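(* Let $D$ be a Dedekind domain that is not a field, let $M$ and $N$ be finitely generated $D$-modules, and write $T_M=\tau(M)$ and $T_N=\tau(N)$. (i) $M\oplus N$ is C4 if and only if $\operatorname{rank}_D M+\operatorname{rank}_D N\le1$, every primary component of both $T_M$ and $T_N$ is homocyclic, and, whenever $(T_M)_{\mathfrak p}$ and $(T_N)_{\mathfrak p}$ are both nonzero, $e_{\mathfrak p}((T_M)_{\mathfrak p})=e_{\mathfrak p}((T_N)_{\mathfrak p})$. (ii) $M\oplus N$ is C4$^*$ if and only if $\operatorname{rank}_D M+\operatorname{rank}_D N\le1$, every primary component of $T_M$ and $T_N$ is cyclic or semisimple, and, for every prime in the common support of $T_M$ and $T_N$, both primary components at that prime are semisimple. (iii) $M\oplus N$ is always semi-weak-CS, and it is strongly C4$^*$ exactly under the conditions in (ii).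
   Context: $\tau(M)=\{x\in M: xd=0\text{ for some }0\ne d\in D\}$ is the torsion submodule, $\operatorname{rank}_D M=\dim_K(K\otimes_D M)$ with $K$ the fraction field of $D$, and $T_{\mathfrak p}$ denotes the $\mathfrak p$-primary component of a finite-length torsion module $T$, for $\mathfrak p$ a nonzero prime ideal. A $\mathfrak p$-primary module is homocyclic if it is a (finite) direct sum of copies of $D/\mathfrak p^{\lambda}$ for a single $\lambda\ge 1$; for a nonzero homocyclic $\mathfrak p$-primary module $X$, $e_{\mathfrak p}(X)$ denotes this common exponent $\lambda$. A module $M$ is a C4-module if, whenever $M=A\oplus B$ (internal direct sum) and $f:A\to B$ is a homomorphism such that $\ker f$ is a direct summand of $A$, the image $\operatorname{Im} f$ is a direct summand of $B$. A module is C4$^*$ if every submodule of it is a C4-module. For a module $M$, $\mathcal S(M)$ is the set of triples $(X,Y,\varphi)$ where $X,Y$ are semisimple direct summands of $M$ with $X\cap Y=0$ and $\varphi:X\to Y$ is an isomorphism. It is partially ordered by $(X,Y,\varphi)\preccurlyeq(X',Y',\varphi')$ iff $X\le X'$, $Y\le Y'$ and $\varphi'|_X=\varphi$. For a chain $\mathcal C\subseteq\mathcal S(M)$, put $X_{\mathcal C}=\bigcup_{(X,Y,\varphi)\in\mathcal C}X$ and $Y_{\mathcal C}=\bigcup_{(X,Y,\varphi)\in\mathcal C}Y$. The module $M$ is semi-weak-CS if for every chain $\mathcal C\subseteq\mathcal S(M)$ there are direct summands $A,B$ of $M$ such that $X_{\mathcal C}$ is an essential submodule of $A$ and $Y_{\mathcal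 C}$ is an essential submodule of $B$. A module is strongly C4$^*$ if it is both C4$^*$ and semi-weak-CS. *)

theory Defs
  imports
    "HOL-Analysis.Product_Vector"
    "HOL-Computational_Algebra.Polynomial_Factorial"
    "HOL-Library.Poly_Mapping"
    "HOL-Library.Set_Algebras"
    "HOL-Library.FuncSet"
begin

text \<open>
  A module over a commutative ring is a scaling function \<open>s\<close> with \<open>module s\<close>; its submodules are the
  sets satisfying \<open>module.subspace s\<close>. Properties of modules are stated for a submodule \<open>S\<close> of the
  ambient module, so that they apply verbatim to submodules; the module itself is \<open>UNIV\<close>.
\<close>

section \<open>Dedekind domains\<close>

abbreviation ideal :: "'d::comm_ring_1 set \<Rightarrow> bool"
  where "ideal \<equiv> module.subspace (*)"

definition prime_ideal :: "'d::comm_ring_1 set \<Rightarrow> bool"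
  where "prime_ideal P \<longleftrightarrow>
    ideal P \<and> P \<noteq> UNIV \<and> (\<forall>a b. a * b \<in> P \<longrightarrow> a \<in> P \<or> b \<in> P)"

definition maximal_ideal :: "'d::comm_ring_1 set \<Rightarrow> bool"
  where "maximal_ideal P \<longleftrightarrow>
    ideal P \<and> P \<noteq> UNIV \<and> (\<forall>J. ideal J \<and> P \<subseteq> J \<longrightarrow> J = P \<or> J = UNIV)"

primrec ideal_power :: "'d::comm_ring_1 set \<Rightarrow> nat \<Rightarrow> 'd set"
  where
    "ideal_power P 0 = UNIV"
  | "ideal_power P (Suc n) = module.span (*) {a * b | a b. a \<in> P \<and> b \<in> ideal_power P n}"

definition noetherian_domain :: "'d::idom itself \<Rightarrow> bool"
  where "noetherian_domain D \<longleftrightarrow>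
    (\<forall>I :: 'd set. ideal I \<longrightarrow> (\<exists>B. finite B \<and> I = module.span (*) B))"

definition integrally_closed_domain :: "'d::idom itself \<Rightarrow> bool"
  where "integrally_closed_domain D \<longleftrightarrow>
    (\<forall>(x :: 'd fract) (q :: 'd poly).
      lead_coeff q = 1 \<and> poly (fract_poly q) x = 0 \<longrightarrow> x \<in> range to_fract)"

text \<open>Fields satisfy this predicate; they are excluded separately where needed.\<close>

definition dedekind_domain :: "'d::idom itself \<Rightarrow> bool"
  where "dedekind_domain D \<longleftrightarrow>
    noetherian_domain D \<and> integrally_closed_domain D \<and>
    (\<forall>P :: 'd set. prime_ideal P \<and> P \<noteq> {0} \<longrightarrow> maximal_ideal P)"

definition is_field :: "'d::idom itself \<Rightarrow> bool"
  where "is_field D \<longleftrightarrow> (\<forall>a :: 'd. a \<noteq> 0 \<longrightarrow> (\<exists>b. a * b = 1))"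

section \<open>Modules, direct sums and homomorphisms\<close>

definition finitely_generated :: "('d::comm_ring_1 \<Rightarrow> 'm::ab_group_add \<Rightarrow> 'm) \<Rightarrow> bool"
  where "finitely_generated s \<longleftrightarrow> (\<exists>B. finite B \<and> module.span s B = UNIV)"

definition is_direct_sum ::
    "('d::comm_ring_1 \<Rightarrow> 'm::ab_group_add \<Rightarrow> 'm) \<Rightarrow> 'm set \<Rightarrow> 'm set \<Rightarrow> 'm set \<Rightarrow> bool"
  where "is_direct_sum s S A B \<longleftrightarrow>
    module.subspace s A \<and> module.subspace s B \<and> A \<inter> B = {0} \<and> A + B = S"

definition direct_summand ::
    "('d::comm_ring_1 \<Rightarrow> 'm::ab_group_add \<Rightarrow> 'm) \<Rightarrow> 'm set \<Rightarrow> 'm set \<Rightarrow> bool"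
  where "direct_summand s A S \<longleftrightarrow> (\<exists>B. is_direct_sum s S A B)"

definition hom_on ::
    "('d::comm_ring_1 \<Rightarrow> 'm::ab_group_add \<Rightarrow> 'm) \<Rightarrow> 'm set \<Rightarrow> 'm set \<Rightarrow> ('m \<Rightarrow> 'm) \<Rightarrow> bool"
  where "hom_on s A B f \<longleftrightarrow>
    f ` A \<subseteq> B \<and> (\<forall>x\<in>A. \<forall>y\<in>A. f (x + y) = f x + f y) \<and> (\<forall>r. \<forall>x\<in>A. f (s r x) = s r (f x))"

definition iso_on ::
    "('d::comm_ring_1 \<Rightarrow> 'm::ab_group_add \<Rightarrow> 'm) \<Rightarrow> 'm set \<Rightarrow> 'm set \<Rightarrow> ('m \<Rightarrow> 'm) \<Rightarrow> bool"
  where "iso_on s A B f \<longleftrightarrow> hom_on s A B f \<and> bij_betw f A B"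

definition essential_in ::
    "('d::comm_ring_1 \<Rightarrow> 'm::ab_group_add \<Rightarrow> 'm) \<Rightarrow> 'm set \<Rightarrow> 'm set \<Rightarrow> bool"
  where "essential_in s X A \<longleftrightarrow>
    module.subspace s X \<and> X \<subseteq> A \<and>
    (\<forall>L. module.subspace s L \<and> L \<subseteq> A \<and> L \<inter> X = {0} \<longrightarrow> L = {0})"

definition cyclic_module :: "('d::comm_ring_1 \<Rightarrow> 'm::ab_group_add \<Rightarrow> 'm) \<Rightarrow> 'm set \<Rightarrow> bool"
  where "cyclic_module s X \<longleftrightarrow> (\<exists>x. X = module.span s {x})"

definition simple_module :: "('d::comm_ring_1 \<Rightarrow> 'm::ab_group_add \<Rightarrow> 'm) \<Rightarrow> 'm set \<Rightarrow> bool"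
  where "simple_module s X \<longleftrightarrow>
    module.subspace s X \<and> X \<noteq> {0} \<and>
    (\<forall>L. module.subspace s L \<and> L \<subseteq> X \<longrightarrow> L = {0} \<or> L = X)"

text \<open>Semisimple: the sum of its simple submodules; the zero module is semisimple.\<close>

definition semisimple_module :: "('d::comm_ring_1 \<Rightarrow> 'm::ab_group_add \<Rightarrow> 'm) \<Rightarrow> 'm set \<Rightarrow> bool"
  where "semisimple_module s X \<longleftrightarrow>
    X = module.span s (\<Union>{L. simple_module s L \<and> L \<subseteq> X})"

section \<open>Torsion and primary components\<close>

definition torsion :: "('d::idom \<Rightarrow> 'm::ab_group_add \<Rightarrow> 'm) \<Rightarrow> 'm set"
  where "torsion s = {x. \<exists>d. d \<noteq> 0 \<and> s d x = 0}"

definition primary_component ::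
    "('d::idom \<Rightarrow> 'm::ab_group_add \<Rightarrow> 'm) \<Rightarrow> 'd set \<Rightarrow> 'm set \<Rightarrow> 'm set"
  where "primary_component s P T = {x \<in> T. \<exists>n. \<forall>d \<in> ideal_power P n. s d x = 0}"

text \<open>
  The primes at which the localisation of \<open>T\<close> is nonzero: the fraction \<open>x/1\<close> is nonzero in the
  localisation at \<open>P\<close> iff no element outside \<open>P\<close> annihilates \<open>x\<close>.
\<close>

definition support :: "('d::idom \<Rightarrow> 'm::ab_group_add \<Rightarrow> 'm) \<Rightarrow> 'm set \<Rightarrow> 'd set set"
  where "support s T = {P. prime_ideal P \<and> (\<exists>x\<in>T. \<forall>d. d \<notin> P \<longrightarrow> s d x \<noteq> 0)}"

text \<open>
  An isomorphism from the quotient module of the ring by the ideal \<open>I\<close>, whose elements are the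
  cosets \<open>a +o I\<close>, onto \<open>X\<close>.
\<close>

definition quotient_iso ::
    "('d::comm_ring_1 \<Rightarrow> 'm::ab_group_add \<Rightarrow> 'm) \<Rightarrow> 'd set \<Rightarrow> 'm set \<Rightarrow> ('d set \<Rightarrow> 'm) \<Rightarrow> bool"
  where "quotient_iso s I X \<phi> \<longleftrightarrow>
    bij_betw \<phi> (range (\<lambda>a. a +o I)) X \<and>
    (\<forall>a b. \<phi> ((a + b) +o I) = \<phi> (a +o I) + \<phi> (b +o I)) \<and>
    (\<forall>r a. \<phi> ((r * a) +o I) = s r (\<phi> (a +o I)))"

text \<open>
  \<open>X\<close> is the internal direct sum of \<open>n\<close> submodules \<open>C 0, \<dots>, C (n - 1)\<close>, each isomorphic to the
  quotient of the ring by the \<open>l\<close>-th power of \<open>P\<close>; \<open>n = 0\<close> gives the zero module.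
\<close>

definition homocyclic_of_exponent ::
    "('d::idom \<Rightarrow> 'm::ab_group_add \<Rightarrow> 'm) \<Rightarrow> 'd set \<Rightarrow> nat \<Rightarrow> 'm set \<Rightarrow> bool"
  where "homocyclic_of_exponent s P l X \<longleftrightarrow>
    (\<exists>(n :: nat) C.
      (\<forall>i<n. module.subspace s (C i) \<and> (\<exists>\<phi>. quotient_iso s (ideal_power P l) (C i) \<phi>)) \<and>
      bij_betw (\<lambda>c. \<Sum>i<n. c i) (Pi\<^sub>E {..<n} C) X)"

definition homocyclic ::
    "('d::idom \<Rightarrow> 'm::ab_group_add \<Rightarrow> 'm) \<Rightarrow> 'd set \<Rightarrow> 'm set \<Rightarrow> bool"
  where "homocyclic s P X \<longleftrightarrow> (\<exists>l\<ge>1. homocyclic_of_exponent s P l X)"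

definition homocyclic_exponent ::
    "('d::idom \<Rightarrow> 'm::ab_group_add \<Rightarrow> 'm) \<Rightarrow> 'd set \<Rightarrow> 'm set \<Rightarrow> nat"
  where "homocyclic_exponent s P X = (THE l. l \<ge> 1 \<and> homocyclic_of_exponent s P l X)"

section \<open>Rank\<close>

text \<open>
  With \<open>K\<close> the fraction field of the ring, \<open>K \<otimes> M\<close> is the free abelian group on \<open>K \<times> M\<close> modulo the
  subgroup generated by the bilinearity relations, and \<open>K\<close> acts on the first factor.
\<close>

definition tensor_relations ::
    "('d::idom \<Rightarrow> 'm::ab_group_add \<Rightarrow> 'm) \<Rightarrow> (('d fract \<times> 'm) \<Rightarrow>\<^sub>0 int) set"
  where "tensor_relations s = module.span frag_cmul
    ({frag_of (a + b, x) - frag_of (a, x) - frag_of (b, x) | a b x. True} \<union>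
     {frag_of (a, x + y) - frag_of (a, x) - frag_of (a, y) | a x y. True} \<union>
     {frag_of (to_fract r * a, x) - frag_of (a, s r x) | r a x. True})"

definition tensor_class ::
    "('d::idom \<Rightarrow> 'm::ab_group_add \<Rightarrow> 'm) \<Rightarrow> (('d fract \<times> 'm) \<Rightarrow>\<^sub>0 int) \<Rightarrow> (('d fract \<times> 'm) \<Rightarrow>\<^sub>0 int) set"
  where "tensor_class s t = t +o tensor_relations s"

definition tensor_scale ::
    "'d::idom fract \<Rightarrow> (('d fract \<times> 'm) \<Rightarrow>\<^sub>0 int) \<Rightarrow> (('d fract \<times> 'm) \<Rightarrow>\<^sub>0 int)"
  where "tensor_scale k = frag_extend (\<lambda>(a, x). frag_of (k * a, x))"

text \<open>
  The classes of \<open>t 0, \<dots>, t (n - 1)\<close> form a \<open>K\<close>-basis of \<open>K \<otimes> M\<close>: every element is a linear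
  combination of them for exactly one tuple of coefficients.
\<close>

definition tensor_basis ::
    "('d::idom \<Rightarrow> 'm::ab_group_add \<Rightarrow> 'm) \<Rightarrow> nat \<Rightarrow> (nat \<Rightarrow> (('d fract \<times> 'm) \<Rightarrow>\<^sub>0 int)) \<Rightarrow> bool"
  where "tensor_basis s n t \<longleftrightarrow>
    bij_betw (\<lambda>c. tensor_class s (\<Sum>i<n. tensor_scale (c i) (t i)))
      ({..<n} \<rightarrow>\<^sub>E UNIV) (range (tensor_class s))"

text \<open>Only meaningful when \<open>K \<otimes> M\<close> is finite-dimensional, for instance for finitely generated \<open>M\<close>.\<close>

definition module_rank :: "('d::idom \<Rightarrow> 'm::ab_group_add \<Rightarrow> 'm) \<Rightarrow> nat"
  where "module_rank s = (THE n. \<exists>t. tensor_basis s n t)"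

section \<open>C4-modules and semi-weak-CS modules\<close>

definition C4 :: "('d::comm_ring_1 \<Rightarrow> 'm::ab_group_add \<Rightarrow> 'm) \<Rightarrow> 'm set \<Rightarrow> bool"
  where "C4 s S \<longleftrightarrow>
    (\<forall>A B f. is_direct_sum s S A B \<and> hom_on s A B f \<and> direct_summand s {x\<in>A. f x = 0} A
      \<longrightarrow> direct_summand s (f ` A) B)"

definition C4_star :: "('d::comm_ring_1 \<Rightarrow> 'm::ab_group_add \<Rightarrow> 'm) \<Rightarrow> 'm set \<Rightarrow> bool"
  where "C4_star s S \<longleftrightarrow> (\<forall>L. module.subspace s L \<and> L \<subseteq> S \<longrightarrow> C4 s L)"

text \<open>
  The maps are made extensional (constant outside \<open>X\<close>), so that a triple is determined by the actual
  map from \<open>X\<close> to \<open>Y\<close> and the relation below is antisymmetric.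
\<close>

definition summand_isos ::
    "('d::comm_ring_1 \<Rightarrow> 'm::ab_group_add \<Rightarrow> 'm) \<Rightarrow> 'm set \<Rightarrow> ('m set \<times> 'm set \<times> ('m \<Rightarrow> 'm)) set"
  where "summand_isos s S = {(X, Y, \<phi>).
    semisimple_module s X \<and> semisimple_module s Y \<and>
    direct_summand s X S \<and> direct_summand s Y S \<and> X \<inter> Y = {0} \<and>
    \<phi> \<in> extensional X \<and> iso_on s X Y \<phi>}"

definition summand_isos_order ::
    "('d::comm_ring_1 \<Rightarrow> 'm::ab_group_add \<Rightarrow> 'm) \<Rightarrow> 'm set \<Rightarrow>
      (('m set \<times> 'm set \<times> ('m \<Rightarrow> 'm)) \<times> ('m set \<times> 'm set \<times> ('m \<Rightarrow> 'm))) set"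
  where "summand_isos_order s S = {((X, Y, \<phi>), (X', Y', \<phi>')).
    (X, Y, \<phi>) \<in> summand_isos s S \<and> (X', Y', \<phi>') \<in> summand_isos s S \<and>
    X \<subseteq> X' \<and> Y \<subseteq> Y' \<and> restrict \<phi>' X = \<phi>}"

text \<open>
  Chains are taken nonempty: the set-theoretic union over the empty chain is not a submodule, and
  with the convention that it is the zero submodule the condition holds trivially (\<open>A = B = {0}\<close>).
\<close>

definition semi_weak_CS :: "('d::comm_ring_1 \<Rightarrow> 'm::ab_group_add \<Rightarrow> 'm) \<Rightarrow> 'm set \<Rightarrow> bool"
  where "semi_weak_CS s S \<longleftrightarrow>
    (\<forall>\<C> \<in> Chains (summand_isos_order s S). \<C> \<noteq> {} \<longrightarrow>
      (\<exists>A B. direct_summand s A S \<and> direct_summand s B S \<and>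
        essential_in s (\<Union>(X, Y, \<phi>)\<in>\<C>. X) A \<and> essential_in s (\<Union>(X, Y, \<phi>)\<in>\<C>. Y) B))"

definition strongly_C4_star :: "('d::comm_ring_1 \<Rightarrow> 'm::ab_group_add \<Rightarrow> 'm) \<Rightarrow> 'm set \<Rightarrow> bool"
  where "strongly_C4_star s S \<longleftrightarrow> C4_star s S \<and> semi_weak_CS s S"

end

theory Submission
  imports Defs
begin

text \<open>
  Everything is reduced to one statement about submodules \<open>S\<close> of a finitely generated module: \<open>S\<close> is C4
  iff any two elements of \<open>S\<close> are linearly dependent and every primary component \<open>X\<close> of \<open>S\<close> is
  homogeneous, that is, with a uniformizer \<open>p\<close> at the prime there is an \<open>l \<ge> 1\<close> with \<open>p\<^sup>l X = 0\<close> and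
  \<open>{x \<in> X. p x = 0} \<subseteq> p\<^sup>l\<^sup>-\<^sup>1 X\<close>. This condition passes to and from direct sums at once, and it makes \<open>X\<close>
  injective relative to modules killed by \<open>p\<^sup>l\<close>: a homogeneous torsion submodule of a module whose primary
  components have the same exponents is a direct summand. For finitely generated primary modules it is
  equivalent to being homocyclic. The C4* property follows by applying the criterion to submodules, and
  semi-weak-CS holds because chains of submodules of a noetherian module stabilize.
\<close>

section \<open>Noetherian modules\<close>

text \<open>No localization is ever formed. A prime P enters through two ring elements, a
  uniformizer \<open>p\<close> in P and a denominator \<open>u\<close> outside P with u P inside p
  D, and local statements are proved up to a multiplier outside P. Such multipliers act bijectively
  on P-primary elements, so they can be removed at the end. Homogeneity is chosen because it speaks
  of elements and not of a decomposition: it can be tested on arbitrary submodules, and asking for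
  one exponent on a direct sum encodes both the shape of the two components and the equality of
  their exponents. Decompositions arise only from maximality: a largest homogeneous submodule splits
  off, and a nonzero component left in the complement would either enlarge it or violate C4. The
  rank bound needs another source of summands: nonzero ideals are projective, so a linear functional
  splits off its image. Only there does the existence of a nonzero nonunit, that is, D not being a
  field, enter.\<close>

lemma module_mult: "module ((*) :: 'd::comm_ring_1 \<Rightarrow> 'd \<Rightarrow> 'd)"
  by unfold_locales (auto simp: algebra_simps)

lemmas ideal_0 = module.subspace_0[OF module_mult]
  and ideal_add = module.subspace_add[OF module_mult]
  and ideal_diff = module.subspace_diff[OF module_mult]
  and ideal_scale = module.subspace_scale[OF module_mult]
  and idealI = module.subspaceI[OF module_mult]

lemma ideal_eq_UNIV: "ideal I \<Longrightarrow> 1 \<in> I \<Longrightarrow> I = UNIV"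
  using ideal_scale[of I 1] by auto

locale noetherian_module = module scale
  for scale :: "'d::comm_ring_1 \<Rightarrow> 'm::ab_group_add \<Rightarrow> 'm" (infixr \<open>*s\<close> 75) +
  assumes noetherian: "subspace N \<Longrightarrow> \<exists>B. finite B \<and> N = span B"
begin

text \<open>The union is a submodule, hence generated by a finite set, and a finite subset of the
  union of a chain lies in a single member.\<close>

lemma Union_chain_in:
  assumes "\<C> \<noteq> {}" and sub: "\<And>X. X \<in> \<C> \<Longrightarrow> subspace X"
    and total: "\<And>X Y. X \<in> \<C> \<Longrightarrow> Y \<in> \<C> \<Longrightarrow> X \<subseteq> Y \<or> Y \<subseteq> X"
  shows "\<Union>\<C> \<in> \<C>"
proof -
  have "subspace (\<Union>\<C>)"
  proof (rule subspaceI)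
    show "0 \<in> \<Union>\<C>" using assms(1) sub subspace_0 by blast
    show "x + y \<in> \<Union>\<C>" if "x \<in> \<Union>\<C>" "y \<in> \<Union>\<C>" for x y
    proof -
      obtain X Y where XY: "X \<in> \<C>" "x \<in> X" "Y \<in> \<C>" "y \<in> Y"
        using \<open>x \<in> \<Union>\<C>\<close> \<open>y \<in> \<Union>\<C>\<close> by blast
      obtain Z where "Z \<in> \<C>" "x \<in> Z" "y \<in> Z" using total[OF XY(1,3)] XY by blast
      then have "x + y \<in> Z" using subspace_add[OF sub[of Z]] by blast
      then show ?thesis using \<open>Z \<in> \<C>\<close> by (rule UnionI[rotated])
    qed
    show "c *s x \<in> \<Union>\<C>" if "x \<in> \<Union>\<C>" for c x
      using that sub subspace_scale by blast
  qed
  from noetherian[OF this] obtain B where B: "finite B" "\<Union>\<C> = span B" by auto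
  have "subset.chain \<C> \<C>" using total by (auto simp: subset_chain_def)
  moreover have "B \<subseteq> \<Union>\<C>" using B(2) span_superset by metis
  ultimately obtain X where X: "X \<in> \<C>" "B \<subseteq> X"
    using finite_subset_Union_chain[OF B(1) _ assms(1)] by metis
  have "\<Union>\<C> \<subseteq> X" using B(2) span_minimal[OF X(2) sub[OF X(1)]] by simp
  then have "\<Union>\<C> = X" using X(1) by blast
  then show ?thesis using X(1) by simp
qed

text \<open>The ascending chain condition in the form used throughout: it supplies maximal
  annihilators, complements and largest homogeneous submodules.\<close>

lemma maximal_submodule:
  assumes "\<A> \<noteq> {}" and sub: "\<And>X. X \<in> \<A> \<Longrightarrow> subspace X"
  obtains M where "M \<in> \<A>" "\<And>X. X \<in> \<A> \<Longrightarrow> M \<subseteq> X \<Longrightarrow> X = M"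
proof -
  have "\<exists>M\<in>\<A>. \<forall>X\<in>\<A>. M \<subseteq> X \<longrightarrow> X = M"
  proof (rule subset_Zorn_nonempty[OF assms(1)])
    fix \<C> assume C: "\<C> \<noteq> {}" "subset.chain \<A> \<C>"
    have "\<Union>\<C> \<in> \<C>"
      using C sub by (intro Union_chain_in) (auto simp: subset_chain_def)
    then show "\<Union>\<C> \<in> \<A>" using C(2) by (auto simp: subset_chain_def)
  qed
  then show thesis using that by blast
qed

end

lemma noetherian_ring_module:
  assumes "noetherian_domain TYPE('d::idom)"
  shows "noetherian_module ((*) :: 'd \<Rightarrow> 'd \<Rightarrow> 'd)"
proof -
  interpret module "(*) :: 'd \<Rightarrow> 'd \<Rightarrow> 'd" by (rule module_mult)
  show ?thesis
    using assms by unfold_locales (simp add: noetherian_domain_def)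
qed

text \<open>The coefficients of \<open>b\<close> in elements of N, taken modulo span B, form an
  ideal \<open>?I\<close>. Lifts \<open>n g\<close> of finitely many generators of \<open>?I\<close>
  reduce an element of N to one of N \<inter> span B, to which the induction hypothesis
  applies.\<close>

lemma (in module) span_insert_noetherian:
  assumes R: "\<And>I :: 'a set. ideal I \<Longrightarrow> \<exists>G. finite G \<and> I = module.span (*) G"
    and IH: "\<And>N. subspace N \<Longrightarrow> N \<subseteq> span B \<Longrightarrow> \<exists>G. finite G \<and> N = span G"
    and N: "subspace N" "N \<subseteq> span (insert b B)"
  shows "\<exists>G. finite G \<and> N = span G"
proof -
  let ?I = "{r. \<exists>x\<in>N. x - r *s b \<in> span B}"
  have "ideal ?I"
  proof (rule idealI)
    show "0 \<in> ?I" using subspace_0[OF N(1)] span_zero by auto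
    show "r + t \<in> ?I" if "r \<in> ?I" "t \<in> ?I" for r t
    proof -
      from that obtain x y where "x \<in> N" "x - r *s b \<in> span B" "y \<in> N" "y - t *s b \<in> span B"
        by blast
      then have "x + y \<in> N" "(x - r *s b) + (y - t *s b) \<in> span B"
        using subspace_add[OF N(1)] span_add by blast+
      moreover have "(x - r *s b) + (y - t *s b) = (x + y) - (r + t) *s b"
        by (simp add: algebra_simps)
      ultimately show ?thesis by auto
    qed
    show "c * r \<in> ?I" if "r \<in> ?I" for c r
    proof -
      from that obtain x where "x \<in> N" "x - r *s b \<in> span B" by blast
      then have "c *s x \<in> N" "c *s (x - r *s b) \<in> span B"
        using subspace_scale[OF N(1)] span_scale by blast+
      then show ?thesis by (auto simp: scale_right_diff_distrib)
    qed
  qed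
  from R[OF this] obtain G where G: "finite G" "?I = module.span (*) G" by auto
  have "\<forall>g\<in>G. \<exists>x\<in>N. x - g *s b \<in> span B"
    using G(2) module.span_base[OF module_mult] by blast
  then obtain n where n: "\<And>g. g \<in> G \<Longrightarrow> n g \<in> N" "\<And>g. g \<in> G \<Longrightarrow> n g - g *s b \<in> span B"
    by metis
  obtain B' where B': "finite B'" "N \<inter> span B = span B'"
    using IH[of "N \<inter> span B"] subspace_inter[OF N(1)] by auto
  have nG: "\<exists>z\<in>span (n ` G). z - r *s b \<in> span B" if "r \<in> module.span (*) G" for r
    using that
  proof (induction r rule: module.span_induct_alt[OF module_mult, consumes 1])
    case (1) then show ?case using span_zero by auto
  next
    case (2 c x y)
    then obtain z where z: "z \<in> span (n ` G)" "z - y *s b \<in> span B" by blast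
    have "c *s n x + z \<in> span (n ` G)" using z 2 by (auto intro: span_add span_scale span_base)
    moreover have "c *s (n x - x *s b) + (z - y *s b) \<in> span B"
      using z n 2 by (auto intro: span_add span_scale)
    ultimately show ?case by (intro bexI[of _ "c *s n x + z"]) (auto simp: algebra_simps)
  qed
  have "N \<subseteq> span (B' \<union> n ` G)"
  proof
    fix x assume x: "x \<in> N"
    then obtain r where "x - r *s b \<in> span B" using N(2) span_insert by blast
    then obtain z where z: "z \<in> span (n ` G)" "z - r *s b \<in> span B"
      using nG x G(2) by blast
    have "z \<in> N" using z(1) span_minimal[of "n ` G" N] n(1) N(1) by blast
    then have "x - z \<in> N \<inter> span B"
      using x subspace_diff[OF N(1)] span_diff[OF \<open>x - r *s b \<in> span B\<close> z(2)] by auto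
    then have "x - z \<in> span (B' \<union> n ` G)" using B'(2) span_mono[of B' "B' \<union> n ` G"] by blast
    moreover have "z \<in> span (B' \<union> n ` G)" using z(1) span_mono[of "n ` G" "B' \<union> n ` G"] by blast
    ultimately show "x \<in> span (B' \<union> n ` G)" using span_add by fastforce
  qed
  moreover have "span (B' \<union> n ` G) \<subseteq> N"
    using B'(2) span_superset[of B'] n(1) by (intro span_minimal N(1)) auto
  ultimately show ?thesis using B'(1) G(1) by (intro exI[of _ "B' \<union> n ` G"]) auto
qed

lemma noetherian_module_if_finitely_generated:
  assumes D: "noetherian_domain TYPE('d::idom)" and s: "module (s :: 'd \<Rightarrow> 'm::ab_group_add \<Rightarrow> 'm)"
    and fg: "finitely_generated s"
  shows "noetherian_module s"
proof -
  interpret module s by (rule s)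
  obtain B where B: "finite B" "span B = UNIV" using fg by (auto simp: finitely_generated_def)
  have "\<forall>N. subspace N \<longrightarrow> N \<subseteq> span B \<longrightarrow> (\<exists>G. finite G \<and> N = span G)"
    using B(1)
  proof induction
    case empty
    then show ?case
      by (metis finite.emptyI span_empty subset_singletonD subspace_0 empty_iff)
  next
    case (insert b B)
    show ?case
    proof (intro allI impI)
      fix N assume N: "subspace N" "N \<subseteq> span (insert b B)"
      show "\<exists>G. finite G \<and> N = span G"
        by (rule span_insert_noetherian[OF _ _ N])
          (use D insert.IH in \<open>auto simp: noetherian_domain_def\<close>)
    qed
  qed
  then show ?thesis using B(2) by unfold_locales auto
qed

text \<open>An annihilator of an element of \<open>B/G\<close> that is maximal among such annihilators is prime.\<close>

lemma associated_prime:
  assumes D: "noetherian_domain TYPE('d::idom)" and s: "module (s :: 'd \<Rightarrow> 'm::ab_group_add \<Rightarrow> 'm)"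
    and G: "module.subspace s G" and B: "module.subspace s B" and "x0 \<in> B" "x0 \<notin> G"
  obtains x where "x \<in> B" "x \<notin> G" "prime_ideal {d. s d x \<in> G}"
proof -
  interpret module s by (rule s)
  interpret R: noetherian_module "(*) :: 'd \<Rightarrow> 'd \<Rightarrow> 'd" by (rule noetherian_ring_module[OF D])
  let ?A = "{{d. s d x \<in> G} | x. x \<in> B \<and> x \<notin> G}"
  have id: "ideal {d. s d x \<in> G}" for x
  proof (rule idealI)
    show "c * d \<in> {d. s d x \<in> G}" if "d \<in> {d. s d x \<in> G}" for c d
      using subspace_scale[OF G, of "s d x" c] that by simp
    show "c + d \<in> {d. s d x \<in> G}" if "c \<in> {d. s d x \<in> G}" "d \<in> {d. s d x \<in> G}" for c d
      using subspace_add[OF G, of "s c x" "s d x"] that by (simp add: scale_left_distrib)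
  qed (simp add: subspace_0[OF G])
  have "?A \<noteq> {}" using assms(5,6) by blast
  then obtain M where M: "M \<in> ?A" "\<And>X. X \<in> ?A \<Longrightarrow> M \<subseteq> X \<Longrightarrow> X = M"
    by (rule R.maximal_submodule) (use id in auto)
  then obtain x where x: "x \<in> B" "x \<notin> G" "M = {d. s d x \<in> G}" by blast
  have "prime_ideal M"
    unfolding prime_ideal_def
  proof (intro conjI allI impI)
    show "ideal M" using id x(3) by simp
    show "M \<noteq> UNIV" using x(2,3) by (metis UNIV_I mem_Collect_eq scale_one)
    fix a b assume ab: "a * b \<in> M"
    show "a \<in> M \<or> b \<in> M"
    proof (rule disjCI)
      assume "b \<notin> M"
      then have "s b x \<in> B" "s b x \<notin> G" using x subspace_scale[OF B] by auto
      then have "{d. s d (s b x) \<in> G} \<in> ?A" by blast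
      moreover have "M \<subseteq> {d. s d (s b x) \<in> G}"
      proof
        fix d assume "d \<in> M"
        then have "s b (s d x) \<in> G" using x(3) subspace_scale[OF G] by blast
        then show "d \<in> {d. s d (s b x) \<in> G}" using scale_left_commute[of b d x] by (simp del: scale_scale)
      qed
      ultimately have "{d. s d (s b x) \<in> G} = M" using M(2) by blast
      then show "a \<in> M" using ab x(3) by auto
    qed
  qed
  then show thesis using that x by blast
qed

section \<open>Localization of a Dedekind domain at a nonzero prime\<close>

text \<open>J annihilates every element of D/J, so an associated prime of D/J contains J.\<close>

lemma proper_ideal_le_prime:
  assumes D: "noetherian_domain TYPE('d::idom)" and J: "ideal (J :: 'd set)" "1 \<notin> J"
  obtains P where "prime_ideal P" "J \<subseteq> P"
proof -
  obtain x where "x \<notin> J" "prime_ideal {d. d * x \<in> J}"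
    by (rule associated_prime[OF D module_mult J(1) module.subspace_UNIV[OF module_mult] UNIV_I J(2)])
  moreover have "J \<subseteq> {d. d * x \<in> J}" using ideal_scale[OF J(1)] by (auto simp: mult.commute)
  ultimately show thesis using that by blast
qed

locale dedekind_prime =
  fixes P :: "'d::idom set"
  assumes ded: "dedekind_domain TYPE('d)" and prime: "prime_ideal P" and nonzero: "P \<noteq> {0}"
begin

lemma noeth: "noetherian_domain TYPE('d)" using ded by (simp add: dedekind_domain_def)
lemma ideal_P: "ideal P" and proper: "P \<noteq> UNIV" using prime by (auto simp: prime_ideal_def)
lemma prime_mult: "a * b \<in> P \<Longrightarrow> a \<in> P \<or> b \<in> P" using prime by (auto simp: prime_ideal_def)
lemma one_notin: "1 \<notin> P" using ideal_eq_UNIV ideal_P proper by blast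
lemma mult_notin: "a \<notin> P \<Longrightarrow> b \<notin> P \<Longrightarrow> a * b \<notin> P" using prime_mult by blast
lemma power_notin: "a \<notin> P \<Longrightarrow> a ^ n \<notin> P" by (induction n) (auto simp: one_notin mult_notin)
lemma zero_in: "0 \<in> P" by (rule ideal_0[OF ideal_P])
lemma mult_in: "x \<in> P \<Longrightarrow> c * x \<in> P" by (rule ideal_scale[OF ideal_P])

lemma maximal: "ideal J \<Longrightarrow> P \<subseteq> J \<Longrightarrow> J = P \<or> J = UNIV"
  using ded prime nonzero unfolding dedekind_domain_def maximal_ideal_def by blast

lemma eq_if_prime_le: "prime_ideal Q \<Longrightarrow> Q \<noteq> {0} \<Longrightarrow> Q \<subseteq> P \<Longrightarrow> Q = P"
  using ded ideal_P proper unfolding dedekind_domain_def maximal_ideal_def by blast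

text \<open>P + D w is an ideal strictly larger than the maximal ideal P.\<close>

lemma unit_mod:
  assumes "w \<notin> P" obtains v where "1 - v * w \<in> P"
proof -
  let ?J = "{x + c * w | x c. x \<in> P}"
  have "ideal ?J"
  proof (rule idealI)
    show "0 \<in> ?J" using zero_in by force
    show "a + b \<in> ?J" if ab: "a \<in> ?J" "b \<in> ?J" for a b
    proof -
      obtain x c where 1: "x \<in> P" "a = x + c * w" using ab by blast
      obtain y d where 2: "y \<in> P" "b = y + d * w" using ab by blast
      have "x + y \<in> P" "a + b = (x + y) + (c + d) * w"
        using 1 2 ideal_add[OF ideal_P] by (auto simp: algebra_simps)
      then show ?thesis by blast
    qed
    show "c * a \<in> ?J" if a: "a \<in> ?J" for c a
    proof -
      obtain x d where 1: "x \<in> P" "a = x + d * w" using a by blast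
      have "c * x \<in> P" "c * a = c * x + (c * d) * w" using 1 mult_in by (simp_all add: distrib_left mult.assoc)
      then show ?thesis by blast
    qed
  qed
  moreover have "P \<subseteq> ?J" by force
  moreover have "w \<in> ?J" using zero_in by force
  ultimately have "?J = UNIV" using maximal assms by blast
  then obtain x c where "x \<in> P" "1 = x + c * w" by blast
  then have "1 - c * w \<in> P" by (metis add_diff_cancel_right')
  then show thesis using that by blast
qed

text \<open>
  If \<open>bP \<subseteq> aP\<close> with \<open>a \<in> P\<close>, then multiplication by \<open>b/a\<close> maps \<open>P\<close> into itself, so the elements
  \<open>a(b/a)\<^sup>k\<close> all lie in the noetherian ring; hence \<open>b/a\<close> is integral.
\<close>

lemma dvd_if_mult_into:
  assumes a: "a \<in> P" "a \<noteq> 0" and q: "\<And>x. x \<in> P \<Longrightarrow> \<exists>y\<in>P. b * x = a * y"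
  shows "a dvd b"
proof -
  interpret R: noetherian_module "(*) :: 'd \<Rightarrow> 'd \<Rightarrow> 'd" by (rule noetherian_ring_module[OF noeth])
  obtain h where h: "\<And>x. x \<in> P \<Longrightarrow> h x \<in> P" "\<And>x. x \<in> P \<Longrightarrow> b * x = a * h x" using q by metis
  \<comment> \<open>\<open>d k\<close> represents a (b/a)^k inside the ring: \<open>h\<close> sends
    x to (b/a) x.\<close>
  define d where "d k = (h ^^ k) a" for k
  have d: "d k \<in> P" for k by (induction k) (auto simp: d_def a h)
  define c where "c = to_fract b / to_fract a"
  have fd: "to_fract (d k) = to_fract a * c ^ k" for k
  proof (induction k)
    case (Suc k)
    have "to_fract a * to_fract (d (Suc k)) = to_fract b * to_fract (d k)"
      using h(2)[OF d[of k]] by (metis d_def funpow.simps(2) comp_apply to_fract_mult)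
    then show ?case using Suc a by (simp add: c_def field_simps)
  qed (simp add: d_def)
  \<comment> \<open>The submodules spanned by d 0, ..., d (n - 1) increase, so they become
    stationary. This gives a linear relation for d n, which divided by a is a monic equation for
    b/a.\<close>
  obtain M where M: "M \<in> range (\<lambda>n. R.span (d ` {..<n}))"
    "\<And>X. X \<in> range (\<lambda>n. R.span (d ` {..<n})) \<Longrightarrow> M \<subseteq> X \<Longrightarrow> X = M"
    by (rule R.maximal_submodule[of "range (\<lambda>n. R.span (d ` {..<n}))"]) auto
  then obtain n where n: "M = R.span (d ` {..<n})" by auto
  have "R.span (d ` {..<Suc n}) = M"
  proof (rule M(2))
    show "M \<subseteq> R.span (d ` {..<Suc n})" unfolding n by (rule R.span_mono) auto
  qed blast
  then have "d n \<in> R.span (d ` {..<n})" using n by (auto intro: R.span_base)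
  moreover have "\<exists>r. x = (\<Sum>k<n. r k * d k)" if "x \<in> R.span (d ` {..<n})" for x
    using that
  proof (induction rule: R.span_induct_alt)
    case base show ?case by (intro exI[of _ "\<lambda>_. 0"]) auto
  next
    case (step c x y)
    then obtain r k where r: "y = (\<Sum>k<n. r k * d k)" and k: "k < n" "x = d k" by auto
    have "c * x + y = (\<Sum>i<n. (r i + (if i = k then c else 0)) * d i)"
      using k by (simp add: r algebra_simps sum.distrib if_distrib[of "\<lambda>t. _ * t"] cong: if_cong)
    then show ?case by (rule exI[of _ "\<lambda>i. r i + (if i = k then c else 0)"])
  qed
  ultimately obtain r where r: "d n = (\<Sum>k<n. r k * d k)" by blast
  define Q where "Q = monom 1 n - (\<Sum>k<n. monom (r k) k)"
  have coeffQ: "coeff Q i = (if i = n then 1 else if i < n then - r i else 0)" for i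
    by (simp add: Q_def coeff_sum)
  have "degree Q = n"
    by (rule antisym, rule degree_le) (simp_all add: coeffQ le_degree)
  then have lead: "lead_coeff Q = 1" by (simp add: coeffQ)
  have "to_fract a * c ^ n = (\<Sum>k<n. to_fract (r k) * (to_fract a * c ^ k))"
    using arg_cong[OF r, of to_fract] by (simp add: fd)
  also have "\<dots> = to_fract a * (\<Sum>k<n. to_fract (r k) * c ^ k)"
    by (simp add: sum_distrib_left mult_ac)
  finally have cn: "c ^ n = (\<Sum>k<n. to_fract (r k) * c ^ k)" using a by simp
  have "poly (fract_poly Q) c = (\<Sum>i\<le>n. to_fract (coeff Q i) * c ^ i)"
    using \<open>degree Q = n\<close> by (subst poly_altdef) (simp add: coeff_map_poly degree_map_poly)
  also have "{..n} = insert n {..<n}" by auto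
  also have "(\<Sum>i\<in>insert n {..<n}. to_fract (coeff Q i) * c ^ i) = c ^ n - (\<Sum>k<n. to_fract (r k) * c ^ k)"
    by (simp add: coeffQ sum_negf)
  finally have "poly (fract_poly Q) c = 0" using cn by simp
  then have "c \<in> range to_fract"
    using ded lead unfolding dedekind_domain_def integrally_closed_domain_def by blast
  then obtain e where "c = to_fract e" by blast
  then have "to_fract b = to_fract (a * e)" using a by (simp add: c_def field_simps)
  then have "b = a * e" by (simp only: to_fract_eq_iff)
  then show ?thesis by simp
qed


text \<open>The set is the contraction to D of the ideal generated by \<open>a\<close> in the
  localization at P, expressed without fractions.\<close>

lemma ideal_saturation: "ideal {x. \<exists>w. w \<notin> P \<and> a dvd w * x}" (is "ideal ?A")
proof (rule idealI)
  show "0 \<in> ?A" using one_notin by auto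
  show "x + y \<in> ?A" if "x \<in> ?A" "y \<in> ?A" for x y
  proof -
    obtain v where v: "v \<notin> P" "a dvd v * x" using \<open>x \<in> ?A\<close> by blast
    obtain w where w: "w \<notin> P" "a dvd w * y" using \<open>y \<in> ?A\<close> by blast
    have "a dvd w * (v * x) + v * (w * y)" by (intro dvd_add dvd_mult v(2) w(2))
    then have "a dvd (v * w) * (x + y)" by (simp add: algebra_simps)
    then show ?thesis using mult_notin v w by blast
  qed
  show "c * x \<in> ?A" if "x \<in> ?A" for c x
  proof -
    obtain v where v: "v \<notin> P" "a dvd v * x" using \<open>x \<in> ?A\<close> by blast
    then have "a dvd v * (c * x)" by (metis dvd_mult mult.left_commute)
    then show ?thesis using v by blast
  qed
qed

text \<open>The multipliers of finitely many generators of I can be multiplied together without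
  entering the prime P. The factor \<open>b\<close> is carried along because the lemma is applied
  both to b P with a nontrivial b and, with b = 1, to I itself.\<close>

lemma uniform_denominator:
  assumes I: "ideal I" and dvd: "\<And>x. x \<in> I \<Longrightarrow> \<exists>w. w \<notin> P \<and> a dvd w * (b * x)"
  obtains w where "w \<notin> P" "\<And>x. x \<in> I \<Longrightarrow> a dvd w * (b * x)"
proof -
  obtain G where G: "finite G" "I = module.span (*) G"
    using noeth I by (auto simp: noetherian_domain_def)
  have "G \<subseteq> I" using G(2) module.span_superset[OF module_mult] by blast
  with G(1) have "\<exists>w. w \<notin> P \<and> (\<forall>g\<in>G. a dvd w * (b * g))"
  proof induction
    case empty then show ?case using one_notin by blast
  next
    case (insert g G)
    then obtain w where w: "w \<notin> P" "\<forall>g\<in>G. a dvd w * (b * g)" by blast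
    obtain v where v: "v \<notin> P" "a dvd v * (b * g)" using insert.prems dvd by blast
    have "a dvd (w * v) * (b * h)" if "h \<in> insert g G" for h
    proof (cases "h = g")
      case True
      then show ?thesis using v(2) by (metis dvd_mult mult.assoc)
    next
      case False
      then show ?thesis using w(2) that by (metis dvd_mult insertE mult.assoc mult.commute)
    qed
    then show ?case using mult_notin[OF w(1) v(1)] by blast
  qed
  then obtain w where w: "w \<notin> P" "\<forall>g\<in>G. a dvd w * (b * g)" by blast
  have "a dvd w * (b * x)" if "x \<in> I" for x
    using that unfolding G(2)
  proof (induction x rule: module.span_induct_alt[OF module_mult, consumes 1])
    case (2 r x y)
    have "w * (b * (r * x + y)) = r * (w * (b * x)) + w * (b * y)" by (simp add: algebra_simps)
    then show ?case using 2 w(2) by simp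
  qed simp
  then show thesis using that w(1) by blast
qed

text \<open>With \<open>b\<close> chosen such that, locally, its annihilator modulo \<open>a\<close>
  is P, some c outside a D satisfies c P inside a D. If c P were inside a P, integral closedness
  would give a dvd c; hence c x = a y for some x in P and y outside P. For z in P with c z = a z'
  this yields y z = x z', so x and y serve as \<open>p\<close> and \<open>u\<close>.\<close>

lemma ex_uniformizer: "\<exists>p u. p \<in> P \<and> u \<notin> P \<and> (\<forall>x\<in>P. p dvd u * x)"
proof -
  obtain a where a: "a \<in> P" "a \<noteq> 0" using nonzero zero_in by blast
  let ?A = "{x. \<exists>w. w \<notin> P \<and> a dvd w * x}"
  have idA: "ideal ?A" by (rule ideal_saturation)
  have "1 \<notin> ?A" using a mult_in by (auto elim!: dvdE simp: mult.commute[of a])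
  then obtain b where b: "b \<notin> ?A" "prime_ideal {d. d * b \<in> ?A}"
    by (rule associated_prime[OF noeth module_mult idA module.subspace_UNIV[OF module_mult] UNIV_I])
  have "{d. d * b \<in> ?A} \<subseteq> P"
  proof
    fix d assume "d \<in> {d. d * b \<in> ?A}"
    then obtain w where w: "w \<notin> P" "a dvd (w * d) * b" by (auto simp: mult.assoc)
    then show "d \<in> P" using b(1) mult_notin by blast
  qed
  moreover have "a \<in> {d. d * b \<in> ?A}" using one_notin by auto
  \<comment> \<open>The associated prime contains \<open>a\<close>, so it is nonzero; dimension one
    turns its inclusion in P into equality.\<close>
  ultimately have PA: "P = {d. d * b \<in> ?A}" using eq_if_prime_le[OF b(2)] a(2) by blast
  have "\<exists>w. w \<notin> P \<and> a dvd w * (b * x)" if "x \<in> P" for x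
  proof -
    have "x \<in> {d. d * b \<in> ?A}" using that PA by (rule back_subst)
    then show ?thesis by (simp add: mult.commute[of x b])
  qed
  then obtain w where w: "w \<notin> P" "\<And>x. x \<in> P \<Longrightarrow> a dvd w * (b * x)"
    using uniform_denominator[OF ideal_P, of a b] by metis
  define c where "c = w * b"
  have c: "a dvd c * x" if "x \<in> P" for x
    using w(2)[OF that] by (simp add: c_def mult.assoc)
  have "\<not> a dvd c" using b(1) w(1) by (auto simp: c_def)
  then obtain x where x: "x \<in> P" "\<And>y. y \<in> P \<Longrightarrow> c * x \<noteq> a * y"
    using dvd_if_mult_into[OF a, of c] by blast
  obtain y where y: "c * x = a * y" using c[OF x(1)] by (auto elim: dvdE)
  have "x dvd y * z" if z: "z \<in> P" for z
  proof -
    obtain z' where "c * z = a * z'" using c[OF z] by (auto elim: dvdE)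
    then have "a * (y * z) = a * (x * z')" using y by (metis mult.assoc mult.commute)
    then show ?thesis using a(2) by simp
  qed
  then show ?thesis using x y by blast
qed

end

text \<open>A generator of the maximal ideal of the localization at \<open>P\<close>.\<close>

definition uniformizer :: "'d::idom set \<Rightarrow> 'd"
  where "uniformizer P = (SOME p. p \<in> P \<and> (\<exists>u. u \<notin> P \<and> (\<forall>x\<in>P. p dvd u * x)))"

lemma ideal_ideal_power: "ideal (ideal_power P n)"
  by (cases n) (auto simp: module.subspace_UNIV[OF module_mult] module.subspace_span[OF module_mult])

lemma mult_in_ideal_power_Suc: "a \<in> P \<Longrightarrow> b \<in> ideal_power P n \<Longrightarrow> a * b \<in> ideal_power P (Suc n)"
  by (auto intro!: module.span_base[OF module_mult])

lemma ideal_power_Suc_le: "ideal_power P (Suc n) \<subseteq> ideal_power P n"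
  unfolding ideal_power.simps
  by (rule module.span_minimal[OF module_mult _ ideal_ideal_power])
    (use ideal_scale[OF ideal_ideal_power[of P n]] in blast)

lemma ideal_power_antimono: "n \<le> m \<Longrightarrow> ideal_power P m \<subseteq> ideal_power P n"
  by (rule lift_Suc_antimono_le[of "ideal_power P"]) (rule ideal_power_Suc_le)

context dedekind_prime
begin

abbreviation p :: 'd where "p \<equiv> uniformizer P"

text \<open>P is generated by \<open>p\<close> only after localization, so dividing an element of P
  by \<open>p\<close> in D costs a factor; one factor \<open>u\<close> outside P works for all of
  P.\<close>

definition u :: 'd where "u = (SOME u. u \<notin> P \<and> (\<forall>x\<in>P. p dvd u * x))"

lemma p_in: "p \<in> P" and u_notin: "u \<notin> P" and p_dvd: "x \<in> P \<Longrightarrow> p dvd u * x"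
proof -
  have *: "p \<in> P \<and> (\<exists>u. u \<notin> P \<and> (\<forall>x\<in>P. p dvd u * x))"
    unfolding uniformizer_def by (rule someI_ex) (use ex_uniformizer in blast)
  then show "p \<in> P" by blast
  have "u \<notin> P \<and> (\<forall>x\<in>P. p dvd u * x)"
    unfolding u_def by (rule someI_ex) (use * in blast)
  then show "u \<notin> P" and "x \<in> P \<Longrightarrow> p dvd u * x" by auto
qed

lemma p_nonzero: "p \<noteq> 0"
proof
  assume "p = 0"
  obtain a where a: "a \<in> P" "a \<noteq> 0" using nonzero zero_in by blast
  have "u * a = 0" using p_dvd[OF a(1)] \<open>p = 0\<close> by simp
  then show False using a u_notin zero_in by auto
qed

lemma p_mult_in: "p * x \<in> P" using mult_in[OF p_in, of x] by (simp add: mult.commute)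

text \<open>In the localization, \<open>d\<close> is a unit times a power of \<open>p\<close>. A
  counterexample \<open>d\<close> with \<open>J d\<close> maximal lies in P, and d' with u d = p d'
  is again a counterexample. Since \<open>J d\<close> is contained in \<open>J d'\<close>, both
  agree, which makes \<open>p\<close> divide an element outside P.\<close>

lemma factorization:
  assumes "d \<noteq> 0"
  obtains w n w' where "w \<notin> P" "w' \<notin> P" "w * d = p ^ n * w'"
proof -
  interpret R: noetherian_module "(*) :: 'd \<Rightarrow> 'd \<Rightarrow> 'd" by (rule noetherian_ring_module[OF noeth])
  define good where "good d \<longleftrightarrow> (\<exists>w n w'. w \<notin> P \<and> w' \<notin> P \<and> w * d = p ^ n * w')" for d
  define J where "J d = {a. \<exists>w. w \<notin> P \<and> d dvd w * a}" for d
  have idJ: "ideal (J d)" for d unfolding J_def by (rule ideal_saturation)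
  have "good d"
  proof (rule ccontr)
    assume "\<not> good d"
    let ?A = "{J d | d. d \<noteq> 0 \<and> \<not> good d}"
    have "?A \<noteq> {}" using \<open>\<not> good d\<close> assms by blast
    then obtain M where M: "M \<in> ?A" "\<And>X. X \<in> ?A \<Longrightarrow> M \<subseteq> X \<Longrightarrow> X = M"
      by (rule R.maximal_submodule) (use idJ in auto)
    then obtain d where d: "d \<noteq> 0" "\<not> good d" "M = J d" by blast
    have "d \<in> P"
    proof (rule ccontr)
      assume "d \<notin> P"
      then have "1 \<notin> P \<and> d \<notin> P \<and> 1 * d = p ^ 0 * d" using one_notin by simp
      then show False using d(2) unfolding good_def by blast
    qed
    then obtain d' where d': "u * d = p * d'" using p_dvd by (auto elim: dvdE)
    have "d' \<noteq> 0" using d' d(1) u_notin zero_in by auto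
    moreover have "\<not> good d'"
    proof
      assume "good d'"
      then obtain w n w' where w: "w \<notin> P" "w' \<notin> P" "w * d' = p ^ n * w'" unfolding good_def by blast
      have "(w * u) * d = p ^ Suc n * w'"
        using w(3) d' by (metis mult.assoc mult.left_commute power_Suc)
      then show False using d(2) w mult_notin u_notin unfolding good_def by blast
    qed
    moreover have "J d \<subseteq> J d'"
    proof
      fix a assume "a \<in> J d"
      then obtain w where w: "w \<notin> P" "d dvd w * a" by (auto simp: J_def)
      have "d' dvd u * d" using d' by simp
      also have "u * d dvd u * (w * a)" by (rule mult_dvd_mono[OF dvd_refl w(2)])
      finally have "d' dvd (u * w) * a" by (simp only: mult.assoc)
      moreover have "u * w \<notin> P" by (rule mult_notin[OF u_notin w(1)])
      ultimately show "a \<in> J d'" unfolding J_def by blast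
    qed
    ultimately have "J d' = J d" using M(2)[of "J d'"] d(3) by blast
    moreover have "d' \<in> J d'" using one_notin by (auto simp: J_def)
    ultimately obtain w r where w: "w \<notin> P" "w * d' = d * r" unfolding J_def dvd_def by blast
    have "d * (w * u) = d * (p * r)" using w(2) d' by (metis mult.assoc mult.commute)
    then have "w * u = p * r" using d(1) by simp
    then show False using mult_notin[OF w(1) u_notin] p_mult_in by simp
  qed
  then show thesis using that unfolding good_def by blast
qed

text \<open>\<open>i\<close> is an element of least order at P: it divides every other element up to
  a multiplier outside P, and finite generation makes the multiplier uniform.\<close>

lemma locally_principal:
  assumes I: "ideal I" "I \<noteq> {0}"
  obtains i w where "i \<in> I" "w \<notin> P" "\<And>x. x \<in> I \<Longrightarrow> i dvd w * x"
proof -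
  let ?Q = "\<lambda>n. \<exists>i\<in>I. \<exists>w w'. w \<notin> P \<and> w' \<notin> P \<and> w * i = p ^ n * w'"
  obtain i where i: "i \<in> I" "i \<noteq> 0" using I ideal_0 by blast
  obtain w n w' where "w \<notin> P" "w' \<notin> P" "w * i = p ^ n * w'" using i(2) by (rule factorization)
  then have "?Q n" using i(1) by blast
  define m where "m = (LEAST n. ?Q n)"
  have "?Q m" unfolding m_def using \<open>?Q n\<close> by (rule LeastI)
  then obtain i w w' where i: "i \<in> I" "w \<notin> P" "w' \<notin> P" "w * i = p ^ m * w'" by blast
  have "\<exists>v. v \<notin> P \<and> i dvd v * (1 * x)" if x: "x \<in> I" for x
  proof (cases "x = 0")
    case True then show ?thesis using one_notin by auto
  next
    case False
    then obtain v n v' where v: "v \<notin> P" "v' \<notin> P" "v * x = p ^ n * v'" by (rule factorization)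
    then have "m \<le> n" unfolding m_def using x by (intro Least_le) blast
    then have "p ^ n = p ^ m * p ^ (n - m)" by (simp flip: power_add)
    then have "(w' * v) * x = (p ^ m * w') * (p ^ (n - m) * v')" using v(3) by (simp add: mult_ac)
    also have "\<dots> = i * (w * p ^ (n - m) * v')" unfolding i(4)[symmetric] by (simp add: mult_ac)
    finally have "i dvd (w' * v) * (1 * x)" by simp
    then show ?thesis using mult_notin[OF i(3) v(1)] by blast
  qed
  from uniform_denominator[OF I(1) this] obtain v
    where "v \<notin> P" "\<And>x. x \<in> I \<Longrightarrow> i dvd v * (1 * x)" by blast
  then show thesis using that i(1) by simp
qed

lemma p_power_in: "p ^ n \<in> ideal_power P n"
  by (induction n) (auto intro: mult_in_ideal_power_Suc p_in simp del: ideal_power.simps(2))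

lemma p_power_dvd: "d \<in> ideal_power P n \<Longrightarrow> p ^ n dvd u ^ n * d"
proof (induction n arbitrary: d)
  case (Suc n)
  from Suc.prems have "d \<in> module.span (*) {a * b | a b. a \<in> P \<and> b \<in> ideal_power P n}" by simp
  then show ?case
  proof (induction d rule: module.span_induct_alt[OF module_mult, consumes 1])
    case (2 c x y)
    then obtain a b where ab: "a \<in> P" "b \<in> ideal_power P n" "x = a * b" by blast
    have "p * p ^ n dvd (u * a) * (u ^ n * b)" by (intro mult_dvd_mono p_dvd ab Suc.IH)
    moreover have "(u * a) * (u ^ n * b) = u ^ Suc n * x" using ab by (simp add: mult_ac)
    ultimately have "p ^ Suc n dvd c * (u ^ Suc n * x)" by (metis dvd_mult power_Suc)
    moreover have "u ^ Suc n * (c * x + y) = c * (u ^ Suc n * x) + u ^ Suc n * y"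
      by (simp add: algebra_simps)
    ultimately show ?case using 2 by simp
  qed simp
qed simp

text \<open>If v inverts w modulo P^n and v' does so modulo P, the product of the two errors lies in
  P^(n+1) and again differs from 1 by a multiple of w.\<close>

lemma unit_mod_power:
  assumes "w \<notin> P" obtains v where "1 - v * w \<in> ideal_power P n"
proof -
  have "\<exists>v. 1 - v * w \<in> ideal_power P n"
  proof (induction n)
    case (Suc n)
    then obtain v where v: "1 - v * w \<in> ideal_power P n" by blast
    obtain v' where "1 - v' * w \<in> P" using unit_mod[OF assms] .
    then have "(1 - v' * w) * (1 - v * w) \<in> ideal_power P (Suc n)"
      by (rule mult_in_ideal_power_Suc[OF _ v])
    moreover have "(1 - v' * w) * (1 - v * w) = 1 - (v + v' - v' * w * v) * w"
      by (simp add: algebra_simps)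
    ultimately show ?case by metis
  qed simp
  then show thesis using that by blast
qed

text \<open>Since \<open>w\<close> is a unit modulo \<open>ideal_power P n\<close>, it can be
  cancelled: the ideal is P-primary.\<close>

lemma ideal_power_primary:
  assumes "w \<notin> P" "w * d \<in> ideal_power P n" shows "d \<in> ideal_power P n"
proof -
  obtain v where v: "1 - v * w \<in> ideal_power P n" using unit_mod_power[OF assms(1)] .
  have "d * (1 - v * w) + v * (w * d) \<in> ideal_power P n"
    by (intro ideal_add[OF ideal_ideal_power] ideal_scale[OF ideal_ideal_power] v assms(2))
  moreover have "d * (1 - v * w) + v * (w * d) = d" by (simp add: algebra_simps)
  ultimately show ?thesis by simp
qed

text \<open>Otherwise p would divide u^(n+1), which lies outside P. So the powers of P strictly
  decrease, and l is the exact exponent of D/P^l.\<close>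

lemma p_power_notin: "p ^ n \<notin> ideal_power P (Suc n)"
proof
  assume "p ^ n \<in> ideal_power P (Suc n)"
  then have "p ^ n * p dvd p ^ n * u ^ Suc n" using p_power_dvd[of "p ^ n" "Suc n"] by (simp add: mult_ac)
  then have "p dvd u ^ Suc n" using p_nonzero by (simp add: dvd_times_left_cancel_iff)
  then show False using power_notin[OF u_notin, of "Suc n"] p_mult_in by (auto elim: dvdE)
qed

end

lemma power_in_ideal_power: "d \<in> P \<Longrightarrow> d ^ n \<in> ideal_power P n"
  by (induction n) (auto intro: mult_in_ideal_power_Suc simp del: ideal_power.simps(2))

text \<open>
  Invertibility of nonzero ideals without fractional ideals: the quotients \<open>r/g\<close> with \<open>r\<close> in the
  left factor form the inverse of \<open>I\<close>.
\<close>

lemma ideal_invertible: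
  assumes D: "dedekind_domain TYPE('d::idom)" and I: "ideal (I :: 'd set)" and g: "g \<in> I" "g \<noteq> 0"
  shows "g \<in> module.span (*) {r * i | r i. (\<forall>x\<in>I. g dvd r * x) \<and> i \<in> I}" (is "g \<in> ?L")
proof -
  have noeth: "noetherian_domain TYPE('d)" using D by (simp add: dedekind_domain_def)
  have L: "ideal ?L" by (rule module.subspace_span[OF module_mult])
  have base: "r * i \<in> ?L" if "\<And>x. x \<in> I \<Longrightarrow> g dvd r * x" "i \<in> I" for r i
    using that by (intro module.span_base[OF module_mult]) blast
  let ?Q = "{d. d * g \<in> ?L}"
  have "ideal ?Q"
  proof (rule idealI)
    show "c * d \<in> ?Q" if "d \<in> ?Q" for c d using that ideal_scale[OF L, of "d * g" c] by (simp add: mult.assoc)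
  qed (use ideal_0[OF L] ideal_add[OF L] in \<open>auto simp: distrib_right\<close>)
  have "1 \<in> ?Q"
  proof (rule ccontr)
    assume "1 \<notin> ?Q"
    then obtain P where P: "prime_ideal P" "?Q \<subseteq> P"
      using proper_ideal_le_prime[OF noeth \<open>ideal ?Q\<close>] by blast
    have "g \<in> ?Q" using base[of g g] g(1) by simp
    then have "P \<noteq> {0}" using P(2) g(2) by blast
    then interpret dedekind_prime P using D P(1) by unfold_locales
    obtain i w where i: "i \<in> I" "w \<notin> P" "\<And>x. x \<in> I \<Longrightarrow> i dvd w * x"
      using locally_principal[OF I] g by blast
    \<comment> \<open>Locally I is generated by \<open>i\<close>, so t = w g / i multiplies I into g
      D. Then w g = t i lies in \<open>?L\<close>, although \<open>w\<close> is outside P.\<close>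
    obtain t where t: "w * g = i * t" using i(3)[OF g(1)] by (auto elim: dvdE)
    have "i \<noteq> 0" using t g(2) i(2) zero_in by auto
    have "g dvd t * x" if x: "x \<in> I" for x
    proof -
      obtain y where "w * x = i * y" using i(3)[OF x] by (auto elim: dvdE)
      then have "i * (t * x) = i * (g * y)" using t by (metis mult.assoc mult.commute)
      then show ?thesis using \<open>i \<noteq> 0\<close> by simp
    qed
    then have "w * g \<in> ?L" using base[of t i] i(1) t by (simp add: mult.commute)
    then show False using P(2) i(2) by blast
  qed
  then show ?thesis by simp
qed

section \<open>Direct sums of submodules\<close>

context module
begin

lemma subspace_set_plus: "subspace A \<Longrightarrow> subspace B \<Longrightarrow> subspace (A + B)"
  unfolding set_plus_def
proof (rule subspaceI)
  assume A: "subspace A" and B: "subspace B"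
  let ?S = "{c. \<exists>a\<in>A. \<exists>b\<in>B. c = a + b}"
  show "0 \<in> ?S" using subspace_0[OF A] subspace_0[OF B] by force
  show "x + y \<in> ?S" if x: "x \<in> ?S" and y: "y \<in> ?S" for x y
  proof -
    obtain a b where "a \<in> A" "b \<in> B" "x = a + b" using x by blast
    moreover obtain a' b' where "a' \<in> A" "b' \<in> B" "y = a' + b'" using y by blast
    moreover have "a + b + (a' + b') = (a + a') + (b + b')" by (simp add: algebra_simps)
    ultimately show ?thesis using subspace_add[OF A] subspace_add[OF B] by blast
  qed
  show "c *s x \<in> ?S" if "x \<in> ?S" for c x
    using that subspace_scale[OF A] subspace_scale[OF B] by (auto simp: scale_right_distrib) blast
qed

lemma set_plus_superset: "subspace A \<Longrightarrow> subspace B \<Longrightarrow> A \<subseteq> A + B \<and> B \<subseteq> A + B"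
  using set_plus_intro[of _ A 0 B] set_plus_intro[of 0 A _ B] subspace_0[of A] subspace_0[of B] by force

lemma set_plus_subset: "subspace S \<Longrightarrow> A \<subseteq> S \<Longrightarrow> B \<subseteq> S \<Longrightarrow> A + B \<subseteq> S"
  by (auto elim!: set_plus_elim intro: subspace_add)

lemma is_direct_sumI:
  assumes "subspace S" "subspace A" "subspace B" "A \<subseteq> S" "B \<subseteq> S"
    and "\<And>x. x \<in> A \<Longrightarrow> x \<in> B \<Longrightarrow> x = 0"
    and "\<And>x. x \<in> S \<Longrightarrow> \<exists>a\<in>A. \<exists>b\<in>B. x = a + b"
  shows "is_direct_sum scale S A B"
proof -
  have "A \<inter> B = {0}" using assms(2,3,6) subspace_0 by blast
  moreover have "A + B = S"
    using set_plus_subset[OF assms(1,4,5)] assms(7) by (auto simp: set_plus_def)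
  ultimately show ?thesis using assms(2,3) by (simp add: is_direct_sum_def)
qed

lemma is_direct_sumD:
  assumes "is_direct_sum scale S A B"
  shows "subspace A" "subspace B" "subspace S" "A \<subseteq> S" "B \<subseteq> S"
    "\<And>x. x \<in> A \<Longrightarrow> x \<in> B \<Longrightarrow> x = 0"
    "\<And>x. x \<in> S \<Longrightarrow> \<exists>a\<in>A. \<exists>b\<in>B. x = a + b"
  using assms subspace_set_plus[of A B] set_plus_superset[of A B]
  by (auto simp: is_direct_sum_def set_plus_def)

lemma direct_sum_unique:
  assumes "is_direct_sum scale S A B" "a \<in> A" "b \<in> B" "a' \<in> A" "b' \<in> B" "a + b = a' + b'"
  shows "a = a' \<and> b = b'"
proof -
  note D = is_direct_sumD[OF assms(1)]
  have "a - a' = b' - b" using assms(6) by (simp add: algebra_simps)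
  moreover have "a - a' \<in> A" "b' - b \<in> B"
    using subspace_diff D assms by auto
  ultimately show ?thesis using D(6)[of "a - a'"] by auto
qed

lemma is_direct_sum_commute: "is_direct_sum scale S A B \<Longrightarrow> is_direct_sum scale S B A"
  by (auto simp: is_direct_sum_def add.commute Int_commute)

end

section \<open>Primary components\<close>

text \<open>
  For a finitely generated \<open>P\<close>-primary module \<open>X\<close> with \<open>p\<close> a uniformizer at \<open>P\<close> this says that \<open>X\<close> is
  free over \<open>D/P\<^sup>l\<close>. The zero module is homogeneous for every positive \<open>l\<close>.
\<close>

definition homogeneous ::
    "('d::idom \<Rightarrow> 'm::ab_group_add \<Rightarrow> 'm) \<Rightarrow> 'd \<Rightarrow> nat \<Rightarrow> 'm set \<Rightarrow> bool"
  where "homogeneous s p l X \<longleftrightarrow>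
    1 \<le> l \<and> (\<forall>x\<in>X. s (p ^ l) x = 0) \<and> (\<forall>x\<in>X. s p x = 0 \<longrightarrow> (\<exists>y\<in>X. x = s (p ^ (l - 1)) y))"

lemma homogeneous_zero: "module s \<Longrightarrow> homogeneous s p 1 {0}"
  by (simp add: homogeneous_def module.scale_zero_right)

lemma (in module) power_scale_eq_0: "p ^ n *s x = 0 \<Longrightarrow> n \<le> m \<Longrightarrow> p ^ m *s x = 0"
  by (metis le_add_diff_inverse2 power_add scale_scale scale_zero_right)

lemma (in module) least_power:
  assumes "p ^ n *s x = 0" "x \<noteq> 0"
  obtains k where "p ^ k *s x \<noteq> 0" "p ^ Suc k *s x = 0"
proof -
  define m where "m = (LEAST m. p ^ m *s x = 0)"
  have m: "p ^ m *s x = 0" unfolding m_def using assms(1) by (rule LeastI)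
  then obtain k where "m = Suc k" using assms(2) by (cases m) auto
  moreover have "p ^ k *s x \<noteq> 0"
    using not_less_Least[of k "\<lambda>m. p ^ m *s x = 0"] \<open>m = Suc k\<close> by (auto simp: m_def)
  ultimately show thesis using that m by blast
qed

text \<open>The last nonzero multiple p^k x of a nonzero x lies in the socle, hence in p^(l-1) X. So
  l is the exact exponent of a nonzero X.\<close>

lemma homogeneous_top:
  fixes s :: "'d::idom \<Rightarrow> 'm::ab_group_add \<Rightarrow> 'm"
  assumes "module s" "module.subspace s X" "homogeneous s p l X" "X \<noteq> {0}"
  obtains t where "t \<in> X" "s (p ^ (l - 1)) t \<noteq> 0"
proof -
  interpret module s by fact
  obtain x where x: "x \<in> X" "x \<noteq> 0" using subspace_0[OF assms(2)] assms(4) by blast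
  have "s (p ^ l) x = 0" using assms(3) x by (simp add: homogeneous_def)
  then obtain k where k: "s (p ^ k) x \<noteq> 0" "s (p ^ Suc k) x = 0" using least_power x(2) by blast
  have "s (p ^ k) x \<in> X" "s p (s (p ^ k) x) = 0" using subspace_scale[OF assms(2) x(1)] k by auto
  then obtain y where "y \<in> X" "s (p ^ k) x = s (p ^ (l - 1)) y"
    using assms(3) unfolding homogeneous_def by blast
  then show thesis using that k by metis
qed

text \<open>The defining condition is the case k = 1. If p^(k+1) x = 0, then p^k x lies in the socle
  and equals p^(l-1) y; subtracting p^(l-k-1) y from x leaves an element killed by p^k.\<close>

lemma homogeneous_divisible:
  fixes s :: "'d::idom \<Rightarrow> 'm::ab_group_add \<Rightarrow> 'm"
  assumes "module s" "module.subspace s X" "homogeneous s p l X"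
  shows "x \<in> X \<Longrightarrow> s (p ^ k) x = 0 \<Longrightarrow> k \<le> l \<Longrightarrow> \<exists>y\<in>X. x = s (p ^ (l - k)) y"
proof (induction k arbitrary: x)
  case 0
  interpret module s by fact
  have "x = 0" using 0 by simp
  then show ?case using subspace_0[OF assms(2)] by (intro bexI[of _ 0]) auto
next
  case (Suc k)
  interpret module s by fact
  have "s (p ^ k) x \<in> X" "s p (s (p ^ k) x) = 0" using subspace_scale[OF assms(2)] Suc.prems by auto
  then obtain y where y: "y \<in> X" "s (p ^ k) x = s (p ^ (l - 1)) y"
    using assms(3) unfolding homogeneous_def by blast
  define x' where "x' = x - s (p ^ (l - Suc k)) y"
  have "p ^ (l - 1) = p ^ k * p ^ (l - Suc k)" using Suc.prems(3) by (simp flip: power_add)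
  then have "s (p ^ k) x' = 0" using y(2) by (simp add: x'_def scale_right_diff_distrib)
  moreover have "x' \<in> X" unfolding x'_def using subspace_diff subspace_scale Suc.prems(1) y(1) assms(2) by blast
  ultimately obtain z where z: "z \<in> X" "x' = s (p ^ (l - k)) z" using Suc by auto
  have "l - k = Suc (l - Suc k)" using Suc.prems(3) by simp
  then have "p ^ (l - k) = p ^ (l - Suc k) * p" by (simp add: mult.commute)
  then have "x = s (p ^ (l - Suc k)) (y + s p z)"
    using z(2) by (simp add: x'_def algebra_simps)
  then show ?case using subspace_add subspace_scale assms(2) y(1) z(1) by blast
qed

text \<open>An element not killed by p^(m-1) excludes every exponent l < m; for X = {0} uniqueness
  fails.\<close>

lemma homogeneous_unique:
  fixes s :: "'d::idom \<Rightarrow> 'm::ab_group_add \<Rightarrow> 'm"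
  assumes "module s" "module.subspace s X" "homogeneous s p l X" "homogeneous s p m X" "X \<noteq> {0}"
  shows "l = m"
proof -
  have False if lm: "l < m" "homogeneous s p l X" "homogeneous s p m X" for l m
  proof -
    obtain t where t: "t \<in> X" "s (p ^ (m - 1)) t \<noteq> 0"
      using homogeneous_top[OF assms(1,2) lm(3) assms(5)] .
    have "s (p ^ l) t = 0" using lm(2) t by (simp add: homogeneous_def)
    then show False using t module.power_scale_eq_0[OF assms(1), of p l t "m - 1"] lm(1) by linarith
  qed
  then show ?thesis using assms(3,4) by (metis nat_neq_iff)
qed

locale dedekind_module_at = module scale + dedekind_prime P
  for scale :: "'d::idom \<Rightarrow> 'm::ab_group_add \<Rightarrow> 'm" (infixr \<open>*s\<close> 75) and P :: "'d set"
begin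

abbreviation pc :: "'m set \<Rightarrow> 'm set" where "pc \<equiv> primary_component scale P"

lemma pc_subset: "pc S \<subseteq> S"
  by (auto simp: primary_component_def)

lemma pc_Int: "pc S = S \<inter> pc UNIV"
  by (auto simp: primary_component_def)

lemma pc_mono: "S \<subseteq> T \<Longrightarrow> pc S \<subseteq> pc T"
  by (auto simp: primary_component_def)

lemma subspace_pc:
  assumes "subspace S" shows "subspace (pc S)"
proof (rule subspaceI)
  show "0 \<in> pc S" using subspace_0[OF assms] by (simp add: primary_component_def)
  show "x + y \<in> pc S" if "x \<in> pc S" "y \<in> pc S" for x y
  proof -
    obtain m where m: "\<forall>d\<in>ideal_power P m. d *s x = 0" using \<open>x \<in> pc S\<close> by (auto simp: primary_component_def)
    obtain n where n: "\<forall>d\<in>ideal_power P n. d *s y = 0" using \<open>y \<in> pc S\<close> by (auto simp: primary_component_def)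
    have "\<forall>d\<in>ideal_power P (max m n). d *s (x + y) = 0"
    proof
      fix d assume "d \<in> ideal_power P (max m n)"
      then have "d *s x = 0" "d *s y = 0"
        using m n ideal_power_antimono[of m "max m n" P] ideal_power_antimono[of n "max m n" P] by auto
      then show "d *s (x + y) = 0" by (simp add: scale_right_distrib)
    qed
    moreover have "x + y \<in> S" using that assms pc_subset subspace_add by blast
    ultimately show ?thesis by (auto simp: primary_component_def)
  qed
  show "c *s x \<in> pc S" if "x \<in> pc S" for c x
  proof -
    obtain n where n: "\<forall>d\<in>ideal_power P n. d *s x = 0" using \<open>x \<in> pc S\<close> by (auto simp: primary_component_def)
    have "d *s c *s x = 0" if "d \<in> ideal_power P n" for d
      using n that scale_left_commute[of d c x] by (simp del: scale_scale)
    moreover have "c *s x \<in> S" using \<open>x \<in> pc S\<close> pc_subset subspace_scale[OF assms] by blast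
    ultimately show ?thesis unfolding primary_component_def by blast
  qed
qed

text \<open>Since \<open>w\<close> is invertible modulo every power of P, multipliers outside P can
  be undone on P-primary elements. This is the substitute for passing to the localization.\<close>

lemma unit_scale:
  assumes "w \<notin> P" "x \<in> pc S" obtains v where "v *s w *s x = x"
proof -
  obtain n where n: "\<forall>d\<in>ideal_power P n. d *s x = 0" using assms(2) by (auto simp: primary_component_def)
  obtain v where "1 - v * w \<in> ideal_power P n" using unit_mod_power[OF assms(1)] .
  then have "(1 - v * w) *s x = 0" using n by blast
  then have "v *s w *s x = x" by (simp add: scale_left_diff_distrib)
  then show thesis using that by blast
qed

lemma scale_eq_0: "w \<notin> P \<Longrightarrow> x \<in> pc S \<Longrightarrow> w *s x = 0 \<Longrightarrow> x = 0"
  by (metis unit_scale scale_zero_right)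

text \<open>u^n P^n lies in p^n D, and u^n can be cancelled on P-primary elements. Thus the single
  element p^n tests what \<open>primary_component\<close> demands of the whole ideal power.\<close>

lemma ideal_power_scale:
  assumes "x \<in> pc S" "p ^ n *s x = 0" "d \<in> ideal_power P n" shows "d *s x = 0"
proof -
  obtain r where r: "u ^ n * d = p ^ n * r" using p_power_dvd[OF assms(3)] by (auto elim: dvdE)
  have "u ^ n *s d *s x = r *s p ^ n *s x" using r by (simp add: mult.commute)
  then have "u ^ n *s d *s x = 0" using assms(2) by simp
  moreover have "d *s x \<in> pc UNIV"
    using assms(1) pc_mono[of S UNIV] subspace_scale[OF subspace_pc[OF subspace_UNIV]] by blast
  ultimately show ?thesis using scale_eq_0[OF power_notin[OF u_notin]] by blast
qed

lemma pc_power: assumes "x \<in> pc S" obtains n where "p ^ n *s x = 0"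
  using assms p_power_in by (auto simp: primary_component_def)

lemma pc_nonzero_power:
  assumes "x \<in> pc S" obtains d where "d \<noteq> 0" "d *s x = 0"
proof -
  obtain n where "p ^ n *s x = 0" using pc_power[OF assms] .
  then show thesis using that[of "p ^ n"] p_nonzero by simp
qed

text \<open>If w d = p^n w', then w' x is killed by p^n; the further factor u^n makes it killed by
  all of P^n.\<close>

lemma scale_into_pc:
  assumes "d \<noteq> 0" "d *s x = 0" "x \<in> S" "subspace S"
  obtains w where "w \<notin> P" "w *s x \<in> pc S"
proof -
  obtain w n w' where w: "w \<notin> P" "w' \<notin> P" "w * d = p ^ n * w'" using factorization[OF assms(1)] .
  have "p ^ n *s w' *s x = w *s d *s x" using w(3) by simp
  then have 0: "p ^ n *s w' *s x = 0" using assms(2) by simp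
  have "\<forall>d\<in>ideal_power P n. d *s (u ^ n * w') *s x = 0"
  proof
    fix d assume "d \<in> ideal_power P n"
    then obtain r where r: "u ^ n * d = p ^ n * r" using p_power_dvd by (blast elim: dvdE)
    have "d * (u ^ n * w') = (u ^ n * d) * w'" by (simp add: mult_ac)
    also have "\<dots> = r * (p ^ n * w')" unfolding r by (simp add: mult_ac)
    finally have "d *s (u ^ n * w') *s x = r *s p ^ n *s w' *s x" by (simp only: scale_scale)
    then show "d *s (u ^ n * w') *s x = 0" unfolding 0 by (simp only: scale_zero_right)
  qed
  then have "(u ^ n * w') *s x \<in> pc S"
    using subspace_scale[OF assms(4,3)] by (auto simp: primary_component_def)
  then show thesis using that mult_notin[OF power_notin[OF u_notin] w(2)] by blast
qed

text \<open>A nonzero d is p^n up to multipliers outside P. If p d z = 0, then p^(n+1) z = 0, so n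
  is at least l-1 because l is exact, and d z is divisible by p^(l-1).\<close>

lemma cyclic_homogeneous:
  assumes z: "z \<in> pc S" "p ^ l *s z = 0" "p ^ (l - 1) *s z \<noteq> 0"
  shows "homogeneous scale p l (span {z})"
  unfolding homogeneous_def
proof (intro conjI ballI impI)
  show "1 \<le> l" using z(2,3) by (cases l) auto
  fix x assume "x \<in> span {z}"
  then obtain d where d: "x = d *s z" by (auto simp: span_singleton)
  have "p ^ l *s x = d *s p ^ l *s z" by (simp add: d mult.commute)
  then show "p ^ l *s x = 0" using z(2) by simp
  assume px: "p *s x = 0"
  show "\<exists>y\<in>span {z}. x = p ^ (l - 1) *s y"
  proof (cases "d = 0")
    case True then show ?thesis using d span_zero by (intro bexI[of _ 0]) auto
  next
    case False
    then obtain w n w' where w: "w \<notin> P" "w' \<notin> P" "w * d = p ^ n * w'" by (rule factorization)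
    have zU: "z \<in> pc UNIV" using z(1) pc_mono[of S UNIV] by blast
    have cU: "c *s z \<in> pc UNIV" for c by (rule subspace_scale[OF subspace_pc[OF subspace_UNIV] zU])
    have "w' *s p ^ Suc n *s z = p *s w *s x" using w(3) by (simp add: d mult_ac)
    also have "\<dots> = w *s p *s x" by (rule scale_left_commute)
    finally have "w' *s p ^ Suc n *s z = 0" using px by simp
    then have "p ^ Suc n *s z = 0" using scale_eq_0[OF w(2) cU] by blast
    then have "\<not> Suc n \<le> l - 1" using z(3) power_scale_eq_0 by blast
    then have n: "n = (l - 1) + (n - (l - 1))" by simp
    obtain v where "v *s w *s x = x" using unit_scale[OF w(1) cU[of d]] d by blast
    moreover have "w *s x = p ^ (l - 1) *s (p ^ (n - (l - 1)) * w') *s z"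
      using w(3) n by (simp add: d mult_ac flip: power_add)
    ultimately have "x = p ^ (l - 1) *s (v * p ^ (n - (l - 1)) * w') *s z"
      by (metis (no_types, lifting) scale_scale mult.assoc mult.left_commute)
    then show ?thesis by (auto simp: span_singleton)
  qed
qed

text \<open>Up to multipliers outside P, a nonzero d is some p^n, which kills x exactly if m \<le>
  n. The case m = 0, where x = 0 and the ideal is the whole ring, is listed apart because m - 1 is
  truncated.\<close>

lemma annihilator_power:
  assumes "x \<in> pc S" "p ^ m *s x = 0" "m = 0 \<or> p ^ (m - 1) *s x \<noteq> 0"
  shows "d *s x = 0 \<longleftrightarrow> d \<in> ideal_power P m"
proof
  assume dx: "d *s x = 0"
  show "d \<in> ideal_power P m"
  proof (cases "d = 0")
    case True then show ?thesis using ideal_0[OF ideal_ideal_power] by simp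
  next
    case False
    then obtain w n w' where w: "w \<notin> P" "w' \<notin> P" "w * d = p ^ n * w'" by (rule factorization)
    have "w' *s p ^ n *s x = w *s d *s x" using w(3) by (simp add: mult.commute)
    then have "w' *s p ^ n *s x = 0" using dx by simp
    moreover have "p ^ n *s x \<in> pc UNIV"
      using assms(1) pc_mono[of S UNIV] subspace_scale[OF subspace_pc[OF subspace_UNIV]] by blast
    ultimately have "p ^ n *s x = 0" using scale_eq_0[OF w(2)] by blast
    then have "m \<le> n" using assms(3) power_scale_eq_0[of p n x "m - 1"] by linarith
    then have "w * d \<in> ideal_power P m"
      using p_power_in[of n] ideal_power_antimono[of m n P] ideal_scale[OF ideal_ideal_power, of "p ^ n" P m w']
      unfolding w(3) by (metis mult.commute subsetD)
    then show ?thesis using ideal_power_primary[OF w(1)] by blast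
  qed
qed (use ideal_power_scale[OF assms(1,2)] in blast)

lemma pc_direct_sum:
  assumes S: "is_direct_sum scale S X Y" and "x \<in> pc S"
  obtains a b where "a \<in> pc X" "b \<in> pc Y" "x = a + b"
proof -
  note D = is_direct_sumD[OF S]
  obtain n where n: "\<forall>d\<in>ideal_power P n. d *s x = 0" using assms(2) by (auto simp: primary_component_def)
  obtain a b where ab: "a \<in> X" "b \<in> Y" "x = a + b" using D(7) assms(2) pc_subset by blast
  have "d *s a = 0 \<and> d *s b = 0" if "d \<in> ideal_power P n" for d
  proof (rule direct_sum_unique[OF S])
    show "d *s a + d *s b = 0 + 0" using n that by (simp add: ab(3) scale_right_distrib)
  qed (use ab D subspace_scale subspace_0 in auto)
  then have "a \<in> pc X" "b \<in> pc Y" using ab unfolding primary_component_def by blast+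
  then show thesis using that ab(3) by blast
qed

lemma pc_subset_if_complement_zero:
  assumes S: "is_direct_sum scale S X Y" and "pc Y = {0}"
  shows "pc S \<subseteq> X"
proof
  fix x assume "x \<in> pc S"
  then obtain a b where "a \<in> pc X" "b \<in> pc Y" "x = a + b" by (rule pc_direct_sum[OF S])
  then show "x \<in> X" using assms(2) pc_subset by auto
qed

lemma homogeneous_summand:
  assumes S: "is_direct_sum scale S X Y" and h: "homogeneous scale p l (pc S)"
  shows "homogeneous scale p l (pc X)"
  unfolding homogeneous_def
proof (intro conjI ballI impI)
  note D = is_direct_sumD[OF S]
  show "1 \<le> l" using h by (simp add: homogeneous_def)
  fix x assume x: "x \<in> pc X"
  then have xS: "x \<in> pc S" using pc_mono[OF D(4)] by blast
  then show "p ^ l *s x = 0" using h by (simp add: homogeneous_def)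
  assume "p *s x = 0"
  then obtain y where y: "y \<in> pc S" "x = p ^ (l - 1) *s y" using h xS unfolding homogeneous_def by blast
  obtain a b where ab: "a \<in> pc X" "b \<in> pc Y" "y = a + b" using pc_direct_sum[OF S y(1)] .
  have "x = p ^ (l - 1) *s a \<and> 0 = p ^ (l - 1) *s b"
  proof (rule direct_sum_unique[OF S])
    show "x + 0 = p ^ (l - 1) *s a + p ^ (l - 1) *s b" by (simp add: y(2) ab(3) scale_right_distrib)
  next
    show "x \<in> X" "p ^ (l - 1) *s a \<in> X" using x ab(1) pc_subset subspace_scale[OF D(1)] by blast+
    show "0 \<in> Y" "p ^ (l - 1) *s b \<in> Y" using ab(2) pc_subset subspace_scale[OF D(2)] subspace_0[OF D(2)] by blast+
  qed
  then show "\<exists>y\<in>pc X. x = p ^ (l - 1) *s y" using ab(1) by blast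
qed

end

section \<open>Homogeneous torsion submodules are direct summands\<close>

locale dedekind_module = noetherian_module scale
  for scale :: "'d::idom \<Rightarrow> 'm::ab_group_add \<Rightarrow> 'm" (infixr \<open>*s\<close> 75) +
  assumes dedekind: "dedekind_domain TYPE('d)"
begin

lemma noetherian_ring: "noetherian_domain TYPE('d)"
  using dedekind by (simp add: dedekind_domain_def)

lemma at_prime: "prime_ideal P \<Longrightarrow> P \<noteq> {0} \<Longrightarrow> dedekind_module_at scale P"
  using dedekind module_axioms by (simp add: dedekind_module_at_def dedekind_prime_def)

text \<open>Each generator has a multiplier outside P that sends it into the component, and the
  product serves all of them. Multiplication by w then stands in for the projection of F onto its
  P-component.\<close>

lemma clear_denominator_into_pc:
  assumes "dedekind_module_at scale P" "subspace F" "F \<subseteq> torsion scale"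
  obtains w where "w \<notin> P" "\<And>x. x \<in> F \<Longrightarrow> w *s x \<in> primary_component scale P F"
proof -
  interpret dedekind_module_at scale P by fact
  obtain G where G: "finite G" "F = span G" using noetherian[OF assms(2)] by blast
  have "G \<subseteq> F" using G(2) span_superset by blast
  with G(1) have "\<exists>w. w \<notin> P \<and> (\<forall>g\<in>G. w *s g \<in> pc F)"
  proof induction
    case empty then show ?case using one_notin by blast
  next
    case (insert g G)
    then obtain w where w: "w \<notin> P" "\<forall>g\<in>G. w *s g \<in> pc F" by blast
    obtain d where d: "d \<noteq> 0" "d *s g = 0" "g \<in> F"
      using insert.prems assms(3) by (auto simp: torsion_def)
    obtain v where v: "v \<notin> P" "v *s g \<in> pc F" using scale_into_pc[OF d assms(2)] .
    have "(v * w) *s h \<in> pc F" if "h \<in> insert g G" for h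
    proof (cases "h = g")
      case True
      then show ?thesis using subspace_scale[OF subspace_pc[OF assms(2)] v(2), of w] by (simp add: mult.commute)
    next
      case False
      then show ?thesis using that w subspace_scale[OF subspace_pc[OF assms(2)], of "w *s h" v] by simp
    qed
    then show ?case using mult_notin[OF v(1) w(1)] by blast
  qed
  then obtain w where w: "w \<notin> P" "\<forall>g\<in>G. w *s g \<in> pc F" by blast
  have "w *s x \<in> pc F" if "x \<in> F" for x
    using that unfolding G(2)
  proof (induction x rule: span_induct_alt)
    case base show ?case using subspace_0[OF subspace_pc[OF subspace_span]] by simp
  next
    case (step c x y)
    have "c *s w *s x + w *s y \<in> pc (span G)"
      using step w G(2) subspace_add subspace_scale subspace_pc[OF subspace_span] by metis
    then show ?case by (simp add: scale_right_distrib mult.commute)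
  qed
  then show thesis using that w(1) by blast
qed

text \<open>
  The complement is a submodule \<open>C\<close> maximal subject to \<open>C \<inter> F = 0\<close> and \<open>C \<supseteq> ann(F) B\<close>. The second
  condition forces \<open>p\<^sup>l\<^sup>-\<^sup>1 f = 0\<close> whenever \<open>p x = f + c\<close>, so that \<open>f\<close> is divisible by \<open>p\<close> in \<open>F\<close>.
\<close>

lemma homogeneous_submodule_direct_summand:
  assumes B: "subspace B" and F: "subspace F" "F \<subseteq> B" "F \<subseteq> torsion scale"
    and hom: "\<And>P. prime_ideal P \<Longrightarrow> P \<noteq> {0} \<Longrightarrow> primary_component scale P F \<noteq> {0} \<Longrightarrow>
      \<exists>l. homogeneous scale (uniformizer P) l (primary_component scale P F) \<and>
        (\<forall>x\<in>primary_component scale P B. uniformizer P ^ l *s x = 0)"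
  obtains C where "is_direct_sum scale B F C"
proof -
  define I where "I = {i. \<forall>x\<in>F. i *s x = 0}"
  define C0 where "C0 = span {i *s b | i b. i \<in> I \<and> b \<in> B}"
  have C0B: "C0 \<subseteq> B" unfolding C0_def
    by (rule span_minimal[OF _ B]) (use subspace_scale[OF B] in blast)
  \<comment> \<open>Let P contain the annihilator of y. Since the component of F at P has exact
    exponent l, elements of \<open>I\<close> are divisible by p^l up to multipliers outside P, so y
    is locally p^l b with b in B. As y is torsion, so is b; a multiple of b by an element outside P
    lies in the component of B, where p^l is zero, so an element outside P kills y.\<close>
  have C0F: "y = 0" if y: "y \<in> C0" "y \<in> F" for y
  proof (rule ccontr)
    assume "y \<noteq> 0"
    let ?J = "{d. d *s y = 0}"
    have "ideal ?J"
      by (rule idealI) (auto simp: scale_left_distrib simp flip: scale_scale)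
    moreover have "1 \<notin> ?J" using \<open>y \<noteq> 0\<close> by simp
    ultimately obtain P where P: "prime_ideal P" "?J \<subseteq> P"
      by (rule proper_ideal_le_prime[OF noetherian_ring])
    obtain d where d: "d \<noteq> 0" "d *s y = 0" using y F(3) by (auto simp: torsion_def)
    then have "P \<noteq> {0}" using P(2) by blast
    then interpret dedekind_module_at scale P using at_prime P(1) by blast
    obtain w where w: "w \<notin> P" "\<And>x. x \<in> F \<Longrightarrow> w *s x \<in> pc F"
      using clear_denominator_into_pc[OF dedekind_module_at_axioms F(1,3)] by blast
    have "w *s y \<noteq> 0" using w(1) P(2) by blast
    then have nz: "pc F \<noteq> {0}" using w(2) y(2) by blast
    then obtain l where l: "homogeneous scale p l (pc F)" "\<And>x. x \<in> pc B \<Longrightarrow> p ^ l *s x = 0"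
      using hom[OF P(1) \<open>P \<noteq> {0}\<close>] by blast
    obtain t where t: "t \<in> pc F" "p ^ (l - 1) *s t \<noteq> 0"
      using homogeneous_top[OF module_axioms subspace_pc[OF F(1)] l(1) nz] .
    have I: "\<exists>w r. w \<notin> P \<and> w * i = p ^ l * r" if "i \<in> I" for i
    proof (cases "i = 0")
      case True then show ?thesis using one_notin by (intro exI[of _ 1] exI[of _ 0]) auto
    next
      case False
      then obtain w n w' where w: "w \<notin> P" "w' \<notin> P" "w * i = p ^ n * w'" by (rule factorization)
      have "i *s t = 0" using that t pc_subset by (auto simp: I_def)
      then have "w *s i *s t = 0" by (metis scale_zero_right)
      then have "w' *s p ^ n *s t = 0" using w(3) by (simp add: mult.commute)
      then have "p ^ n *s t = 0"
        using scale_eq_0[OF w(2)] subspace_scale[OF subspace_pc[OF F(1)] t(1)] by blast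
      then have "\<not> n \<le> l - 1" using t(2) power_scale_eq_0 by blast
      then have "p ^ n = p ^ l * p ^ (n - l)" by (simp flip: power_add)
      then have "w * i = p ^ l * (p ^ (n - l) * w')" using w(3) by (simp add: mult.assoc)
      then show ?thesis using w(1) by blast
    qed
    have "\<exists>w b. w \<notin> P \<and> b \<in> B \<and> w *s y = p ^ l *s b"
      using y(1) unfolding C0_def
    proof (induction y rule: span_induct_alt)
      case base
      then show ?case using one_notin subspace_0[OF B] by (intro exI[of _ 1] exI[of _ 0]) auto
    next
      case (step c x y)
      obtain i b where ib: "x = i *s b" "i \<in> I" "b \<in> B" using step(1) by blast
      obtain v r where v: "v \<notin> P" "v * i = p ^ l * r" using I[OF ib(2)] by blast
      obtain w b' where w: "w \<notin> P" "b' \<in> B" "w *s y = p ^ l *s b'" using step(2) by blast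
      have "(w * v) *s (c *s x + y) = (w * c) *s (v * i) *s b + v *s w *s y"
        by (simp add: ib(1) scale_right_distrib mult_ac)
      also have "\<dots> = p ^ l *s ((w * c * r) *s b + v *s b')"
        by (simp only: v(2) w(3)) (simp add: scale_right_distrib mult_ac)
      finally have "(w * v) *s (c *s x + y) = p ^ l *s ((w * c * r) *s b + v *s b')" .
      moreover have "(w * c * r) *s b + v *s b' \<in> B"
        using subspace_add[OF B] subspace_scale[OF B] ib(3) w(2) by blast
      ultimately show ?case using mult_notin[OF w(1) v(1)] by blast
    qed
    then obtain v b where v: "v \<notin> P" "b \<in> B" "v *s y = p ^ l *s b" by blast
    have "(d * p ^ l) *s b = v *s d *s y" using v(3) by (metis scale_left_commute scale_scale)
    then have "(d * p ^ l) *s b = 0" using d(2) by simp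
    moreover have "d * p ^ l \<noteq> 0" using d(1) p_nonzero by simp
    ultimately obtain v' where v': "v' \<notin> P" "v' *s b \<in> pc B" using scale_into_pc v(2) B by blast
    have "(v' * v) *s y = p ^ l *s v' *s b" using v(3) by (metis scale_left_commute scale_scale)
    then have "(v' * v) *s y = 0" using l(2)[OF v'(2)] by simp
    then show False using mult_notin[OF v'(1) v(1)] P(2) by blast
  qed
  let ?A = "{C. subspace C \<and> C0 \<subseteq> C \<and> C \<subseteq> B \<and> C \<inter> F \<subseteq> {0}}"
  have "C0 \<in> ?A" using C0B C0F by (auto simp: C0_def)
  then have "?A \<noteq> {}" by blast
  then obtain C where C: "C \<in> ?A" "\<And>X. X \<in> ?A \<Longrightarrow> C \<subseteq> X \<Longrightarrow> X = C"
    by (rule maximal_submodule) auto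
  then have Cs: "subspace C" "C0 \<subseteq> C" "C \<subseteq> B" and CF: "\<And>x. x \<in> C \<Longrightarrow> x \<in> F \<Longrightarrow> x = 0" by auto
  let ?G = "F + C"
  have G: "subspace ?G" "F \<subseteq> ?G" "C \<subseteq> ?G" "?G \<subseteq> B"
    using subspace_set_plus[OF F(1) Cs(1)] set_plus_superset[OF F(1) Cs(1)] set_plus_subset[OF B F(2) Cs(3)]
    by auto
  \<comment> \<open>By maximality \<open>C + Dx\<close> meets \<open>F\<close>.\<close>
  have max: "\<exists>d. d *s x \<in> ?G \<and> d *s x \<notin> C" if x: "x \<in> B" "x \<notin> ?G" for x
  proof (rule ccontr)
    assume contra: "\<not> (\<exists>d. d *s x \<in> ?G \<and> d *s x \<notin> C)"
    have "C + span {x} \<in> ?A"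
    proof (intro CollectI conjI)
      show "subspace (C + span {x})" using subspace_set_plus Cs(1) by blast
      show "C0 \<subseteq> C + span {x}" using Cs set_plus_superset[OF Cs(1) subspace_span] by blast
      show "C + span {x} \<subseteq> B" using set_plus_subset[OF B Cs(3)] span_minimal[of "{x}" B] x(1) B by blast
      show "(C + span {x}) \<inter> F \<subseteq> {0}"
      proof
        fix f assume f: "f \<in> (C + span {x}) \<inter> F"
        then obtain c d where cd: "c \<in> C" "f = c + d *s x" by (auto simp: set_plus_def span_singleton)
        then have "d *s x = f - c" by simp
        then have "d *s x \<in> ?G" using subspace_diff[OF G(1)] G(2,3) f cd(1) by auto
        then have "d *s x \<in> C" using contra by blast
        then have "f \<in> C" using cd subspace_add[OF Cs(1)] by blast
        then show "f \<in> {0}" using CF f by blast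
      qed
    qed
    moreover have sup: "C \<subseteq> C + span {x}" "span {x} \<subseteq> C + span {x}"
      using set_plus_superset[OF Cs(1) subspace_span] by auto
    ultimately have "C + span {x} = C" using C(2) by blast
    then have "x \<in> C" using sup(2) span_base[of x "{x}"] by blast
    then show False using x(2) G(3) by blast
  qed
  have "B \<subseteq> ?G"
  proof
    fix x0 assume "x0 \<in> B"
    show "x0 \<in> ?G"
    proof (rule ccontr)
      assume "x0 \<notin> ?G"
      obtain x where x: "x \<in> B" "x \<notin> ?G" "prime_ideal {d. d *s x \<in> ?G}"
        by (rule associated_prime[OF noetherian_ring module_axioms G(1) B \<open>x0 \<in> B\<close> \<open>x0 \<notin> ?G\<close>])
      define P where "P = {d. d *s x \<in> ?G}"
      \<comment> \<open>By \<open>max\<close>, some nonzero ring element sends x into F + C.\<close>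
      have "P \<noteq> {0}"
      proof
        assume "P = {0}"
        obtain d where d: "d *s x \<in> ?G" "d *s x \<notin> C" using max[OF x(1,2)] by blast
        then have "d \<in> P" by (simp add: P_def)
        then have "d = 0" unfolding \<open>P = {0}\<close> by simp
        then show False using d(2) subspace_0[OF Cs(1)] by simp
      qed
      then interpret dedekind_module_at scale P using at_prime x(3) by (simp add: P_def)
      obtain w where w: "w \<notin> P" "\<And>x. x \<in> F \<Longrightarrow> w *s x \<in> pc F"
        using clear_denominator_into_pc[OF dedekind_module_at_axioms F(1,3)] by blast
      have "p *s x \<in> ?G" using p_in by (simp add: P_def)
      then obtain f c where fc: "f \<in> F" "c \<in> C" "p *s x = f + c" by (auto simp: set_plus_def)
      have px: "p *s w *s x = w *s f + w *s c"
        using fc(3) by (metis scale_left_commute scale_right_distrib)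
      have wf: "w *s f \<in> pc F" using w(2) fc(1) by blast
      have "\<exists>f'\<in>F. w *s f = p *s f'"
      proof (cases "pc F = {0}")
        case True
        then show ?thesis using wf subspace_0[OF F(1)] by (intro bexI[of _ 0]) auto
      next
        case False
        then obtain l where l: "homogeneous scale p l (pc F)" "\<And>x. x \<in> pc B \<Longrightarrow> p ^ l *s x = 0"
          using hom[of P] prime nonzero by blast
        have l1: "1 \<le> l" "\<And>x. x \<in> pc F \<Longrightarrow> p ^ l *s x = 0" using l(1) by (auto simp: homogeneous_def)
        have pl: "p ^ l = p ^ (l - 1) * p" using l1(1) by (cases l) auto
        \<comment> \<open>w maps F into its P-component and p^l kills that, so their product
          annihilates all of F.\<close>
        have "(w * p ^ l) *s g = 0" if "g \<in> F" for g
          using l1(2)[OF w(2)[OF that]] by (simp add: mult.commute)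
        then have "w * p ^ l \<in> I" by (simp add: I_def)
        then have "(w * p ^ l) *s w *s x \<in> C0"
          unfolding C0_def using x(1) subspace_scale[OF B] by (intro span_base) blast
        moreover have "(w * p ^ l) *s w *s x = w *s p ^ (l - 1) *s p *s w *s x"
          by (simp add: pl mult_ac)
        moreover have "\<dots> = w *s p ^ (l - 1) *s w *s f + (w * p ^ (l - 1) * w) *s c"
          unfolding px by (simp add: scale_right_distrib mult.assoc)
        ultimately have "w *s p ^ (l - 1) *s w *s f + (w * p ^ (l - 1) * w) *s c \<in> C" using Cs(2) by auto
        then have "w *s p ^ (l - 1) *s w *s f \<in> C"
          using subspace_diff[OF Cs(1) _ subspace_scale[OF Cs(1) fc(2), of "w * p ^ (l - 1) * w"]] by fastforce
        moreover have pwf: "p ^ (l - 1) *s w *s f \<in> pc F" using subspace_scale[OF subspace_pc[OF F(1)] wf] .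
        moreover have "w *s p ^ (l - 1) *s w *s f \<in> F" using subspace_scale[OF F(1)] pwf pc_subset by blast
        ultimately have "w *s p ^ (l - 1) *s w *s f = 0" using CF by blast
        then have "p ^ (l - 1) *s w *s f = 0" using scale_eq_0[OF w(1) pwf] by blast
        then have "\<exists>y\<in>pc F. w *s f = p ^ (l - (l - 1)) *s y"
          using homogeneous_divisible[OF module_axioms subspace_pc[OF F(1)] l(1) wf] by simp
        then show ?thesis using l1(1) pc_subset by auto
      qed
      then obtain f' where f': "f' \<in> F" "w *s f = p *s f'" by blast
      \<comment> \<open>Replacing w x by w x - f' moves its multiple by \<open>p\<close> from F + C
        into C; the factor \<open>u\<close> extends this to all of P, because u P lies in p D.
        Modulo F + C the annihilator is still P, so \<open>max\<close> applies to x' and gives the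
        contradiction.\<close>
      define x' where "x' = u *s (w *s x - f')"
      have "w *s x \<notin> ?G" using w(1) by (simp add: P_def)
      have iff: "d *s x' \<in> ?G \<longleftrightarrow> d \<in> P" for d
      proof -
        have "d *s x' = (d * u * w) *s x - (d * u) *s f'" by (simp add: x'_def scale_right_diff_distrib mult.assoc)
        moreover have "(d * u) *s f' \<in> ?G" using subspace_scale[OF F(1) f'(1)] G(2) by blast
        ultimately have "d *s x' \<in> ?G \<longleftrightarrow> (d * u * w) *s x \<in> ?G"
          using subspace_diff[OF G(1), of "(d * u * w) *s x" "(d * u) *s f'"]
            subspace_add[OF G(1), of "(d * u * w) *s x - (d * u) *s f'" "(d * u) *s f'"] by auto
        also have "\<dots> \<longleftrightarrow> d * u * w \<in> P" by (simp add: P_def)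
        also have "\<dots> \<longleftrightarrow> d \<in> P"
        proof
          assume "d \<in> P"
          then have "(u * w) * d \<in> P" by (rule mult_in)
          then show "d * u * w \<in> P" by (simp only: mult_ac)
        qed (use mult_notin u_notin w(1) in blast)
        finally show ?thesis .
      qed
      have x'B: "x' \<in> B" unfolding x'_def
        using subspace_scale[OF B] subspace_diff[OF B] x(1) f'(1) F(2) by blast
      have "x' \<notin> ?G" using iff[of 1] one_notin by simp
      then obtain d where d: "d *s x' \<in> ?G" "d *s x' \<notin> C" using max[OF x'B] by blast
      then obtain r where r: "u * d = p * r" using iff p_dvd by (blast elim: dvdE)
      have "d *s x' = (u * d) *s (w *s x - f')" by (simp add: x'_def mult.commute)
      also have "\<dots> = r *s (p *s w *s x - p *s f')"
        unfolding r by (simp add: scale_right_diff_distrib mult_ac)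
      also have "\<dots> = r *s w *s c" using px f'(2) by (simp del: scale_scale)
      finally have "d *s x' \<in> C" using subspace_scale[OF Cs(1)] fc(2) by metis
      then show False using d(2) by blast
    qed
  qed
  then have "is_direct_sum scale B F C"
    using F(1) Cs(1) CF G(4) subspace_0[OF F(1)] subspace_0[OF Cs(1)]
    by (auto simp: is_direct_sum_def)
  then show thesis using that by blast
qed

end

section \<open>Characterization of C4-modules\<close>

text \<open>Phrased for a submodule and without the tensor product, so that it passes to smaller
  submodules at once; \<open>rank_le_1_iff\<close> compares it with the rank of the whole
  module.\<close>

definition rank_le_1 :: "('d::idom \<Rightarrow> 'm::ab_group_add \<Rightarrow> 'm) \<Rightarrow> 'm set \<Rightarrow> bool"
  where "rank_le_1 s S \<longleftrightarrow> (\<forall>x\<in>S. \<forall>y\<in>S. \<exists>a b. (a \<noteq> 0 \<or> b \<noteq> 0) \<and> s a x + s b y = 0)"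

definition homogeneous_components :: "('d::idom \<Rightarrow> 'm::ab_group_add \<Rightarrow> 'm) \<Rightarrow> 'm set \<Rightarrow> bool"
  where "homogeneous_components s S \<longleftrightarrow>
    (\<forall>P. prime_ideal P \<and> P \<noteq> {0} \<longrightarrow>
      (\<exists>l. homogeneous s (uniformizer P) l (primary_component s P S)))"

context dedekind_module
begin

text \<open>A complement of the kernel is mapped isomorphically onto the image, so the components of
  the image are homogeneous with the exponents of S. The image is torsion: a relation a x + b f x =
  0 splits along A and B, and then both coefficients kill f x. As the same powers kill the
  components of B, the image splits off.\<close>

lemma C4_if_homogeneous_components:
  assumes S: "subspace S" and rank: "rank_le_1 scale S" and hom: "homogeneous_components scale S"
  shows "C4 scale S"
  unfolding C4_def
proof (intro allI impI, elim conjE)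
  fix A B f
  assume AB: "is_direct_sum scale S A B" and f: "hom_on scale A B f"
    and "direct_summand scale {x \<in> A. f x = 0} A"
  then obtain A' where A': "is_direct_sum scale A {x \<in> A. f x = 0} A'" (is "is_direct_sum _ _ ?K _")
    by (auto simp: direct_summand_def)
  note D = is_direct_sumD[OF AB] and D' = is_direct_sumD[OF A']
  have f_in: "f x \<in> B" and f_add: "f (x + y) = f x + f y" and f_scale: "f (r *s x) = r *s f x"
    if "x \<in> A" "y \<in> A" for x y r using f that by (auto simp: hom_on_def)
  have f0: "f 0 = 0" using f_scale[OF subspace_0[OF D(1)] subspace_0[OF D(1)], of 0] by simp
  have inj: "x = 0" if "x \<in> A'" "f x = 0" for x using that D'(5,6) by blast
  have fA: "\<exists>a\<in>A'. y = f a" if y: "y \<in> f ` A" for y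
  proof -
    obtain x where x: "x \<in> A" "y = f x" using y by blast
    obtain k a where ka: "k \<in> ?K" "a \<in> A'" "x = k + a" using D'(7)[OF x(1)] by blast
    then have "f x = f k + f a" using f_add D'(5) by blast
    then show ?thesis using ka x by auto
  qed
  have F: "subspace (f ` A)"
  proof (rule subspaceI)
    show "0 \<in> f ` A" using f0 subspace_0[OF D(1)] by (metis imageI)
    show "x + y \<in> f ` A" if xy: "x \<in> f ` A" "y \<in> f ` A" for x y
    proof -
      obtain a b where ab: "a \<in> A" "b \<in> A" "x = f a" "y = f b" using xy by blast
      then have "x + y = f (a + b)" using f_add by simp
      then show ?thesis using subspace_add[OF D(1) ab(1,2)] by blast
    qed
    show "c *s x \<in> f ` A" if x: "x \<in> f ` A" for c x
    proof -
      obtain a where a: "a \<in> A" "x = f a" using x by blast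
      then have "c *s x = f (c *s a)" using f_scale by simp
      then show ?thesis using subspace_scale[OF D(1) a(1)] by blast
    qed
  qed
  have FB: "f ` A \<subseteq> B" using f_in by blast
  have tors: "f ` A \<subseteq> torsion scale"
  proof
    fix y assume "y \<in> f ` A"
    then obtain x where x: "x \<in> A" "y = f x" by blast
    then have "x \<in> S" "y \<in> S" using D(4,5) FB by auto
    then obtain a b where ab: "a \<noteq> 0 \<or> b \<noteq> 0" "a *s x + b *s y = 0"
      using rank unfolding rank_le_1_def by blast
    have "a *s x = 0 \<and> b *s y = 0"
    proof (rule direct_sum_unique[OF AB])
      show "a *s x + b *s y = 0 + 0" using ab(2) by simp
    qed (use x FB subspace_scale subspace_0 D in auto)
    then have "a *s y = 0" "b *s y = 0" using f_scale[OF x(1) x(1), of a] f0 x(2) by auto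
    then show "y \<in> torsion scale" using ab(1) by (auto simp: torsion_def)
  qed
  have "\<exists>C. is_direct_sum scale B (f ` A) C"
  proof (rule homogeneous_submodule_direct_summand[OF D(2) F FB tors])
    fix P :: "'d set"
    assume P: "prime_ideal P" "P \<noteq> {0}"
    then interpret dedekind_module_at scale P by (rule at_prime)
    obtain l where l: "homogeneous scale p l (pc S)"
      using hom P unfolding homogeneous_components_def by blast
    have lA: "homogeneous scale p l (pc A')"
      by (rule homogeneous_summand[OF is_direct_sum_commute[OF A'] homogeneous_summand[OF AB l]])
    have "homogeneous scale p l (pc (f ` A))"
      unfolding homogeneous_def
    proof (intro conjI ballI impI)
      show "1 \<le> l" using l by (simp add: homogeneous_def)
      fix y assume y: "y \<in> pc (f ` A)"
      then have "y \<in> f ` A" using pc_subset[of "f ` A"] by (rule subsetD[rotated])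
      then obtain a where a: "a \<in> A'" "y = f a" using fA by blast
      have aA: "a \<in> A" using a(1) D'(5) by blast
      have da: "d *s a = 0 \<longleftrightarrow> d *s y = 0" for d
        using inj[OF subspace_scale[OF D'(2) a(1)], of d] f_scale[OF aA aA, of d] a(2) f0 by metis
      have apc: "a \<in> pc A'" using y a(1) da by (auto simp: primary_component_def)
      then have "p ^ l *s a = 0" using lA by (simp add: homogeneous_def)
      then show "p ^ l *s y = 0" using da by blast
      assume "p *s y = 0"
      then have "p *s a = 0" using da by simp
      then obtain a' where a': "a' \<in> pc A'" "a = p ^ (l - 1) *s a'"
        using lA apc unfolding homogeneous_def by blast
      have a'A: "a' \<in> A" using a'(1) pc_subset D'(5) by blast
      have "f a' \<in> pc (f ` A)"
      proof -
        obtain n where n: "\<forall>d\<in>ideal_power P n. d *s a' = 0" using a'(1) by (auto simp: primary_component_def)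
        have "d *s f a' = 0" if "d \<in> ideal_power P n" for d
          using n that f_scale[OF a'A a'A, of d] f0 by simp
        then show ?thesis using a'A by (auto simp: primary_component_def)
      qed
      moreover have "y = p ^ (l - 1) *s f a'" using a(2) a'(2) f_scale[OF a'A a'A] by metis
      ultimately show "\<exists>z\<in>pc (f ` A). y = p ^ (l - 1) *s z" by blast
    qed
    moreover have "\<forall>x\<in>pc B. p ^ l *s x = 0"
      using l pc_mono[OF D(5)] by (auto simp: homogeneous_def)
    ultimately show "\<exists>l. homogeneous scale p l (pc (f ` A)) \<and> (\<forall>x\<in>pc B. p ^ l *s x = 0)" by blast
  qed blast
  then show "direct_summand scale (f ` A) B" by (auto simp: direct_summand_def)
qed

section \<open>C4 forces homogeneous primary components\<close>

lemma pc_distinct_primes: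
  assumes "dedekind_module_at scale P" "dedekind_module_at scale Q"
    and x: "x \<in> primary_component scale P S" "x \<in> primary_component scale Q T" "x \<noteq> 0"
  shows "P = Q"
proof -
  interpret P: dedekind_module_at scale P by fact
  interpret Q: dedekind_module_at scale Q by fact
  have "P \<subseteq> Q"
  proof
    fix d assume "d \<in> P"
    obtain n where "\<forall>d\<in>ideal_power P n. d *s x = 0" using x(1) by (auto simp: primary_component_def)
    then have "d ^ n *s x = 0" using power_in_ideal_power[OF \<open>d \<in> P\<close>] by blast
    then show "d \<in> Q" using Q.scale_eq_0[OF Q.power_notin x(2)] x(3) by blast
  qed
  then show ?thesis using Q.eq_if_prime_le[OF P.prime P.nonzero] by blast
qed

text \<open>At a prime other than P a P-primary module has zero component, so only the condition at
  P remains to be met.\<close>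

lemma primary_direct_summand:
  assumes P: "dedekind_module_at scale P" and B: "subspace B"
    and F: "subspace F" "F \<subseteq> primary_component scale P B" "homogeneous scale (uniformizer P) l F"
    and l: "\<And>x. x \<in> primary_component scale P B \<Longrightarrow> uniformizer P ^ l *s x = 0"
  obtains C where "is_direct_sum scale B F C"
proof -
  interpret dedekind_module_at scale P by fact
  have FB: "F \<subseteq> B" using F(2) pc_subset by blast
  have tors: "F \<subseteq> torsion scale"
  proof
    fix x assume "x \<in> F"
    then have "x \<in> pc B" using F(2) by blast
    then obtain d where "d \<noteq> 0" "d *s x = 0" by (rule pc_nonzero_power)
    then show "x \<in> torsion scale" by (auto simp: torsion_def)
  qed
  show thesis
  proof (rule homogeneous_submodule_direct_summand[OF B F(1) FB tors])
    fix Q :: "'d set"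
    assume Q: "prime_ideal Q" "Q \<noteq> {0}" "primary_component scale Q F \<noteq> {0}"
    interpret Q: dedekind_module_at scale Q by (rule at_prime[OF Q(1,2)])
    obtain x where x: "x \<in> Q.pc F" "x \<noteq> 0" using Q(3) subspace_0[OF Q.subspace_pc[OF F(1)]] by blast
    have "x \<in> pc B" using x(1) F(2) Q.pc_subset by blast
    then have "P = Q" using pc_distinct_primes[OF P Q.dedekind_module_at_axioms _ x(1,2)] by blast
    moreover have "pc F = F" using F(2) pc_Int[of F] pc_Int[of B] by blast
    ultimately show "\<exists>l. homogeneous scale (uniformizer Q) l (primary_component scale Q F) \<and>
        (\<forall>x\<in>primary_component scale Q B. uniformizer Q ^ l *s x = 0)"
      using F(3) l by auto
  qed (rule that)
qed

lemma pc_exponent: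
  assumes P: "dedekind_module_at scale P" and S: "subspace S" and nz: "primary_component scale P S \<noteq> {0}"
  obtains l z where "1 \<le> l" "\<And>x. x \<in> primary_component scale P S \<Longrightarrow> uniformizer P ^ l *s x = 0"
    "z \<in> primary_component scale P S" "uniformizer P ^ (l - 1) *s z \<noteq> 0"
proof -
  interpret dedekind_module_at scale P by fact
  obtain G where G: "finite G" "pc S = span G" using noetherian[OF subspace_pc[OF S]] by blast
  have "G \<subseteq> pc S" using G(2) span_superset by blast
  with G(1) have "\<exists>n. \<forall>g\<in>G. p ^ n *s g = 0"
  proof induction
    case (insert g G)
    then obtain n where n: "\<forall>g\<in>G. p ^ n *s g = 0" by blast
    obtain m where m: "p ^ m *s g = 0" using insert.prems pc_power by blast
    have "\<forall>h\<in>insert g G. p ^ max m n *s h = 0"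
      using n m power_scale_eq_0[of p _ _ "max m n"] by auto
    then show ?case by blast
  qed simp
  then obtain n where n: "\<forall>g\<in>G. p ^ n *s g = 0" by blast
  have "p ^ n *s x = 0" if "x \<in> pc S" for x
    using that unfolding G(2)
  proof (induction x rule: span_induct_alt)
    case (step c x y)
    have "p ^ n *s (c *s x + y) = c *s p ^ n *s x + p ^ n *s y"
      by (simp add: scale_right_distrib mult.commute)
    then show ?case using step n by simp
  qed simp
  then have ex: "\<forall>x\<in>pc S. p ^ n *s x = 0" by blast
  define l where "l = (LEAST l. \<forall>x\<in>pc S. p ^ l *s x = 0)"
  have l: "\<forall>x\<in>pc S. p ^ l *s x = 0" unfolding l_def using ex by (rule LeastI)
  have "l \<noteq> 0"
  proof
    assume "l = 0"
    then have "pc S \<subseteq> {0}" using l by auto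
    then show False using nz subspace_0[OF subspace_pc[OF S]] by blast
  qed
  then have "\<not> (\<forall>x\<in>pc S. p ^ (l - 1) *s x = 0)"
    using not_less_Least[of "l - 1" "\<lambda>l. \<forall>x\<in>pc S. p ^ l *s x = 0"] by (simp add: l_def)
  then obtain z where "z \<in> pc S" "p ^ (l - 1) *s z \<noteq> 0" by blast
  then show thesis using that[of l z] l \<open>l \<noteq> 0\<close> by simp
qed

text \<open>
  If a \<open>P\<close>-primary summand of exponent \<open>l\<close> had a complement with \<open>P\<close>-component of smaller exponent \<open>m\<close>,
  a cyclic summand \<open>Dw\<close> of length \<open>m\<close> would embed as the non-summand \<open>D p\<^sup>l\<^sup>-\<^sup>m t\<close>.
\<close>

lemma not_C4_if_two_exponents:
  assumes P: "dedekind_module_at scale P" and FC: "is_direct_sum scale S F C"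
    and F: "F \<subseteq> primary_component scale P S" and t: "t \<in> F" "uniformizer P ^ l *s t = 0" "uniformizer P ^ (l - 1) *s t \<noteq> 0"
    and w: "w \<in> primary_component scale P C" "uniformizer P ^ (m - 1) *s w \<noteq> 0"
    and m: "\<And>x. x \<in> primary_component scale P C \<Longrightarrow> uniformizer P ^ m *s x = 0" "1 \<le> m" "m < l"
  shows "\<not> C4 scale S"
proof
  assume C4: "C4 scale S"
  interpret dedekind_module_at scale P by fact
  note D = is_direct_sumD[OF FC]
  have wC: "w \<in> C" using w(1) pc_subset by blast
  have "span {w} \<subseteq> pc C" by (rule span_minimal) (use w subspace_pc[OF D(2)] in auto)
  then obtain C' where C': "is_direct_sum scale C (span {w}) C'"
    using primary_direct_summand[OF P D(2) subspace_span _ cyclic_homogeneous[OF w(1) m(1)[OF w(1)] w(2)] m(1)] by blast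
  note D' = is_direct_sumD[OF C']
  have sub: "subspace (F + C')" "F \<subseteq> F + C'" "C' \<subseteq> F + C'" "F + C' \<subseteq> S"
    using subspace_set_plus[OF D(1) D'(2)] set_plus_superset[OF D(1) D'(2)]
      set_plus_subset[OF D(3,4), of C'] D(5) D'(5) by auto
  have dsum: "is_direct_sum scale S (span {w}) (F + C')"
  proof (rule is_direct_sumI)
    show "subspace S" "subspace (F + C')" "F + C' \<subseteq> S" by fact+
    show "span {w} \<subseteq> S" using D'(4) D(5) by blast
    fix x
    show "x = 0" if x: "x \<in> span {w}" "x \<in> F + C'"
    proof -
      obtain a c where ac: "a \<in> F" "c \<in> C'" "x = a + c" using x(2) by (auto simp: set_plus_def)
      have "a = 0 \<and> c = x"
        by (rule direct_sum_unique[OF FC ac(1) _ subspace_0[OF D(1)]]) (use ac x(1) D' in auto)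
      then show ?thesis using D'(6) x(1) ac(2) by blast
    qed
    show "\<exists>a\<in>span {w}. \<exists>b\<in>F + C'. x = a + b" if x: "x \<in> S"
    proof -
      obtain a c where ac: "a \<in> F" "c \<in> C" "x = a + c" using D(7) x by blast
      obtain v c' where vc: "v \<in> span {w}" "c' \<in> C'" "c = v + c'" using D'(7) ac(2) by blast
      have "x = v + (a + c')" using ac vc by (simp add: algebra_simps)
      moreover have "a + c' \<in> F + C'" using set_plus_intro[OF ac(1) vc(2)] .
      ultimately show ?thesis using vc(1) by blast
    qed
  qed simp
  \<comment> \<open>The exponent l - m is chosen so that y has the same annihilator P^m as
    w.\<close>
  define y where "y = p ^ (l - m) *s t"
  have yF: "y \<in> F" unfolding y_def by (rule subspace_scale[OF D(1) t(1)])
  then have ypc: "y \<in> pc S" using F by blast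
  have "p ^ m *s y = p ^ l *s t" "p ^ (m - 1) *s y = p ^ (l - 1) *s t"
    using m(2,3) by (simp_all add: y_def flip: power_add)
  then have y: "p ^ m *s y = 0" "p ^ (m - 1) *s y \<noteq> 0" using t by simp_all
  have ann: "d *s w = 0 \<longleftrightarrow> d *s y = 0" for d
    using annihilator_power[OF w(1) m(1)[OF w(1)]] w(2) annihilator_power[OF ypc y(1)] y(2) by blast
  \<comment> \<open>The coefficient of v at w is determined only modulo the annihilator of w, which
    also kills y; hence any choice gives the same value.\<close>
  define f where "f v = (SOME d. d *s w = v) *s y" for v
  have f: "f (d *s w) = d *s y" for d
  proof -
    define e where "e = (SOME e. e *s w = d *s w)"
    have "e *s w = d *s w" unfolding e_def by (rule someI[of _ d]) simp
    then have "(e - d) *s w = 0" by (simp add: scale_left_diff_distrib)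
    then have "(e - d) *s y = 0" using ann by blast
    then show ?thesis by (simp add: f_def e_def scale_left_diff_distrib)
  qed
  have f_image: "f ` span {w} = span {y}" by (auto simp: span_singleton f image_iff)
  have "hom_on scale (span {w}) (F + C') f"
    unfolding hom_on_def
  proof (intro conjI ballI allI)
    show "f ` span {w} \<subseteq> F + C'"
      unfolding f_image using yF sub(2) by (intro span_minimal sub(1)) auto
    fix v assume "v \<in> span {w}"
    then obtain d where d: "v = d *s w" by (auto simp: span_singleton)
    show "f (r *s v) = r *s f v" for r by (simp add: d f)
    show "f (v + v') = f v + f v'" if "v' \<in> span {w}" for v'
    proof -
      obtain e where "v' = e *s w" using \<open>v' \<in> span {w}\<close> by (auto simp: span_singleton)
      then show ?thesis using f[of "d + e"] by (simp add: d f scale_left_distrib)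
    qed
  qed
  moreover have "{v \<in> span {w}. f v = 0} = {0}"
  proof -
    have "v = 0" if v: "v \<in> span {w}" "f v = 0" for v
    proof -
      obtain d where "v = d *s w" using v(1) by (auto simp: span_singleton)
      then show ?thesis using v(2) f ann by simp
    qed
    moreover have "f 0 = 0" using f[of 0] by simp
    ultimately show ?thesis using span_zero by blast
  qed
  moreover have "direct_summand scale {0} (span {w})"
    unfolding direct_summand_def by (intro exI[of _ "span {w}"] is_direct_sumI) (auto simp: span_zero)
  ultimately have "direct_summand scale (span {y}) (F + C')"
    using C4 dsum f_image unfolding C4_def by metis
  then obtain G where G: "is_direct_sum scale (F + C') (span {y}) G" by (auto simp: direct_summand_def)
  note DG = is_direct_sumD[OF G]
  \<comment> \<open>The part e of t in D y is killed by p^(l-1), since m \<le> l - 1. So p^(l-1) t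
    lies in the complement G, but it is also p^(m-1) y and nonzero.\<close>
  obtain e g where eg: "e \<in> span {y}" "g \<in> G" "t = e + g" using DG(7) t(1) sub(2) by blast
  obtain d where d: "e = d *s y" using eg(1) by (auto simp: span_singleton)
  have "p ^ (l - 1) *s y = 0" using power_scale_eq_0[OF y(1)] m(3) by simp
  then have "p ^ (l - 1) *s e = 0" by (metis d scale_left_commute scale_zero_right)
  then have "p ^ (l - 1) *s t = p ^ (l - 1) *s g" by (simp add: eg(3) scale_right_distrib)
  then have "p ^ (l - 1) *s t \<in> G" using subspace_scale[OF DG(2) eg(2)] by simp
  moreover have "p ^ (l - 1) *s t = p ^ (m - 1) *s y"
    using \<open>p ^ (m - 1) *s y = p ^ (l - 1) *s t\<close> by (rule sym)
  then have "p ^ (l - 1) *s t \<in> span {y}" by (auto simp: span_singleton)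
  ultimately show False using DG(6) t(3) by blast
qed

text \<open>Let l be the exponent of the P-component and F a largest homogeneous submodule of
  exponent l in it; F splits off. If the complement had a nonzero P-component of exponent m, then m
  = l would let F grow by a cyclic module, and m < l is excluded by
  \<open>not_C4_if_two_exponents\<close>. Hence F is the whole component.\<close>

lemma homogeneous_components_if_C4:
  assumes S: "subspace S" and C4: "C4 scale S"
  shows "homogeneous_components scale S"
  unfolding homogeneous_components_def
proof (intro allI impI, elim conjE)
  fix P :: "'d set"
  assume prime: "prime_ideal P" "P \<noteq> {0}"
  then have P: "dedekind_module_at scale P" by (rule at_prime)
  interpret dedekind_module_at scale P by (rule P)
  show "\<exists>l. homogeneous scale p l (pc S)"
  proof (cases "pc S = {0}")
    case True
    then show ?thesis using homogeneous_zero[OF module_axioms] by metis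
  next
    case False
    then obtain l z where l: "1 \<le> l" "\<And>x. x \<in> pc S \<Longrightarrow> p ^ l *s x = 0"
      and z: "z \<in> pc S" "p ^ (l - 1) *s z \<noteq> 0" using pc_exponent[OF P S] by metis
    let ?A = "{F. subspace F \<and> F \<subseteq> pc S \<and> homogeneous scale p l F}"
    have "span {z} \<in> ?A"
      using z cyclic_homogeneous[OF z(1) l(2)[OF z(1)] z(2)] span_minimal[of "{z}" "pc S"] subspace_pc[OF S] by auto
    then have "?A \<noteq> {}" by blast
    then obtain F where F: "F \<in> ?A" "\<And>X. X \<in> ?A \<Longrightarrow> F \<subseteq> X \<Longrightarrow> X = F"
      by (rule maximal_submodule) auto
    then have Fs: "subspace F" "F \<subseteq> pc S" "homogeneous scale p l F" by auto
    have "F \<noteq> {0}"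
    proof
      assume "F = {0}"
      then have "span {z} = {0}" using F(2)[OF \<open>span {z} \<in> ?A\<close>] span_zero by auto
      then have "z = 0" using span_base[of z "{z}"] by auto
      then show False using z(2) by simp
    qed
    then obtain t where t: "t \<in> F" "p ^ (l - 1) *s t \<noteq> 0"
      using homogeneous_top[OF module_axioms Fs(1,3)] by blast
    obtain C where C: "is_direct_sum scale S F C"
      using primary_direct_summand[OF P S Fs l(2)] .
    note D = is_direct_sumD[OF C]
    have "pc C = {0}"
    proof (rule ccontr)
      assume "pc C \<noteq> {0}"
      then obtain m w where m: "1 \<le> m" "\<And>x. x \<in> pc C \<Longrightarrow> p ^ m *s x = 0"
        and w: "w \<in> pc C" "p ^ (m - 1) *s w \<noteq> 0" using pc_exponent[OF P D(2)] by metis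
      have wC: "w \<in> C" "w \<in> pc S" using w(1) pc_subset pc_mono[OF D(5)] by auto
      have "m \<le> l"
        using power_scale_eq_0[OF l(2)[OF wC(2)], of "m - 1"] w(2) by linarith
      moreover have "m \<noteq> l"
      proof
        assume "m = l"
        have W: "homogeneous scale p l (span {w})"
          using cyclic_homogeneous[OF w(1) m(2)[OF w(1)] w(2)] \<open>m = l\<close> by simp
        have WC: "span {w} \<subseteq> C" using wC(1) D(2) by (intro span_minimal) auto
        have sup: "F \<subseteq> F + span {w}" "span {w} \<subseteq> F + span {w}"
          using set_plus_superset[OF Fs(1) subspace_span] by auto
        have "homogeneous scale p l (F + span {w})"
          unfolding homogeneous_def
        proof (intro conjI ballI impI)
          fix x assume "x \<in> F + span {w}"
          then obtain a b where ab: "a \<in> F" "b \<in> span {w}" "x = a + b" by (auto simp: set_plus_def)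
          show "p ^ l *s x = 0" using Fs(3) W ab by (simp add: homogeneous_def scale_right_distrib)
          assume "p *s x = 0"
          then have "p *s a = 0 \<and> p *s b = 0"
            using ab WC D subspace_scale subspace_0
            by (intro direct_sum_unique[OF C]) (auto simp: scale_right_distrib)
          then obtain a' b' where "a' \<in> F" "a = p ^ (l - 1) *s a'" "b' \<in> span {w}" "b = p ^ (l - 1) *s b'"
            using Fs(3) W ab unfolding homogeneous_def by metis
          then show "\<exists>y\<in>F + span {w}. x = p ^ (l - 1) *s y"
            using ab(3) scale_right_distrib by (metis set_plus_intro)
        qed (rule l(1))
        moreover have "F + span {w} \<subseteq> pc S"
          using Fs(2) wC(2) subspace_pc[OF S] by (intro set_plus_subset span_minimal) auto
        moreover have "subspace (F + span {w})" using subspace_set_plus Fs(1) by blast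
        ultimately have "F + span {w} = F" using F(2) sup(1) by blast
        then have "w \<in> F" using sup(2) span_base[of w "{w}"] by blast
        then have "w = 0" using D(6) wC(1) by blast
        then show False using w(2) by simp
      qed
      ultimately have "m < l" by simp
      moreover have "p ^ l *s t = 0" using Fs(3) t(1) by (simp add: homogeneous_def)
      ultimately show False using not_C4_if_two_exponents[OF P C Fs(2) t(1) _ t(2) w m(2) m(1)] C4 by blast
    qed
    then have "pc S = F" using pc_subset_if_complement_zero[OF C] Fs(2) by blast
    then show ?thesis using Fs(3) by blast
  qed
qed

end

section \<open>C4 bounds the rank\<close>

context dedekind_module
begin

text \<open>
  Modulo a submodule \<open>N\<close> maximal with \<open>N \<inter> Dx = 0\<close> every element has a nonzero multiple in \<open>Dx\<close>.
\<close>

lemma ex_linear_functional: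
  assumes S: "subspace S" and x: "x \<in> S" "\<And>d. d *s x = 0 \<Longrightarrow> d = 0"
  obtains h where "\<And>a b. a \<in> S \<Longrightarrow> b \<in> S \<Longrightarrow> h (a + b) = h a + h b"
    "\<And>r a. a \<in> S \<Longrightarrow> h (r *s a) = r * h a" "h x \<noteq> (0 :: 'd)"
proof -
  let ?A = "{N. subspace N \<and> N \<subseteq> S \<and> N \<inter> span {x} \<subseteq> {0}}"
  have "{0} \<in> ?A" using subspace_0[OF S] by auto
  then have "?A \<noteq> {}" by blast
  then obtain N where N: "N \<in> ?A" "\<And>X. X \<in> ?A \<Longrightarrow> N \<subseteq> X \<Longrightarrow> X = N"
    by (rule maximal_submodule) auto
  then have Ns: "subspace N" "N \<subseteq> S" and Nx: "\<And>e. e *s x \<in> N \<Longrightarrow> e *s x = 0"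
    by (auto simp: span_singleton)
  have ex1: "\<exists>d e. d \<noteq> 0 \<and> d *s a - e *s x \<in> N" if a: "a \<in> S" for a
  proof (rule ccontr)
    assume contra: "\<not> (\<exists>d e. d \<noteq> 0 \<and> d *s a - e *s x \<in> N)"
    have sup: "N \<subseteq> N + span {a}" "span {a} \<subseteq> N + span {a}"
      using set_plus_superset[OF Ns(1) subspace_span] by auto
    have "N + span {a} \<in> ?A"
    proof (intro CollectI conjI)
      show "subspace (N + span {a})" using subspace_set_plus Ns(1) by blast
      show "N + span {a} \<subseteq> S" using set_plus_subset[OF S Ns(2)] span_minimal[of "{a}" S] a S by blast
      show "(N + span {a}) \<inter> span {x} \<subseteq> {0}"
      proof
        fix v assume v: "v \<in> (N + span {a}) \<inter> span {x}"
        then obtain n d where nd: "n \<in> N" "v = n + d *s a" by (auto simp: set_plus_def span_singleton)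
        obtain e where e: "v = e *s x" using v by (auto simp: span_singleton)
        have "d *s a - e *s x = - n" using nd(2) e by (simp add: algebra_simps)
        then have "d *s a - e *s x \<in> N" using subspace_neg[OF Ns(1) nd(1)] by simp
        then have "d = 0" using contra by blast
        then have "e *s x \<in> N" using nd e by simp
        then show "v \<in> {0}" using Nx e by simp
      qed
    qed
    then have "N + span {a} = N" using N(2) sup(1) by blast
    then have "a \<in> N" using sup(2) span_base[of a "{a}"] by blast
    then have "1 *s a - 0 *s x \<in> N" by simp
    then show False using contra one_neq_zero by blast
  qed
  obtain G where G: "finite G" "S = span G" using noetherian[OF S] by blast
  have "G \<subseteq> S" using G(2) span_superset by blast
  with G(1) have "\<exists>d. d \<noteq> 0 \<and> (\<forall>g\<in>G. \<exists>e. d *s g - e *s x \<in> N)"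
  proof induction
    case empty then show ?case using one_neq_zero by blast
  next
    case (insert g G)
    then obtain d where d: "d \<noteq> 0" "\<forall>g\<in>G. \<exists>e. d *s g - e *s x \<in> N" by blast
    obtain c e where c: "c \<noteq> 0" "c *s g - e *s x \<in> N" using ex1 insert.prems by blast
    have mult: "\<exists>e. (b * c) *s h - e *s x \<in> N" if bc: "c *s h - e *s x \<in> N" for b c e h
      using subspace_scale[OF Ns(1) bc, of b] by (auto simp: scale_right_diff_distrib)
    have "\<exists>e. (c * d) *s h - e *s x \<in> N" if "h \<in> insert g G" for h
      using mult[of c g e d] mult[of d h _ c] c(2) d(2) that by (auto simp: mult.commute)
    moreover have "c * d \<noteq> 0" using c(1) d(1) by simp
    ultimately show ?case by blast
  qed
  then obtain d where d: "d \<noteq> 0" "\<forall>g\<in>G. \<exists>e. d *s g - e *s x \<in> N" by blast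
  have exS: "\<exists>e. d *s a - e *s x \<in> N" if "a \<in> S" for a
    using that unfolding G(2)
  proof (induction a rule: span_induct_alt)
    case base show ?case using subspace_0[OF Ns(1)] by (intro exI[of _ 0]) simp
  next
    case (step c a b)
    obtain e where e: "d *s a - e *s x \<in> N" using step(1) d(2) by blast
    obtain e' where e': "d *s b - e' *s x \<in> N" using step(2) by blast
    have "c *s (d *s a - e *s x) + (d *s b - e' *s x) \<in> N"
      by (intro subspace_add[OF Ns(1)] subspace_scale[OF Ns(1)] e e')
    moreover have "c *s (d *s a - e *s x) + (d *s b - e' *s x) = d *s (c *s a + b) - (c * e + e') *s x"
      by (simp add: algebra_simps)
    ultimately show ?case by metis
  qed
  \<comment> \<open>One multiplier \<open>d\<close> serves all of S, by finite generation, so h a is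
    the coefficient of x in d a modulo N. It is unique because x is torsion-free and D x meets N
    trivially.\<close>
  define h where "h a = (THE e. d *s a - e *s x \<in> N)" for a
  have h: "h a = e" if e: "d *s a - e *s x \<in> N" for a e
    unfolding h_def
  proof (rule the_equality)
    show "d *s a - e *s x \<in> N" by fact
    fix e' assume "d *s a - e' *s x \<in> N"
    then have "(d *s a - e *s x) - (d *s a - e' *s x) \<in> N" using subspace_diff[OF Ns(1) e] by blast
    then have "(e' - e) *s x \<in> N" by (simp add: scale_left_diff_distrib)
    then show "e' = e" using x(2) Nx by fastforce
  qed
  have hN: "d *s a - h a *s x \<in> N" if "a \<in> S" for a using exS[OF that] h by metis
  show thesis
  proof (rule that[of h])
    fix a b assume ab: "a \<in> S" "b \<in> S"
    have "(d *s a - h a *s x) + (d *s b - h b *s x) \<in> N" using hN ab subspace_add[OF Ns(1)] by blast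
    then show "h (a + b) = h a + h b" by (intro h) (simp add: algebra_simps)
  next
    fix r a assume a: "a \<in> S"
    have "r *s (d *s a - h a *s x) \<in> N" using hN a subspace_scale[OF Ns(1)] by blast
    then show "h (r *s a) = r * h a" by (intro h) (simp add: algebra_simps)
  next
    have "h x = d" by (rule h) (simp add: subspace_0[OF Ns(1)])
    then show "h x \<noteq> 0" using d(1) by simp
  qed
qed

text \<open>The image I of h is a nonzero ideal, and invertibility makes it projective.
  \<open>ideal_invertible\<close> writes g = h x as a combination of products r (h b) with r I
  inside g D; each product contributes the map from i to (r i / g) b, and the combination of these
  maps is a section.\<close>

lemma ex_section:
  assumes S: "subspace S"
    and h: "\<And>a b. a \<in> S \<Longrightarrow> b \<in> S \<Longrightarrow> h (a + b) = h a + h b" "\<And>r a. a \<in> S \<Longrightarrow> h (r *s a) = r * h a"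
    and x: "x \<in> S" "h x \<noteq> (0 :: 'd)"
  obtains \<sigma> where "\<And>i j. i \<in> h ` S \<Longrightarrow> j \<in> h ` S \<Longrightarrow> \<sigma> (i + j) = \<sigma> i + \<sigma> j"
    "\<And>r i. i \<in> h ` S \<Longrightarrow> \<sigma> (r * i) = r *s \<sigma> i" "\<And>i. i \<in> h ` S \<Longrightarrow> \<sigma> i \<in> S \<and> h (\<sigma> i) = i"
proof -
  let ?I = "h ` S"
  define g where "g = h x"
  have I: "ideal ?I"
  proof (rule idealI)
    show "0 \<in> ?I" using h(2)[OF x(1), of 0] subspace_0[OF S] by (metis imageI mult_zero_left scale_zero_left)
    fix a b assume "a \<in> ?I" "b \<in> ?I"
    then obtain a' b' where "a' \<in> S" "b' \<in> S" "a = h a'" "b = h b'" by blast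
    then show "a + b \<in> ?I" using h(1) subspace_add[OF S] by (metis imageI)
  next
    fix c a assume "a \<in> ?I"
    then obtain a' where "a' \<in> S" "a = h a'" by blast
    then show "c * a \<in> ?I" using h(2) subspace_scale[OF S] by (metis imageI)
  qed
  have g: "g \<in> ?I" "g \<noteq> 0" using x by (auto simp: g_def)
  \<comment> \<open>The induction over the combination needs every q, not only g: the map belonging
    to q satisfies h (\<sigma> i) = (q/g) i, so q = g gives a section.\<close>
  have "\<exists>\<sigma>. (\<forall>i\<in>?I. \<forall>j\<in>?I. \<sigma> (i + j) = \<sigma> i + \<sigma> j) \<and> (\<forall>r. \<forall>i\<in>?I. \<sigma> (r * i) = r *s \<sigma> i) \<and>
      (\<forall>i\<in>?I. \<sigma> i \<in> S \<and> g * h (\<sigma> i) = q * i)"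
    if "q \<in> module.span (*) {r * i | r i. (\<forall>x\<in>?I. g dvd r * x) \<and> i \<in> ?I}" for q
    using that
  proof (induction q rule: module.span_induct_alt[OF module_mult, consumes 1])
    case 1
    have "h 0 = 0" using h(2)[OF x(1), of 0] by simp
    then show ?case using subspace_0[OF S] by (intro exI[of _ "\<lambda>_. 0"]) simp
  next
    case (2 c q q')
    from 2(2) obtain \<sigma> where
      "(\<forall>i\<in>?I. \<forall>j\<in>?I. \<sigma> (i + j) = \<sigma> i + \<sigma> j) \<and> (\<forall>r. \<forall>i\<in>?I. \<sigma> (r * i) = r *s \<sigma> i) \<and>
        (\<forall>i\<in>?I. \<sigma> i \<in> S \<and> g * h (\<sigma> i) = q' * i)" by (rule exE)
    then have \<sigma>: "\<And>i j. i \<in> ?I \<Longrightarrow> j \<in> ?I \<Longrightarrow> \<sigma> (i + j) = \<sigma> i + \<sigma> j"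
      "\<And>r i. i \<in> ?I \<Longrightarrow> \<sigma> (r * i) = r *s \<sigma> i" "\<And>i. i \<in> ?I \<Longrightarrow> \<sigma> i \<in> S"
      "\<And>i. i \<in> ?I \<Longrightarrow> g * h (\<sigma> i) = q' * i" by auto
    obtain r b where r: "q = r * h b" "b \<in> S" "\<And>x. x \<in> ?I \<Longrightarrow> g dvd r * x" using 2(1) by blast
    \<comment> \<open>\<open>t i\<close> is the quotient r i / g, which lies in D.\<close>
    define t where "t i = (THE t. r * i = g * t)" for i
    have tI: "t i = k" if "r * i = g * k" for i k
      unfolding t_def by (rule the_equality) (use that g(2) in auto)
    have t: "r * i = g * t i" if i: "i \<in> ?I" for i
    proof -
      obtain k where "r * i = g * k" using r(3)[OF i] by (auto elim: dvdE)
      then show ?thesis using tI[of i k] by simp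
    qed
    define \<tau> where "\<tau> i = (c * t i) *s b + \<sigma> i" for i
    have "\<tau> (i + j) = \<tau> i + \<tau> j" if ij: "i \<in> ?I" "j \<in> ?I" for i j
    proof -
      have "t (i + j) = t i + t j" using t ij by (intro tI) (simp add: distrib_left)
      then show ?thesis using \<sigma>(1)[OF ij] by (simp add: \<tau>_def algebra_simps)
    qed
    moreover have "\<tau> (a * i) = a *s \<tau> i" if i: "i \<in> ?I" for a i
    proof -
      have "r * (a * i) = a * (r * i)" by (simp only: mult_ac)
      also have "\<dots> = g * (a * t i)" unfolding t[OF i] by (simp only: mult_ac)
      finally have "t (a * i) = a * t i" by (rule tI)
      then show ?thesis using \<sigma>(2)[OF i] by (simp add: \<tau>_def scale_right_distrib mult_ac)
    qed
    moreover have "\<tau> i \<in> S" if "i \<in> ?I" for i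
      unfolding \<tau>_def using subspace_add[OF S subspace_scale[OF S r(2)] \<sigma>(3)[OF that]] .
    moreover have "g * h (\<tau> i) = (c * q + q') * i" if i: "i \<in> ?I" for i
    proof -
      have "h (\<tau> i) = (c * t i) * h b + h (\<sigma> i)"
        unfolding \<tau>_def using h(1)[OF subspace_scale[OF S r(2)] \<sigma>(3)[OF i]] h(2)[OF r(2)] by simp
      then have "g * h (\<tau> i) = c * (g * t i) * h b + g * h (\<sigma> i)" by (simp add: algebra_simps)
      also have "\<dots> = c * (r * i) * h b + q' * i" using t[OF i] \<sigma>(4)[OF i] by simp
      finally show ?thesis by (simp add: r(1) algebra_simps)
    qed
    ultimately show ?case by blast
  qed
  from this[OF ideal_invertible[OF dedekind I g]] obtain \<sigma>
    where \<sigma>: "(\<forall>i\<in>?I. \<forall>j\<in>?I. \<sigma> (i + j) = \<sigma> i + \<sigma> j) \<and> (\<forall>r. \<forall>i\<in>?I. \<sigma> (r * i) = r *s \<sigma> i) \<and>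
      (\<forall>i\<in>?I. \<sigma> i \<in> S \<and> g * h (\<sigma> i) = g * i)" by (rule exE)
  show thesis by (rule that[of \<sigma>]) (use \<sigma> g(2) in auto)
qed

text \<open>Take a nonzero i in I for which the principal ideal D i is maximal and write i = c j.
  Then D i is contained in D j, so both agree, j = r i, and cancelling gives c r = 1.\<close>

lemma ideal_not_divisible:
  assumes I: "I \<noteq> {0 :: 'd}" "0 \<in> I" and div: "\<And>i. i \<in> I \<Longrightarrow> \<exists>j\<in>I. i = c * j"
  shows "\<exists>b. c * b = 1"
proof -
  interpret R: noetherian_module "(*) :: 'd \<Rightarrow> 'd \<Rightarrow> 'd" by (rule noetherian_ring_module[OF noetherian_ring])
  let ?A = "{R.span {i} | i. i \<in> I \<and> i \<noteq> 0}"
  have "?A \<noteq> {}" using I by blast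
  then obtain M where M: "M \<in> ?A" "\<And>X. X \<in> ?A \<Longrightarrow> M \<subseteq> X \<Longrightarrow> X = M"
    by (rule R.maximal_submodule) auto
  then obtain i where i: "i \<in> I" "i \<noteq> 0" "M = R.span {i}" by blast
  obtain j where j: "j \<in> I" "i = c * j" using div i(1) by blast
  have "R.span {j} \<in> ?A" using j i(2) by auto
  moreover have "M \<subseteq> R.span {j}"
    unfolding i(3) using j(2) by (intro R.span_minimal R.subspace_span) (auto simp: R.span_singleton)
  ultimately have "j \<in> R.span {i}" using M(2) i(3) R.span_base[of j "{j}"] by blast
  then obtain r where "j = r * i" by (auto simp: R.span_singleton)
  then have "j * 1 = j * (c * r)" using j(2) by (metis mult.assoc mult.commute mult_1_right)
  moreover have "j \<noteq> 0" using i(2) j(2) by auto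
  ultimately have "c * r = 1" by (metis mult_cancel_left)
  then show ?thesis by blast
qed

text \<open>
  Rank at least two would give a splitting \<open>S = A \<oplus> K\<close> with \<open>A\<close> isomorphic to a nonzero ideal and \<open>b \<in> K\<close>
  torsion-free; for a nonunit \<open>c\<close> the embedding \<open>i \<mapsto> c i b\<close> then has a non-summand as image.
\<close>

lemma rank_le_1_if_C4:
  assumes S: "subspace S" and C4: "C4 scale S" and nf: "\<not> is_field TYPE('d)"
  shows "rank_le_1 scale S"
proof (rule ccontr)
  assume "\<not> rank_le_1 scale S"
  then obtain x y where xy: "x \<in> S" "y \<in> S" "\<And>a b. a *s x + b *s y = 0 \<Longrightarrow> a = 0 \<and> b = 0"
    unfolding rank_le_1_def by blast
  have "d = 0" if "d *s x = 0" for d using xy(3)[of d 0] that by simp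
  then obtain h where h: "\<And>a b. a \<in> S \<Longrightarrow> b \<in> S \<Longrightarrow> h (a + b) = h a + h b"
    "\<And>r a. a \<in> S \<Longrightarrow> h (r *s a) = r * h a" "h x \<noteq> 0"
    using ex_linear_functional[OF S xy(1)] by blast
  obtain \<sigma> where \<sigma>: "\<And>i j. i \<in> h ` S \<Longrightarrow> j \<in> h ` S \<Longrightarrow> \<sigma> (i + j) = \<sigma> i + \<sigma> j"
    "\<And>r i. i \<in> h ` S \<Longrightarrow> \<sigma> (r * i) = r *s \<sigma> i" "\<And>i. i \<in> h ` S \<Longrightarrow> \<sigma> i \<in> S \<and> h (\<sigma> i) = i"
    using ex_section[OF S h(1,2) xy(1) h(3)] by blast
  have h0: "h 0 = 0" using h(2)[OF xy(1), of 0] by simp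
  have hS0: "0 \<in> h ` S" using h0 subspace_0[OF S] by (metis imageI)
  have \<sigma>0: "\<sigma> 0 = 0" using \<sigma>(2)[OF hS0, of 0] by simp
  define A where "A = \<sigma> ` (h ` S)"
  define K where "K = {a \<in> S. h a = 0}"
  have AS: "A \<subseteq> S" using \<sigma>(3) by (auto simp: A_def)
  have hA: "a = \<sigma> (h a)" if "a \<in> A" for a using that \<sigma>(3) by (auto simp: A_def)
  have A: "subspace A"
  proof (rule subspaceI)
    show "0 \<in> A" using \<sigma>0 hS0 by (metis A_def imageI)
    show "a + b \<in> A" if ab: "a \<in> A" "b \<in> A" for a b
    proof -
      have abS: "a \<in> S" "b \<in> S" using ab AS by auto
      have "a + b = \<sigma> (h a) + \<sigma> (h b)" using hA[OF ab(1)] hA[OF ab(2)] by simp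
      also have "\<dots> = \<sigma> (h (a + b))" using \<sigma>(1)[of "h a" "h b"] h(1)[OF abS] abS by simp
      finally show ?thesis using subspace_add[OF S abS] unfolding A_def by blast
    qed
    show "c *s a \<in> A" if a: "a \<in> A" for c a
    proof -
      have aS: "a \<in> S" using a AS by auto
      have "c *s a = c *s \<sigma> (h a)" using hA[OF a] by simp
      also have "\<dots> = \<sigma> (h (c *s a))" using \<sigma>(2)[of "h a" c] h(2)[OF aS, of c] aS by simp
      finally show ?thesis using subspace_scale[OF S aS, of c] unfolding A_def by blast
    qed
  qed
  have K: "subspace K"
    using h h0 subspace_0[OF S] subspace_add[OF S] subspace_scale[OF S]
    by (intro subspaceI) (auto simp: K_def)
  have AK: "is_direct_sum scale S A K"
  proof (rule is_direct_sumI[OF S A K AS])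
    show "K \<subseteq> S" by (auto simp: K_def)
    show "a = 0" if "a \<in> A" "a \<in> K" for a using hA[OF that(1)] that(2) \<sigma>0 by (simp add: K_def)
    show "\<exists>b\<in>A. \<exists>k\<in>K. a = b + k" if a: "a \<in> S" for a
    proof -
      have "\<sigma> (h a) \<in> A" using a by (simp add: A_def)
      have \<sigma>a: "\<sigma> (h a) \<in> S" "h (\<sigma> (h a)) = h a" using \<sigma>(3) a by auto
      then have "h ((a - \<sigma> (h a)) + \<sigma> (h a)) = h (a - \<sigma> (h a)) + h (\<sigma> (h a))"
        using h(1) subspace_diff[OF S] a by blast
      then have "a - \<sigma> (h a) \<in> K" using \<sigma>a subspace_diff[OF S] a by (simp add: K_def)
      then show ?thesis using \<open>\<sigma> (h a) \<in> A\<close> by (metis add.commute diff_add_cancel)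
    qed
  qed
  \<comment> \<open>The cross-multiplied difference lies in the kernel of h; it is torsion-free
    because x and y are independent and h x is nonzero.\<close>
  define b where "b = h y *s x - h x *s y"
  have bS: "b \<in> S" unfolding b_def using xy subspace_diff[OF S] subspace_scale[OF S] by blast
  have "h (b + h x *s y) = h b + h (h x *s y)" using h(1) bS subspace_scale[OF S xy(2)] by blast
  then have "h b = 0" using h(2) xy by (simp add: b_def mult.commute)
  then have bK: "b \<in> K" using bS by (simp add: K_def)
  have b0: "d = 0" if d: "d *s b = 0" for d
  proof -
    have "(d * h y) *s x + (- (d * h x)) *s y = 0" using d by (simp add: b_def scale_right_diff_distrib)
    then show ?thesis using xy(3)[of "d * h y" "- (d * h x)"] h(3) by simp
  qed
  obtain c :: 'd where c: "c \<noteq> 0" "\<And>e. c * e \<noteq> 1" using nf unfolding is_field_def by blast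
  define f where "f a = (c * h a) *s b" for a
  have "hom_on scale A K f"
    unfolding hom_on_def f_def
  proof (intro conjI ballI allI)
    show "(\<lambda>a. (c * h a) *s b) ` A \<subseteq> K" using subspace_scale[OF K bK] by blast
    fix a assume a: "a \<in> A"
    show "(c * h (r *s a)) *s b = r *s (c * h a) *s b" for r
      using h(2) a AS by (simp add: subset_iff mult_ac)
    show "(c * h (a + a')) *s b = (c * h a) *s b + (c * h a') *s b" if "a' \<in> A" for a'
      using h(1) a that AS by (simp add: subset_iff algebra_simps)
  qed
  moreover have "{a \<in> A. f a = 0} = {0}"
  proof -
    have "a = 0" if "a \<in> A" "f a = 0" for a
    proof -
      have "c * h a = 0" using b0[of "c * h a"] that(2) by (simp only: f_def)
      then show ?thesis using c(1) hA[OF that(1)] \<sigma>0 by simp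
    qed
    moreover have "f 0 = 0" by (simp add: f_def h0)
    ultimately show ?thesis using subspace_0[OF A] by blast
  qed
  moreover have "direct_summand scale {0} A"
    unfolding direct_summand_def using A subspace_0[OF A]
    by (intro exI[of _ A] is_direct_sumI) auto
  ultimately have "direct_summand scale (f ` A) K" using C4 AK unfolding C4_def by metis
  then obtain G where G: "is_direct_sum scale K (f ` A) G" by (auto simp: direct_summand_def)
  note D = is_direct_sumD[OF G]
  \<comment> \<open>With i b = e + g along the supposed splitting, c g lies both in the image and in
    G, so c i b = c e with e = f a. This yields i = c (h a): the ideal h S would be divisible by the
    nonunit c.\<close>
  have "\<exists>j\<in>h ` S. i = c * j" if i: "i \<in> h ` S" for i
  proof -
    have "i *s b \<in> K" using subspace_scale[OF K bK] .
    then obtain e g where eg: "e \<in> f ` A" "g \<in> G" "i *s b = e + g" using D(7) by blast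
    obtain a where a: "a \<in> A" "e = f a" using eg(1) by blast
    have "(c * i) *s b = f (\<sigma> i)" using \<sigma>(3)[OF i] by (simp add: f_def)
    then have "(c * i) *s b \<in> f ` A" using i by (auto simp: A_def)
    moreover have "c *s e \<in> f ` A" using subspace_scale[OF D(1) eg(1)] .
    moreover have "c *s g = (c * i) *s b - c *s e" using eg(3) by (simp add: scale_right_distrib flip: scale_scale)
    ultimately have "c *s g \<in> f ` A" using subspace_diff[OF D(1)] by simp
    then have "c *s g = 0" using D(6) subspace_scale[OF D(2) eg(2)] by blast
    then have "(c * i) *s b = (c * (c * h a)) *s b"
      using eg(3) a(2) by (simp add: f_def scale_right_distrib flip: scale_scale)
    then have "c * i - c * (c * h a) = 0" by (intro b0) (simp add: scale_left_diff_distrib)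
    then have "i = c * h a" using c(1) by simp
    then show ?thesis using a(1) AS by blast
  qed
  moreover have "h ` S \<noteq> {0}" using h(3) xy(1) by blast
  ultimately show False using ideal_not_divisible[OF _ hS0] c(2) by blast
qed

theorem C4_iff:
  assumes "subspace S" "\<not> is_field TYPE('d)"
  shows "C4 scale S \<longleftrightarrow> rank_le_1 scale S \<and> homogeneous_components scale S"
  using assms C4_if_homogeneous_components homogeneous_components_if_C4 rank_le_1_if_C4 by blast

end

section \<open>Rank\<close>

text \<open>A basis of K \<otimes> M with cleared denominators: the factor \<open>d\<close> in the
  spanning condition stands for the denominator.\<close>

definition rank_family :: "('d::idom \<Rightarrow> 'm::ab_group_add \<Rightarrow> 'm) \<Rightarrow> nat \<Rightarrow> (nat \<Rightarrow> 'm) \<Rightarrow> bool"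
  where "rank_family s n t \<longleftrightarrow>
    (\<forall>c. (\<Sum>i<n. s (c i) (t i)) = 0 \<longrightarrow> (\<forall>i<n. c i = 0)) \<and>
    (\<forall>x. \<exists>d c. d \<noteq> 0 \<and> s d x = (\<Sum>i<n. s (c i) (t i)))"

lemma rank_family_independent:
  assumes "rank_family s n t" "(\<Sum>i<n. s (c i) (t i)) = 0" "i < n" shows "c i = 0"
  using assms unfolding rank_family_def by (elim conjE allE[of _ c]) auto

text \<open>Gaussian elimination without division: equation n with pivot c k n removes the unknown
  at k, and c' holds the cross-multiplied remaining coefficients.\<close>

lemma homogeneous_system_nontrivial:
  fixes c :: "'j \<Rightarrow> nat \<Rightarrow> 'd::idom"
  shows "finite J \<Longrightarrow> n < card J \<Longrightarrow> \<exists>a. (\<exists>j\<in>J. a j \<noteq> 0) \<and> (\<forall>i<n. (\<Sum>j\<in>J. a j * c j i) = 0)"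
proof (induction n arbitrary: J c)
  case 0
  then obtain j where "j \<in> J" by (metis card.empty ex_in_conv less_irrefl)
  then show ?case by (intro exI[of _ "\<lambda>_. 1"]) auto
next
  case (Suc n)
  show ?case
  proof (cases "\<forall>j\<in>J. c j n = 0")
    case True
    obtain a where a: "\<exists>j\<in>J. a j \<noteq> 0" "\<forall>i<n. (\<Sum>j\<in>J. a j * c j i) = 0"
      using Suc.IH[of J c] Suc.prems by auto
    have "(\<Sum>j\<in>J. a j * c j i) = 0" if "i < Suc n" for i
      using a(2) True that by (cases "i = n") auto
    then show ?thesis using a(1) by blast
  next
    case False
    then obtain k where k: "k \<in> J" "c k n \<noteq> 0" by blast
    define J' where "J' = J - {k}"
    have J': "finite J'" "n < card J'" "k \<notin> J'" "J = insert k J'"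
      using Suc.prems k(1) by (auto simp: J'_def card_Diff_singleton)
    define c' where "c' j i = c k n * c j i - c j n * c k i" for j i
    obtain a where a: "\<exists>j\<in>J'. a j \<noteq> 0" "\<forall>i<n. (\<Sum>j\<in>J'. a j * c' j i) = 0"
      using Suc.IH[OF J'(1,2), of c'] by blast
    \<comment> \<open>Back substitution scaled by the pivot: the value at k solves equation
      n.\<close>
    define b where "b j = (if j = k then - (\<Sum>j\<in>J'. a j * c j n) else a j * c k n)" for j
    have "(\<Sum>j\<in>J. b j * c j i) = (\<Sum>j\<in>J'. a j * c' j i)" for i
    proof -
      have "(\<Sum>j\<in>J'. b j * c j i) = (\<Sum>j\<in>J'. a j * c k n * c j i)"
        using J'(3) by (intro sum.cong) (auto simp: b_def)
      then have "(\<Sum>j\<in>J. b j * c j i) = - (\<Sum>j\<in>J'. a j * c j n) * c k i + (\<Sum>j\<in>J'. a j * c k n * c j i)"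
        using J' by (simp add: b_def)
      also have "\<dots> = (\<Sum>j\<in>J'. a j * c' j i)"
        by (simp add: c'_def sum_distrib_right sum_distrib_left sum_negf algebra_simps sum_subtractf)
      finally show ?thesis .
    qed
    moreover have "(\<Sum>j\<in>J'. a j * c' j n) = 0" by (simp add: c'_def mult.commute)
    ultimately have "\<forall>i<Suc n. (\<Sum>j\<in>J. b j * c j i) = 0" using a(2) by (auto simp: less_Suc_eq)
    moreover have "\<exists>j\<in>J. b j \<noteq> 0" using a(1) k(2) J'(3,4) by (auto simp: b_def)
    ultimately show ?thesis by blast
  qed
qed

text \<open>Expressing the second family through the first gives, if m > n, a linear system with
  more unknowns than equations; the nonzero denominators d j keep the resulting relation
  nontrivial.\<close>

lemma rank_family_le:
  fixes s :: "'d::idom \<Rightarrow> 'm::ab_group_add \<Rightarrow> 'm"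
  assumes "module s" "rank_family s n t" "rank_family s m t'"
  shows "m \<le> n"
proof (rule ccontr)
  interpret module s by fact
  assume "\<not> m \<le> n"
  have "\<forall>j. \<exists>d c. d \<noteq> 0 \<and> s d (t' j) = (\<Sum>i<n. s (c i) (t i))"
    using assms(2) by (simp add: rank_family_def)
  then obtain d c where dc: "\<And>j. d j \<noteq> 0" "\<And>j. s (d j) (t' j) = (\<Sum>i<n. s (c j i) (t i))" by metis
  obtain a where a: "\<exists>j\<in>{..<m}. a j \<noteq> 0" "\<forall>i<n. (\<Sum>j<m. a j * c j i) = 0"
    using homogeneous_system_nontrivial[of "{..<m}" n c] \<open>\<not> m \<le> n\<close> by auto
  have "(\<Sum>j<m. s (a j * d j) (t' j)) = (\<Sum>j<m. s (a j) (\<Sum>i<n. s (c j i) (t i)))"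
    by (simp flip: dc(2))
  also have "\<dots> = (\<Sum>i<n. s (\<Sum>j<m. a j * c j i) (t i))"
    by (simp add: scale_sum_right scale_sum_left) (rule sum.swap)
  also have "\<dots> = 0" using a(2) by simp
  finally have "(\<Sum>j<m. s (a j * d j) (t' j)) = 0" .
  from rank_family_independent[OF assms(3) this] show False using a(1) dc(1) by auto
qed

text \<open>A generator joins the family exactly if no nonzero multiple of it lies in the span of
  the family so far.\<close>

lemma ex_rank_family:
  fixes s :: "'d::idom \<Rightarrow> 'm::ab_group_add \<Rightarrow> 'm"
  assumes "module s" "finitely_generated s"
  obtains n t where "rank_family s n t"
proof -
  interpret module s by fact
  obtain B where B: "finite B" "span B = UNIV" using assms(2) by (auto simp: finitely_generated_def)
  have "\<exists>(n :: nat) t. (\<forall>c. (\<Sum>i<n. s (c i) (t i)) = 0 \<longrightarrow> (\<forall>i<n. c i = 0)) \<and>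
      (\<forall>x\<in>B. \<exists>d c. d \<noteq> 0 \<and> s d x = (\<Sum>i<n. s (c i) (t i)))"
    using B(1)
  proof induction
    case empty show ?case by (rule exI[of _ "0 :: nat"]) simp
  next
    case (insert b B)
    then obtain n :: nat and t where t: "\<And>c. (\<Sum>i<n. s (c i) (t i)) = 0 \<Longrightarrow> \<forall>i<n. c i = 0"
      "\<And>x. x \<in> B \<Longrightarrow> \<exists>d c. d \<noteq> 0 \<and> s d x = (\<Sum>i<n. s (c i) (t i))" by blast
    show ?case
    proof (cases "\<exists>d c. d \<noteq> 0 \<and> s d b = (\<Sum>i<n. s (c i) (t i))")
      case True then show ?thesis using t by (intro exI[of _ n] exI[of _ t]) blast
    next
      case False
      define t' where "t' = t(n := b)"
      have sum: "(\<Sum>i<Suc n. s (c i) (t' i)) = (\<Sum>i<n. s (c i) (t i)) + s (c n) b" for c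
        by (simp add: t'_def)
      have "\<forall>i<Suc n. c i = 0" if c: "(\<Sum>i<Suc n. s (c i) (t' i)) = 0" for c
      proof -
        have "(\<Sum>i<n. s (c i) (t i)) + s (c n) b = 0" using c unfolding sum .
        then have "s (c n) b = - (\<Sum>i<n. s (c i) (t i))" by (simp add: eq_neg_iff_add_eq_0 add.commute)
        also have "\<dots> = (\<Sum>i<n. s (- c i) (t i))" by (simp add: sum_negf)
        finally have "\<exists>c'. s (c n) b = (\<Sum>i<n. s (c' i) (t i))" by (rule exI[of _ "\<lambda>i. - c i"])
        then have cn: "c n = 0" using False by blast
        then have "\<forall>i<n. c i = 0" using t(1)[of c] c unfolding sum by simp
        then show ?thesis using cn by (simp add: less_Suc_eq)
      qed
      moreover have "\<exists>d c. d \<noteq> 0 \<and> s d x = (\<Sum>i<Suc n. s (c i) (t' i))" if x: "x \<in> insert b B" for x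
      proof (cases "x = b")
        case True
        have "s 1 x = (\<Sum>i<Suc n. s ((\<lambda>i. if i = n then 1 else 0) i) (t' i))"
          unfolding sum using True by simp
        then show ?thesis
          by (intro exI[of _ 1] exI[of _ "\<lambda>i. if i = n then 1 else 0"] conjI one_neq_zero)
      next
        case False
        then obtain d c where "d \<noteq> 0" "s d x = (\<Sum>i<n. s (c i) (t i))" using t(2) x by blast
        then have "d \<noteq> 0 \<and> s d x = (\<Sum>i<Suc n. s ((c(n := 0)) i) (t' i))" unfolding sum by simp
        then show ?thesis by (intro exI[of _ d] exI[of _ "c(n := 0)"])
      qed
      ultimately show ?thesis by blast
    qed
  qed
  then obtain n :: nat and t where t: "\<And>c. (\<Sum>i<n. s (c i) (t i)) = 0 \<Longrightarrow> \<forall>i<n. c i = 0"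
    "\<And>x. x \<in> B \<Longrightarrow> \<exists>d c. d \<noteq> 0 \<and> s d x = (\<Sum>i<n. s (c i) (t i))" by blast
  have "\<exists>d c. d \<noteq> 0 \<and> s d x = (\<Sum>i<n. s (c i) (t i))" if "x \<in> span B" for x
    using that
  proof (induction x rule: span_induct_alt)
    case base
    show ?case by (intro exI[of _ 1] exI[of _ "\<lambda>_. 0"]) simp
  next
    case (step r x y)
    obtain d c where d: "d \<noteq> 0" "s d x = (\<Sum>i<n. s (c i) (t i))" using t(2) step(1) by blast
    obtain e c' where e: "e \<noteq> 0" "s e y = (\<Sum>i<n. s (c' i) (t i))" using step(2) by blast
    have "s (d * e) (s r x + y) = s (e * r) (s d x) + s d (s e y)"
      by (simp add: scale_right_distrib mult_ac)
    also have "\<dots> = (\<Sum>i<n. s (e * r * c i + d * c' i) (t i))"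
      unfolding d(2) e(2) by (simp add: scale_sum_right scale_left_distrib sum.distrib)
    finally have "s (d * e) (s r x + y) = (\<Sum>i<n. s (e * r * c i + d * c' i) (t i))" .
    moreover have "d * e \<noteq> 0" using d(1) e(1) by simp
    ultimately show ?case by (intro exI[of _ "d * e"] exI[of _ "\<lambda>i. e * r * c i + d * c' i"] conjI)
  qed
  then have spans: "\<exists>d c. d \<noteq> 0 \<and> s d x = (\<Sum>i<n. s (c i) (t i))" for x using B(2) by blast
  have "rank_family s n t"
    unfolding rank_family_def by (intro conjI; intro allI; (rule impI, erule t(1) | rule spans))
  then show thesis by (rule that)
qed

section \<open>The tensor product with the fraction field\<close>

lemma module_frag_cmul: "module (frag_cmul :: int \<Rightarrow> ('a \<Rightarrow>\<^sub>0 int) \<Rightarrow> _)"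
  by unfold_locales (simp_all add: frag_cmul_distrib frag_cmul_distrib2)

lemma ex_denominator:
  obtains d n where "d \<noteq> 0" "to_fract d * a = to_fract (n :: 'd::idom)"
proof (cases a)
  case (Fract n d)
  have "to_fract d * a = to_fract n"
    unfolding Fract(1) Fract_conv_to_fract using Fract(2) by simp
  then show thesis using that Fract(2) by blast
qed

lemma ex_common_denominator:
  fixes a :: "nat \<Rightarrow> 'd::idom fract"
  obtains d f where "d \<noteq> 0" "\<And>i. i < n \<Longrightarrow> to_fract d * a i = to_fract (f i)"
proof -
  have "\<exists>d. d \<noteq> 0 \<and> (\<forall>i<n. \<exists>m. to_fract d * a i = to_fract m)"
  proof (induction n)
    case 0 show ?case using one_neq_zero by blast
  next
    case (Suc n)
    then obtain d where d: "d \<noteq> 0" "\<forall>i<n. \<exists>m. to_fract d * a i = to_fract m" by blast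
    obtain e m where e: "e \<noteq> 0" "to_fract e * a n = to_fract m" by (rule ex_denominator)
    have "\<exists>m. to_fract (d * e) * a i = to_fract m" if i: "i < Suc n" for i
    proof (cases "i = n")
      case True
      have "to_fract (d * e) * a n = to_fract (d * m)" using e(2) by (simp add: mult.assoc)
      then show ?thesis using True by blast
    next
      case False
      then obtain m where "to_fract d * a i = to_fract m" using d(2) i by (auto simp: less_Suc_eq)
      then have "to_fract (d * e) * a i = to_fract (e * m)" by (simp add: mult_ac)
      then show ?thesis by blast
    qed
    moreover have "d * e \<noteq> 0" using d(1) e(1) by simp
    ultimately show ?case by blast
  qed
  then obtain d where d: "d \<noteq> 0" "\<forall>i<n. \<exists>m. to_fract d * a i = to_fract m" by blast
  then obtain f where "\<And>i. i < n \<Longrightarrow> to_fract d * a i = to_fract (f i)" by metis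
  then show thesis using that d(1) by blast
qed

locale tensor = module scale
  for scale :: "'d::idom \<Rightarrow> 'm::ab_group_add \<Rightarrow> 'm" (infixr \<open>*s\<close> 75)
begin

interpretation Z: module "frag_cmul :: int \<Rightarrow> (('d fract \<times> 'm) \<Rightarrow>\<^sub>0 int) \<Rightarrow> _"
  by (rule module_frag_cmul)

text \<open>Equality in K \<otimes> M on representatives, so that calculations run on formal sums
  instead of classes.\<close>

definition eqv :: "(('d fract \<times> 'm) \<Rightarrow>\<^sub>0 int) \<Rightarrow> (('d fract \<times> 'm) \<Rightarrow>\<^sub>0 int) \<Rightarrow> bool" (infix \<open>\<approx>\<close> 50)
  where "a \<approx> b \<longleftrightarrow> a - b \<in> tensor_relations scale"

lemma subspace_relations: "Z.subspace (tensor_relations scale)"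
  by (simp add: tensor_relations_def)

lemma eqv_refl [simp]: "a \<approx> a"
  using Z.subspace_0[OF subspace_relations] by (simp add: eqv_def)

lemma eqv_sym: "a \<approx> b \<Longrightarrow> b \<approx> a"
  using Z.subspace_neg[OF subspace_relations, of "a - b"] by (simp add: eqv_def del: minus_frag_cmul)

lemma eqv_trans [trans]: "a \<approx> b \<Longrightarrow> b \<approx> c \<Longrightarrow> a \<approx> c"
  using Z.subspace_add[OF subspace_relations, of "a - b" "b - c"] by (simp add: eqv_def)

lemma eqv_add: "a \<approx> b \<Longrightarrow> c \<approx> d \<Longrightarrow> a + c \<approx> b + d"
  using Z.subspace_add[OF subspace_relations, of "a - b" "c - d"] by (simp add: eqv_def algebra_simps)

lemma eqv_diff: "a \<approx> b \<Longrightarrow> c \<approx> d \<Longrightarrow> a - c \<approx> b - d"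
  using Z.subspace_diff[OF subspace_relations, of "a - b" "c - d"] by (simp add: eqv_def algebra_simps)

lemma eqv_sum: "(\<And>i. i \<in> A \<Longrightarrow> f i \<approx> g i) \<Longrightarrow> sum f A \<approx> sum g A"
  by (induction A rule: infinite_finite_induct) (auto intro: eqv_add)

lemma tensor_class_eq: "tensor_class scale a = tensor_class scale b \<longleftrightarrow> a \<approx> b"
proof
  assume "tensor_class scale a = tensor_class scale b"
  moreover have "a \<in> tensor_class scale a"
    using Z.subspace_0[OF subspace_relations] by (force simp: tensor_class_def elt_set_plus_def)
  ultimately show "a \<approx> b" by (auto simp: tensor_class_def elt_set_plus_def eqv_def)
next
  have "tensor_class scale a \<subseteq> tensor_class scale b" if "a \<approx> b" for a b
  proof
    fix x assume "x \<in> tensor_class scale a"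
    then obtain r where r: "r \<in> tensor_relations scale" "x = a + r"
      by (auto simp: tensor_class_def elt_set_plus_def)
    have "x = b + ((a - b) + r)" using r(2) by simp
    moreover have "(a - b) + r \<in> tensor_relations scale"
      using Z.subspace_add[OF subspace_relations] that r(1) by (simp add: eqv_def)
    ultimately show "x \<in> tensor_class scale b" unfolding tensor_class_def elt_set_plus_def by blast
  qed
  then show "a \<approx> b \<Longrightarrow> tensor_class scale a = tensor_class scale b" using eqv_sym by blast
qed

abbreviation pure :: "'d fract \<Rightarrow> 'm \<Rightarrow> ('d fract \<times> 'm) \<Rightarrow>\<^sub>0 int" where "pure a x \<equiv> frag_of (a, x)"

lemma relation1: "frag_of (a + b, x) - frag_of (a, x) - frag_of (b, x) \<in> tensor_relations scale"
  and relation2: "frag_of (a, x + y) - frag_of (a, x) - frag_of (a, y) \<in> tensor_relations scale"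
  and relation3: "frag_of (to_fract r * a, x) - frag_of (a, r *s x) \<in> tensor_relations scale"
  unfolding tensor_relations_def by (rule Z.span_base, blast)+

lemma pure_add_left: "pure (a + b) x \<approx> pure a x + pure b x"
  using relation1[of a b x] by (simp add: eqv_def diff_diff_eq)

lemma pure_add_right: "pure a (x + y) \<approx> pure a x + pure a y"
  using relation2[of a x y] by (simp add: eqv_def diff_diff_eq)

lemma pure_scale: "pure (to_fract r * a) x \<approx> pure a (r *s x)"
  using relation3[of r a x] by (simp add: eqv_def)

lemma pure_scale1: "pure (to_fract r) x \<approx> pure 1 (r *s x)"
  using pure_scale[of r 1 x] by simp

lemma pure_zero_right: "pure a 0 \<approx> 0"
  using eqv_sym[OF pure_add_right[of a 0 0]] by (simp add: eqv_def)

lemma pure_zero_left: "pure 0 x \<approx> 0"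
  using eqv_sym[OF pure_add_left[of 0 0 x]] by (simp add: eqv_def)

lemma pure_diff_right: "pure a (x - y) \<approx> pure a x - pure a y"
  using eqv_diff[OF eqv_sym[OF pure_add_right[of a "x - y" y]] eqv_refl[of "pure a y"]] eqv_sym by simp

lemma pure_sum_right: "pure a (sum f A) \<approx> (\<Sum>i\<in>A. pure a (f i))"
proof (induction A rule: infinite_finite_induct)
  case (insert x F)
  then show ?case using eqv_trans[OF pure_add_right eqv_add[OF eqv_refl]] by simp
qed (simp_all add: pure_zero_right)

lemma tensor_scale_pure [simp]: "tensor_scale k (pure a x) = pure (k * a) x"
  by (simp add: tensor_scale_def)

lemma tensor_scale_0 [simp]: "tensor_scale k 0 = 0"
  and tensor_scale_diff: "tensor_scale k (a - b) = tensor_scale k a - tensor_scale k b"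
  and tensor_scale_add: "tensor_scale k (a + b) = tensor_scale k a + tensor_scale k b"
  and tensor_scale_cmul: "tensor_scale k (frag_cmul z a) = frag_cmul z (tensor_scale k a)"
  for a b :: "('d fract \<times> 'm) \<Rightarrow>\<^sub>0 int"
  by (simp_all add: tensor_scale_def frag_extend_diff frag_extend_add frag_extend_cmul)

lemma tensor_scale_sum: "tensor_scale k (sum f A) = (\<Sum>i\<in>A. tensor_scale k (f i :: ('d fract \<times> 'm) \<Rightarrow>\<^sub>0 int))"
  by (induction A rule: infinite_finite_induct) (simp_all add: tensor_scale_add)

lemma tensor_scale_tensor_scale: "tensor_scale k (tensor_scale l a) = tensor_scale (k * l) (a :: ('d fract \<times> 'm) \<Rightarrow>\<^sub>0 int)"
proof (induction a rule: frag_induction[OF subset_UNIV])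
  case (2 x) then show ?case by (cases x) (simp add: mult.assoc)
qed (simp_all add: tensor_scale_diff)

lemma tensor_scale_1: "tensor_scale 1 a = (a :: ('d fract \<times> 'm) \<Rightarrow>\<^sub>0 int)"
proof (induction a rule: frag_induction[OF subset_UNIV])
  case (2 x) then show ?case by (cases x) simp
qed (simp_all add: tensor_scale_diff)

lemma tensor_scale_zero_left: "tensor_scale 0 a \<approx> 0"
proof (induction a rule: frag_induction[OF subset_UNIV])
  case (2 x) then show ?case by (cases x) (simp add: pure_zero_left)
next
  case (3 a b) then show ?case using eqv_diff[OF 3] by (simp add: tensor_scale_diff)
qed simp

lemma tensor_scale_relations: "a \<in> tensor_relations scale \<Longrightarrow> tensor_scale k a \<in> tensor_relations scale"
  unfolding tensor_relations_def[of scale]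
proof (induction a rule: Z.span_induct_alt)
  case (step c x y)
  have "tensor_scale k x \<in> tensor_relations scale"
    using step(1) relation1[of "k * _" "k * _"] relation2[of "k * _"] relation3[of _ "k * _"]
    by (auto simp: tensor_scale_diff distrib_left mult.left_commute[of k])
  then show ?case
    using step(2) unfolding tensor_relations_def[symmetric]
    by (simp add: tensor_scale_add tensor_scale_cmul Z.subspace_add[OF subspace_relations] Z.subspace_scale[OF subspace_relations])
qed (simp add: Z.span_zero)

lemma tensor_scale_eqv: "a \<approx> b \<Longrightarrow> tensor_scale k a \<approx> tensor_scale k b"
  using tensor_scale_relations[of "a - b" k] by (simp add: eqv_def tensor_scale_diff)

text \<open>Clearing the denominators of the finitely many pure tensors in \<open>a\<close> moves
  all coefficients into the module argument.\<close>

lemma ex_pure_multiple: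
  obtains d x where "d \<noteq> 0" "tensor_scale (to_fract d) a \<approx> pure 1 x"
proof -
  have "\<exists>d x. d \<noteq> 0 \<and> tensor_scale (to_fract d) a \<approx> pure 1 x"
  proof (induction a rule: frag_induction[OF subset_UNIV])
    case 1
    have "tensor_scale (to_fract 1) 0 \<approx> pure 1 0" using eqv_sym[OF pure_zero_right] by simp
    then show ?case using one_neq_zero by blast
  next
    case (2 y)
    obtain a x where y: "y = (a, x)" by fastforce
    obtain d n where d: "d \<noteq> 0" "to_fract d * a = to_fract n" by (rule ex_denominator)
    then have "tensor_scale (to_fract d) (frag_of y) \<approx> pure 1 (n *s x)"
      using pure_scale1[of n x] by (simp add: y)
    then show ?case using d(1) by blast
  next
    case (3 a b)
    then obtain d x e y where d: "d \<noteq> 0" "tensor_scale (to_fract d) a \<approx> pure 1 x"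
      and e: "e \<noteq> 0" "tensor_scale (to_fract e) b \<approx> pure 1 y" by blast
    have "tensor_scale (to_fract (d * e)) (a - b) =
        tensor_scale (to_fract e) (tensor_scale (to_fract d) a) - tensor_scale (to_fract d) (tensor_scale (to_fract e) b)"
      by (simp add: tensor_scale_diff tensor_scale_tensor_scale mult.commute)
    also have "\<dots> \<approx> pure (to_fract e) x - pure (to_fract d) y"
      using eqv_diff[OF tensor_scale_eqv[OF d(2), of "to_fract e"] tensor_scale_eqv[OF e(2), of "to_fract d"]] by simp
    also have "\<dots> \<approx> pure 1 (e *s x) - pure 1 (d *s y)" by (intro eqv_diff pure_scale1)
    also have "\<dots> \<approx> pure 1 (e *s x - d *s y)" by (intro eqv_sym[OF pure_diff_right])
    finally show ?case using d(1) e(1) by (intro exI[of _ "d * e"]) auto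
  qed
  then show thesis using that by blast
qed

text \<open>The numerator of \<open>a\<close> over the denominator \<open>e\<close>; the description
  is meaningful only if e a lies in D.\<close>

definition numer :: "'d \<Rightarrow> 'd fract \<Rightarrow> 'd" where "numer e a = (THE n. to_fract n = to_fract e * a)"

lemma numer_eq: "to_fract e * a = to_fract n \<Longrightarrow> numer e a = n"
  unfolding numer_def by (rule the_equality) auto

text \<open>The formal counterpart of sending a \<otimes> x to (e a) x. It respects a relation only
  if e clears the denominators occurring there.\<close>

definition eval_at :: "'d \<Rightarrow> (('d fract \<times> 'm) \<Rightarrow>\<^sub>0 int) \<Rightarrow> 'm"
  where "eval_at e q = (\<Sum>k\<in>Poly_Mapping.keys q. (of_int (Poly_Mapping.lookup q k) * numer e (fst k)) *s snd k)"

lemma eval_at_superset: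
  assumes "finite K" "Poly_Mapping.keys q \<subseteq> K"
  shows "eval_at e q = (\<Sum>k\<in>K. (of_int (Poly_Mapping.lookup q k) * numer e (fst k)) *s snd k)"
  unfolding eval_at_def using assms
  by (intro sum.mono_neutral_left) (auto simp: in_keys_iff)

lemma eval_at_add: "eval_at e (a + b) = eval_at e a + eval_at e b"
proof -
  let ?K = "Poly_Mapping.keys a \<union> Poly_Mapping.keys b"
  have "finite ?K" "Poly_Mapping.keys (a + b) \<subseteq> ?K" by (simp_all add: Poly_Mapping.keys_add)
  then show ?thesis
    by (simp add: eval_at_superset[of ?K] lookup_add distrib_right scale_left_distrib sum.distrib)
qed

lemma eval_at_cmul: "eval_at e (frag_cmul c a) = of_int c *s eval_at e a"
proof -
  have "Poly_Mapping.keys (frag_cmul c a) \<subseteq> Poly_Mapping.keys a" by (rule keys_cmul)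
  then show ?thesis
    by (simp add: eval_at_superset[of "Poly_Mapping.keys a"] scale_sum_right mult.assoc)
qed

lemma eval_at_diff: "eval_at e (a - b) = eval_at e a - eval_at e b"
  using eval_at_add[of e a "frag_cmul (-1) b"] eval_at_cmul[of e "-1" b] by simp

lemma eval_at_pure: "eval_at e (pure a x) = numer e a *s x"
  by (simp add: eval_at_def)

text \<open>The kernel of \<open>x \<mapsto> 1 \<otimes> x\<close>: relations evaluate to zero after multiplication by a common denominator.\<close>

lemma torsion_if_pure_relation:
  assumes "pure 1 x \<in> tensor_relations scale"
  obtains d where "d \<noteq> 0" "d *s x = 0"
proof -
  \<comment> \<open>The claim covers all nonzero multiples of d because relations with different
    denominators must be evaluated at one common multiple.\<close>
  have "\<exists>d. d \<noteq> 0 \<and> (\<forall>e. e \<noteq> 0 \<and> d dvd e \<longrightarrow> eval_at e q = 0)" if "q \<in> tensor_relations scale" for q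
    using that unfolding tensor_relations_def
  proof (induction q rule: Z.span_induct_alt)
    case base show ?case by (intro exI[of _ 1]) (simp add: eval_at_def)
  next
    case (step c q r)
    obtain d where d: "d \<noteq> 0" "\<And>e. e \<noteq> 0 \<Longrightarrow> d dvd e \<Longrightarrow> eval_at e r = 0" using step(2) by blast
    have num: "numer (d' * f) a = f * n" if "to_fract d' * a = to_fract n" for d' f a n
      using that by (intro numer_eq) (simp add: mult_ac)
    have "\<exists>d. d \<noteq> 0 \<and> (\<forall>e. e \<noteq> 0 \<and> d dvd e \<longrightarrow> eval_at e q = 0)"
      using step(1)
    proof (elim UnE CollectE exE conjE)
      fix a b x assume q: "q = frag_of (a + b, x) - frag_of (a, x) - frag_of (b, x)"
      obtain d1 n1 where 1: "d1 \<noteq> 0" "to_fract d1 * a = to_fract n1" by (rule ex_denominator)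
      obtain d2 n2 where 2: "d2 \<noteq> 0" "to_fract d2 * b = to_fract n2" by (rule ex_denominator)
      have a: "to_fract (d1 * d2) * a = to_fract (d2 * n1)" using 1 by (simp add: mult_ac)
      have b: "to_fract (d1 * d2) * b = to_fract (d1 * n2)" using 2 by (simp add: mult_ac)
      have ab: "to_fract (d1 * d2) * (a + b) = to_fract (d2 * n1 + d1 * n2)"
        unfolding distrib_left a b by simp
      have "eval_at e q = 0" if "d1 * d2 dvd e" for e
      proof -
        obtain k where e: "e = d1 * d2 * k" using \<open>d1 * d2 dvd e\<close> by (rule dvdE)
        have "eval_at e q = numer e (a + b) *s x - numer e a *s x - numer e b *s x"
          unfolding q by (simp only: eval_at_diff eval_at_pure)
        also have "\<dots> = (k * (d2 * n1 + d1 * n2)) *s x - (k * (d2 * n1)) *s x - (k * (d1 * n2)) *s x"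
          unfolding e by (simp only: num[OF a] num[OF b] num[OF ab])
        finally show ?thesis by (simp add: algebra_simps)
      qed
      then show ?thesis using 1(1) 2(1) by (intro exI[of _ "d1 * d2"]) auto
    next
      fix a x y assume q: "q = frag_of (a, x + y) - frag_of (a, x) - frag_of (a, y)"
      show ?thesis by (intro exI[of _ 1]) (auto simp: q eval_at_diff eval_at_pure scale_right_distrib)
    next
      fix r a x assume q: "q = frag_of (to_fract r * a, x) - frag_of (a, r *s x)"
      obtain d n where d: "d \<noteq> 0" "to_fract d * a = to_fract n" by (rule ex_denominator)
      have ra: "to_fract d * (to_fract r * a) = to_fract (r * n)" using d(2) by (simp add: mult.left_commute)
      have "eval_at e q = 0" if "d dvd e" for e
      proof -
        obtain k where e: "e = d * k" using \<open>d dvd e\<close> by (rule dvdE)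
        have "eval_at e q = numer e (to_fract r * a) *s x - numer e a *s r *s x"
          unfolding q by (simp only: eval_at_diff eval_at_pure)
        also have "\<dots> = (k * (r * n)) *s x - (k * n) *s r *s x"
          unfolding e by (simp only: num[OF d(2)] num[OF ra])
        finally show ?thesis by (simp add: mult_ac)
      qed
      then show ?thesis using d(1) by blast
    qed
    then obtain d' where d': "d' \<noteq> 0" "\<And>e. e \<noteq> 0 \<Longrightarrow> d' dvd e \<Longrightarrow> eval_at e q = 0" by blast
    have "eval_at e (frag_cmul c q + r) = 0" if "e \<noteq> 0" "d * d' dvd e" for e
      using d(2)[of e] d'(2)[of e] that by (auto simp: eval_at_add eval_at_cmul dest: dvd_mult_left dvd_mult_right)
    then show ?case using d(1) d'(1) by (intro exI[of _ "d * d'"]) auto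
  qed
  from this[OF assms] obtain d where d: "d \<noteq> 0" "eval_at d (pure 1 x) = 0" by auto
  moreover have "numer d 1 = d" by (rule numer_eq) simp
  ultimately show thesis using that[of d] by (simp add: eval_at_pure)
qed

text \<open>After clearing denominators a relation between the pure tensors says 1 \<otimes> x = 0
  with x in the span of the family, so x is torsion and independence makes the relation trivial. For
  generation, a multiple of any tensor is some 1 \<otimes> x, and a multiple of x lies in the
  span.\<close>

lemma tensor_basis_if_rank_family:
  assumes "rank_family scale n t"
  shows "tensor_basis scale n (\<lambda>i. pure 1 (t i))"
  unfolding tensor_basis_def
proof (rule bij_betwI')
  fix c c' :: "nat \<Rightarrow> 'd fract"
  assume cc': "c \<in> {..<n} \<rightarrow>\<^sub>E UNIV" "c' \<in> {..<n} \<rightarrow>\<^sub>E UNIV"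
  show "tensor_class scale (\<Sum>i<n. tensor_scale (c i) (pure 1 (t i))) =
      tensor_class scale (\<Sum>i<n. tensor_scale (c' i) (pure 1 (t i))) \<longleftrightarrow> c = c'"
  proof
    assume "tensor_class scale (\<Sum>i<n. tensor_scale (c i) (pure 1 (t i))) =
      tensor_class scale (\<Sum>i<n. tensor_scale (c' i) (pure 1 (t i)))"
    then have eq: "(\<Sum>i<n. pure (c i) (t i)) \<approx> (\<Sum>i<n. pure (c' i) (t i))" by (simp add: tensor_class_eq)
    have "(\<Sum>i<n. pure (c i) (t i)) \<approx> (\<Sum>i<n. pure (c' i) (t i) + pure (c i - c' i) (t i))"
    proof (rule eqv_sum)
      fix i
      show "pure (c i) (t i) \<approx> pure (c' i) (t i) + pure (c i - c' i) (t i)"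
        using pure_add_left[of "c' i" "c i - c' i" "t i"] by simp
    qed
    also have "\<dots> = (\<Sum>i<n. pure (c' i) (t i)) + (\<Sum>i<n. pure (c i - c' i) (t i))" by (rule sum.distrib)
    finally have "(\<Sum>i<n. pure (c' i) (t i)) + (\<Sum>i<n. pure (c i - c' i) (t i)) \<approx> (\<Sum>i<n. pure (c' i) (t i))"
      using eq eqv_trans eqv_sym by blast
    then have 0: "(\<Sum>i<n. pure (c i - c' i) (t i)) \<approx> 0" by (simp add: eqv_def)
    obtain d f where d: "d \<noteq> 0" "\<And>i. i < n \<Longrightarrow> to_fract d * (c i - c' i) = to_fract (f i)"
      using ex_common_denominator[of n "\<lambda>i. c i - c' i"] by blast
    have "pure 1 (\<Sum>i<n. f i *s t i) \<approx> (\<Sum>i<n. pure 1 (f i *s t i))" by (rule pure_sum_right)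
    also have "\<dots> \<approx> (\<Sum>i<n. pure (to_fract (f i)) (t i))"
      by (intro eqv_sum eqv_sym[OF pure_scale1])
    also have "\<dots> = tensor_scale (to_fract d) (\<Sum>i<n. pure (c i - c' i) (t i))"
      using d(2) by (simp add: tensor_scale_sum)
    also have "\<dots> \<approx> tensor_scale (to_fract d) 0" by (rule tensor_scale_eqv[OF 0])
    finally have "pure 1 (\<Sum>i<n. f i *s t i) \<in> tensor_relations scale" by (simp add: eqv_def)
    then obtain e where e: "e \<noteq> 0" "e *s (\<Sum>i<n. f i *s t i) = 0" by (rule torsion_if_pure_relation)
    then have "(\<Sum>i<n. (e * f i) *s t i) = 0" by (simp add: scale_sum_right)
    then have "\<forall>i<n. e * f i = 0" using rank_family_independent[OF assms, of "\<lambda>i. e * f i"] by blast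
    then have "c i = c' i" if "i < n" for i using d that e(1) by fastforce
    then show "c = c'" using cc' by (intro PiE_ext) auto
  qed simp
next
  fix q assume "q \<in> range (tensor_class scale)"
  then obtain a where a: "q = tensor_class scale a" by blast
  obtain d x where d: "d \<noteq> 0" "tensor_scale (to_fract d) a \<approx> pure 1 x" by (rule ex_pure_multiple)
  obtain e c where e: "e \<noteq> 0" "e *s x = (\<Sum>i<n. c i *s t i)" using assms unfolding rank_family_def by blast
  have "tensor_scale (to_fract (d * e)) a = tensor_scale (to_fract e) (tensor_scale (to_fract d) a)"
    by (simp add: tensor_scale_tensor_scale mult.commute)
  also have "\<dots> \<approx> pure (to_fract e) x" using tensor_scale_eqv[OF d(2), of "to_fract e"] by simp
  also have "\<dots> \<approx> pure 1 (\<Sum>i<n. c i *s t i)" using pure_scale1[of e x] e(2) by simp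
  also have "\<dots> \<approx> (\<Sum>i<n. pure 1 (c i *s t i))" by (rule pure_sum_right)
  also have "\<dots> \<approx> (\<Sum>i<n. pure (to_fract (c i)) (t i))" by (intro eqv_sum eqv_sym[OF pure_scale1])
  finally have *: "tensor_scale (to_fract (d * e)) a \<approx> (\<Sum>i<n. pure (to_fract (c i)) (t i))" .
  let ?k = "inverse (to_fract (d * e))"
  define b where "b = restrict (\<lambda>i. ?k * to_fract (c i)) {..<n}"
  have "a = tensor_scale ?k (tensor_scale (to_fract (d * e)) a)"
    using d(1) e(1) by (simp add: tensor_scale_tensor_scale tensor_scale_1 del: to_fract_mult)
  also have "\<dots> \<approx> tensor_scale ?k (\<Sum>i<n. pure (to_fract (c i)) (t i))" by (rule tensor_scale_eqv[OF *])
  also have "\<dots> = (\<Sum>i<n. tensor_scale (b i) (pure 1 (t i)))" by (simp add: tensor_scale_sum b_def)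
  finally have "q = tensor_class scale (\<Sum>i<n. tensor_scale (b i) (pure 1 (t i)))"
    using a tensor_class_eq by blast
  moreover have "b \<in> {..<n} \<rightarrow>\<^sub>E UNIV" by (simp add: b_def)
  ultimately show "\<exists>b\<in>{..<n} \<rightarrow>\<^sub>E UNIV. q = tensor_class scale (\<Sum>i<n. tensor_scale (b i) (pure 1 (t i)))" by blast
qed blast

text \<open>\<open>module_rank\<close> is a definite description, so all bases must have the same
  size. Clearing denominators turns an arbitrary basis into a rank family of the same size, where
  \<open>rank_family_le\<close> applies.\<close>

lemma ex_rank_family_if_tensor_basis:
  assumes t: "tensor_basis scale n t"
  shows "\<exists>x. rank_family scale n x"
proof -
  have "\<forall>i. \<exists>d x. d \<noteq> 0 \<and> tensor_scale (to_fract d) (t i) \<approx> pure 1 x" using ex_pure_multiple by metis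
  then obtain d x where d: "\<And>i. d i \<noteq> 0" "\<And>i. tensor_scale (to_fract (d i)) (t i) \<approx> pure 1 (x i)" by metis
  have sum: "pure 1 (\<Sum>i<n. c i *s x i) \<approx> (\<Sum>i<n. tensor_scale (to_fract (c i * d i)) (t i))" for c
  proof -
    have "pure 1 (\<Sum>i<n. c i *s x i) \<approx> (\<Sum>i<n. pure 1 (c i *s x i))" by (rule pure_sum_right)
    also have "\<dots> \<approx> (\<Sum>i<n. tensor_scale (to_fract (c i * d i)) (t i))"
    proof (rule eqv_sum)
      fix i
      have "pure 1 (c i *s x i) \<approx> tensor_scale (to_fract (c i)) (pure 1 (x i))"
        using eqv_sym[OF pure_scale1] by simp
      also have "\<dots> \<approx> tensor_scale (to_fract (c i)) (tensor_scale (to_fract (d i)) (t i))"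
        by (rule tensor_scale_eqv[OF eqv_sym[OF d(2)]])
      finally show "pure 1 (c i *s x i) \<approx> tensor_scale (to_fract (c i * d i)) (t i)"
        by (simp add: tensor_scale_tensor_scale)
    qed
    finally show ?thesis .
  qed
  have indep: "\<forall>i<n. c i = 0" if c: "(\<Sum>i<n. c i *s x i) = 0" for c
  proof -
    define b where "b = restrict (\<lambda>i. to_fract (c i * d i)) {..<n}"
    define z :: "nat \<Rightarrow> 'd fract" where "z = restrict (\<lambda>i. 0) {..<n}"
    have "(\<Sum>i<n. tensor_scale (b i) (t i)) = (\<Sum>i<n. tensor_scale (to_fract (c i * d i)) (t i))"
      by (simp add: b_def)
    also have "\<dots> \<approx> pure 1 0" using eqv_sym[OF sum[of c]] by (simp only: c)
    also have "\<dots> \<approx> (\<Sum>i<n. 0)" using pure_zero_right by simp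
    also have "\<dots> \<approx> (\<Sum>i<n. tensor_scale (z i) (t i))"
      by (rule eqv_sum, rule eqv_sym) (simp add: z_def tensor_scale_zero_left)
    finally have "tensor_class scale (\<Sum>i<n. tensor_scale (b i) (t i)) = tensor_class scale (\<Sum>i<n. tensor_scale (z i) (t i))"
      by (simp add: tensor_class_eq)
    moreover have "b \<in> {..<n} \<rightarrow>\<^sub>E UNIV" "z \<in> {..<n} \<rightarrow>\<^sub>E UNIV" by (simp_all add: b_def z_def)
    ultimately have "b = z" using t unfolding tensor_basis_def bij_betw_def by (auto dest: inj_onD)
    then have "to_fract (c i * d i) = 0" if "i < n" for i
      using that by (metis b_def z_def lessThan_iff restrict_apply')
    then show ?thesis using d(1) by simp
  qed
  have spans: "\<exists>e c. e \<noteq> 0 \<and> e *s y = (\<Sum>i<n. c i *s x i)" for y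
  proof -
    have "tensor_class scale (pure 1 y) \<in> range (tensor_class scale)" by blast
    then obtain k where "tensor_class scale (pure 1 y) = tensor_class scale (\<Sum>i<n. tensor_scale (k i) (t i))"
      using t unfolding tensor_basis_def bij_betw_def by (metis (no_types, lifting) imageE)
    then have k: "pure 1 y \<approx> (\<Sum>i<n. tensor_scale (k i) (t i))" by (simp add: tensor_class_eq)
    obtain e f where e: "e \<noteq> 0" "\<And>i. i < n \<Longrightarrow> to_fract e * (k i / to_fract (d i)) = to_fract (f i)"
      using ex_common_denominator[of n "\<lambda>i. k i / to_fract (d i)"] by blast
    have ek: "to_fract e * k i = to_fract (f i * d i)" if "i < n" for i
      using e(2)[OF that] d(1)[of i] by (simp add: field_simps)
    have "pure 1 (e *s y) \<approx> tensor_scale (to_fract e) (pure 1 y)" using eqv_sym[OF pure_scale1] by simp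
    also have "\<dots> \<approx> tensor_scale (to_fract e) (\<Sum>i<n. tensor_scale (k i) (t i))" by (rule tensor_scale_eqv[OF k])
    also have "\<dots> = (\<Sum>i<n. tensor_scale (to_fract (f i * d i)) (t i))"
      by (simp add: tensor_scale_sum tensor_scale_tensor_scale ek del: to_fract_mult)
    also have "\<dots> \<approx> pure 1 (\<Sum>i<n. f i *s x i)" by (rule eqv_sym[OF sum])
    finally have "pure 1 (e *s y) - pure 1 (\<Sum>i<n. f i *s x i) \<approx> 0" by (simp add: eqv_def)
    then have "pure 1 (e *s y - (\<Sum>i<n. f i *s x i)) \<approx> 0" by (rule eqv_trans[OF pure_diff_right])
    then obtain g where g: "g \<noteq> 0" "g *s (e *s y - (\<Sum>i<n. f i *s x i)) = 0"
      using torsion_if_pure_relation by (auto simp: eqv_def)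
    then have "(g * e) *s y = (\<Sum>i<n. (g * f i) *s x i)" by (simp add: scale_right_diff_distrib scale_sum_right)
    moreover have "g * e \<noteq> 0" using g(1) e(1) by simp
    ultimately show ?thesis by (intro exI[of _ "g * e"] exI[of _ "\<lambda>i. g * f i"] conjI)
  qed
  show ?thesis
    unfolding rank_family_def
    by (intro exI[of _ x] conjI; intro allI; (rule impI, erule indep | rule spans))
qed

lemma module_rank_eq:
  assumes "rank_family scale n t" shows "module_rank scale = n"
  unfolding module_rank_def
proof (rule the_equality)
  show "\<exists>t. tensor_basis scale n t" using tensor_basis_if_rank_family[OF assms] by blast
  fix m assume "\<exists>t. tensor_basis scale m t"
  then obtain x where "rank_family scale m x" using ex_rank_family_if_tensor_basis by blast
  then show "m = n" using rank_family_le[OF module_axioms] assms by (metis order_antisym)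
qed

lemma rank_le_1_iff:
  assumes "rank_family scale n t" shows "rank_le_1 scale UNIV \<longleftrightarrow> n \<le> 1"
proof
  assume r: "rank_le_1 scale UNIV"
  show "n \<le> 1"
  proof (rule ccontr)
    assume n: "\<not> n \<le> 1"
    obtain a b where ab: "a \<noteq> 0 \<or> b \<noteq> 0" "a *s t 0 + b *s t 1 = 0" using r unfolding rank_le_1_def by blast
    define c where "c i = (if i = 0 then a else if i = 1 then b else 0)" for i :: nat
    have "(\<Sum>i<n. c i *s t i) = (\<Sum>i\<in>{0, 1}. c i *s t i)"
      using n by (intro sum.mono_neutral_right) (auto simp: c_def)
    also have "\<dots> = 0" using ab(2) by (simp add: c_def)
    finally have "\<forall>i<n. c i = 0" using assms by (simp add: rank_family_def)
    then have "c 0 = 0" "c 1 = 0" using n by auto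
    then show False using ab(1) by (simp add: c_def)
  qed
next
  assume n: "n \<le> 1"
  show "rank_le_1 scale UNIV"
    unfolding rank_le_1_def
  proof (intro ballI)
    fix x y
    obtain d c where d: "d \<noteq> 0" "d *s x = (\<Sum>i<n. c i *s t i)" using assms unfolding rank_family_def by blast
    obtain e c' where e: "e \<noteq> 0" "e *s y = (\<Sum>i<n. c' i *s t i)" using assms unfolding rank_family_def by blast
    show "\<exists>a b. (a \<noteq> 0 \<or> b \<noteq> 0) \<and> a *s x + b *s y = 0"
    proof (cases "n = 0 \<or> c 0 = 0")
      case True
      have "d *s x + 0 *s y = 0" using True n d(2) by (cases n) auto
      then show ?thesis using d(1) by blast
    next
      case False
      then have "n = 1" using n by simp
      have "(c' 0 * d) *s x + (- (c 0 * e)) *s y = c' 0 *s d *s x - c 0 *s e *s y" by simp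
      also have "\<dots> = 0" unfolding d(2) e(2) \<open>n = 1\<close> by (simp add: mult.commute)
      finally have "(c' 0 * d) *s x + (- (c 0 * e)) *s y = 0" .
      moreover have "- (c 0 * e) \<noteq> 0" using False e(1) by simp
      ultimately show ?thesis by blast
    qed
  qed
qed

end

lemma rank_family_prod:
  fixes s1 :: "'d::idom \<Rightarrow> 'm::ab_group_add \<Rightarrow> 'm" and s2 :: "'d \<Rightarrow> 'n::ab_group_add \<Rightarrow> 'n"
  assumes "module s1" "module s2" "rank_family s1 n t" "rank_family s2 m t'"
  shows "rank_family (module_prod.scale s1 s2) (n + m) (\<lambda>i. if i < n then (t i, 0) else (0, t' (i - n)))"
    (is "rank_family ?s _ ?t")
proof -
  interpret m1: module s1 by fact
  interpret m2: module s2 by fact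
  interpret module_prod s1 s2 by unfold_locales
  have split: "(\<Sum>i<n + m. f i) = (\<Sum>i<n. f i) + (\<Sum>i<m. f (n + i))" for f :: "nat \<Rightarrow> 'm \<times> 'n"
    by (induction m) (simp_all add: add.assoc)
  have sum: "(\<Sum>i<n + m. ?s (c i) (?t i)) = (\<Sum>i<n. s1 (c i) (t i), \<Sum>i<m. s2 (c (n + i)) (t' i))" for c
  proof -
    have "(\<Sum>i<n. ?s (c i) (?t i)) = (\<Sum>i<n. (s1 (c i) (t i), 0))"
      by (intro sum.cong) (auto simp: scale_prod)
    moreover have "(\<Sum>i<m. ?s (c (n + i)) (?t (n + i))) = (\<Sum>i<m. (0, s2 (c (n + i)) (t' i)))"
      by (intro sum.cong) (auto simp: scale_prod)
    ultimately show ?thesis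
      unfolding split by (simp add: prod_eq_iff fst_sum snd_sum)
  qed
  show ?thesis
    unfolding rank_family_def
  proof (intro conjI allI impI)
    fix c i assume c: "(\<Sum>i<n + m. ?s (c i) (?t i)) = 0" and i: "i < n + m"
    have 1: "\<forall>i<n. c i = 0" using assms(3) c unfolding sum by (simp add: rank_family_def zero_prod_def)
    have "(\<Sum>i<m. s2 (c (n + i)) (t' i)) = 0" using c unfolding sum by (simp add: zero_prod_def)
    then have 2: "\<forall>i<m. c (n + i) = 0"
      using assms(4) unfolding rank_family_def by (elim conjE allE[of _ "\<lambda>i. c (n + i)"]) simp
    show "c i = 0"
    proof (cases "i < n")
      case False
      then have "i - n < m" "n + (i - n) = i" using i by auto
      then show ?thesis using 2 by metis
    qed (use 1 in blast)
  next
    fix z :: "'m \<times> 'n"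
    obtain d c where d: "d \<noteq> 0" "s1 d (fst z) = (\<Sum>i<n. s1 (c i) (t i))" using assms(3) unfolding rank_family_def by blast
    obtain e c' where e: "e \<noteq> 0" "s2 e (snd z) = (\<Sum>i<m. s2 (c' i) (t' i))" using assms(4) unfolding rank_family_def by blast
    define b where "b i = (if i < n then e * c i else d * c' (i - n))" for i
    have "s1 (d * e) (fst z) = s1 e (s1 d (fst z))" by (simp add: mult.commute)
    also have "\<dots> = (\<Sum>i<n. s1 (b i) (t i))" unfolding d(2) by (simp add: m1.scale_sum_right b_def)
    finally have 1: "s1 (d * e) (fst z) = (\<Sum>i<n. s1 (b i) (t i))" .
    have "s2 (d * e) (snd z) = s2 d (s2 e (snd z))" by simp
    also have "\<dots> = (\<Sum>i<m. s2 (b (n + i)) (t' i))" unfolding e(2) by (simp add: m2.scale_sum_right b_def)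
    finally have "?s (d * e) z = (\<Sum>i<n + m. ?s (b i) (?t i))" unfolding sum using 1 by (simp add: scale_def)
    moreover have "d * e \<noteq> 0" using d(1) e(1) by simp
    ultimately show "\<exists>d c. d \<noteq> 0 \<and> ?s d z = (\<Sum>i<n + m. ?s (c i) (?t i))" by blast
  qed
qed

lemma module_rank_add_le_1_iff:
  fixes s1 :: "'d::idom \<Rightarrow> 'm::ab_group_add \<Rightarrow> 'm" and s2 :: "'d \<Rightarrow> 'n::ab_group_add \<Rightarrow> 'n"
  assumes "module s1" "finitely_generated s1" "module s2" "finitely_generated s2"
  shows "module_rank s1 + module_rank s2 \<le> 1 \<longleftrightarrow> rank_le_1 (module_prod.scale s1 s2) UNIV"
proof -
  interpret t1: tensor s1 using assms(1) by (rule tensor.intro)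
  interpret t2: tensor s2 using assms(3) by (rule tensor.intro)
  interpret module_prod s1 s2 by unfold_locales
  interpret t: tensor scale by unfold_locales
  obtain n t where t: "rank_family s1 n t" using ex_rank_family[OF assms(1,2)] .
  obtain m t' where t': "rank_family s2 m t'" using ex_rank_family[OF assms(3,4)] .
  show ?thesis
    using t1.module_rank_eq[OF t] t2.module_rank_eq[OF t']
      t.rank_le_1_iff[OF rank_family_prod[OF assms(1,3) t t']] by simp
qed

section \<open>Homocyclic modules are homogeneous\<close>

lemma coset_eq_iff:
  assumes "ideal I" shows "a +o I = b +o I \<longleftrightarrow> a - b \<in> I"
proof
  assume "a +o I = b +o I"
  moreover have "a \<in> a +o I" using ideal_0[OF assms] by (force simp: elt_set_plus_def)
  ultimately show "a - b \<in> I" by (auto simp: elt_set_plus_def)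
next
  have "a +o I \<subseteq> b +o I" if "a - b \<in> I" for a b
  proof
    fix x assume "x \<in> a +o I"
    then obtain r where r: "r \<in> I" "x = a + r" by (auto simp: elt_set_plus_def)
    have "x = b + ((a - b) + r)" using r(2) by simp
    moreover have "(a - b) + r \<in> I" using ideal_add[OF assms that r(1)] .
    ultimately show "x \<in> b +o I" unfolding elt_set_plus_def by blast
  qed
  moreover have "b - a \<in> I" if "a - b \<in> I" using ideal_diff[OF assms ideal_0[OF assms] that] by simp
  ultimately show "a - b \<in> I \<Longrightarrow> a +o I = b +o I" by blast
qed

text \<open>Such an isomorphism is determined by the image of the coset of 1, a generator with
  annihilator I. This trades cosets for generators and annihilators.\<close>

lemma (in module) quotient_iso_iff:
  assumes I: "ideal I"
  shows "(\<exists>\<phi>. quotient_iso scale I X \<phi>) \<longleftrightarrow> (\<exists>x. X = span {x} \<and> (\<forall>d. d *s x = 0 \<longleftrightarrow> d \<in> I))"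
proof
  assume "\<exists>\<phi>. quotient_iso scale I X \<phi>"
  then obtain \<phi> where bij: "bij_betw \<phi> (range (\<lambda>a. a +o I)) X"
    and hom: "\<And>r a. \<phi> ((r * a) +o I) = r *s \<phi> (a +o I)"
    unfolding quotient_iso_def by blast
  define x where "x = \<phi> (1 +o I)"
  have \<phi>: "\<phi> (a +o I) = a *s x" for a using hom[of a 1] by (simp add: x_def)
  have "X = range (\<lambda>a. \<phi> (a +o I))" using bij by (auto simp: bij_betw_def)
  then have "X = span {x}" by (simp add: \<phi> span_singleton)
  moreover have "d *s x = 0 \<longleftrightarrow> d \<in> I" for d
  proof -
    have "d *s x = 0 \<longleftrightarrow> \<phi> (d +o I) = \<phi> (0 +o I)" by (simp only: \<phi> scale_zero_left)
    also have "\<dots> \<longleftrightarrow> d +o I = 0 +o I"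
      by (rule inj_on_eq_iff[OF bij_betw_imp_inj_on[OF bij]]) blast+
    also have "\<dots> \<longleftrightarrow> d - 0 \<in> I" by (rule coset_eq_iff[OF I])
    finally show ?thesis by (simp only: diff_zero)
  qed
  ultimately show "\<exists>x. X = span {x} \<and> (\<forall>d. d *s x = 0 \<longleftrightarrow> d \<in> I)" by blast
next
  assume "\<exists>x. X = span {x} \<and> (\<forall>d. d *s x = 0 \<longleftrightarrow> d \<in> I)"
  then obtain x where X: "X = span {x}" and ann: "\<And>d. d *s x = 0 \<longleftrightarrow> d \<in> I" by blast
  have eq: "a *s x = b *s x \<longleftrightarrow> a +o I = b +o I" for a b
    using ann[of "a - b"] by (simp add: coset_eq_iff[OF I] scale_left_diff_distrib)
  define \<phi> where "\<phi> A = (SOME a. a +o I = A) *s x" for A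
  have \<phi>: "\<phi> (a +o I) = a *s x" for a
    unfolding \<phi>_def eq by (rule someI) (rule refl)
  have "bij_betw \<phi> (range (\<lambda>a. a +o I)) X"
    unfolding bij_betw_def by (auto simp: inj_on_def \<phi> eq X span_singleton image_image)
  then have "quotient_iso scale I X \<phi>"
    unfolding quotient_iso_def by (simp add: \<phi> scale_left_distrib)
  then show "\<exists>\<phi>. quotient_iso scale I X \<phi>" by blast
qed

text \<open>Each cyclic summand is homogeneous, and by directness p x = 0 means that p kills every
  component of x; so the division by p^(l-1) can be done componentwise.\<close>

lemma (in dedekind_module_at) homogeneous_if_homocyclic:
  assumes X: "homocyclic_of_exponent scale P l X" and l: "1 \<le> l"
  shows "homogeneous scale p l X"
proof -
  obtain n :: nat and C where
    C: "\<And>i. i < n \<Longrightarrow> subspace (C i) \<and> (\<exists>\<phi>. quotient_iso scale (ideal_power P l) (C i) \<phi>)"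
    and bij: "bij_betw (\<lambda>c. \<Sum>i<n. c i) (Pi\<^sub>E {..<n} C) X"
    using X unfolding homocyclic_of_exponent_def by blast
  have hom: "homogeneous scale p l (C i)" if i: "i < n" for i
  proof -
    obtain x where x: "C i = span {x}" "\<And>d. d *s x = 0 \<longleftrightarrow> d \<in> ideal_power P l"
      using C[OF i] quotient_iso_iff[OF ideal_ideal_power] by blast
    have "x \<in> pc UNIV" using x(2) unfolding primary_component_def by blast
    moreover have "p ^ l *s x = 0" using x(2) p_power_in by blast
    moreover have "p ^ (l - 1) *s x \<noteq> 0" using x(2) p_power_notin[of "l - 1"] l by simp
    ultimately show ?thesis unfolding x(1) by (rule cyclic_homogeneous)
  qed
  show ?thesis
    unfolding homogeneous_def
  proof (intro conjI ballI impI l)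
    fix x assume "x \<in> X"
    then obtain c where c: "c \<in> Pi\<^sub>E {..<n} C" "x = (\<Sum>i<n. c i)"
      using bij unfolding bij_betw_def by blast
    have cC: "c i \<in> C i" if "i < n" for i using c(1) that by (auto simp: PiE_iff)
    show "p ^ l *s x = 0"
      unfolding c(2) scale_sum_right using hom cC by (intro sum.neutral) (auto simp: homogeneous_def)
    assume px: "p *s x = 0"
    define c' where "c' = restrict (\<lambda>i. p *s c i) {..<n}"
    define z where "z = restrict (\<lambda>_. 0 :: 'm) {..<n}"
    have "c' \<in> Pi\<^sub>E {..<n} C" "z \<in> Pi\<^sub>E {..<n} C"
      using cC C subspace_scale subspace_0 by (auto simp: c'_def z_def)
    moreover have "(\<Sum>i<n. c' i) = (\<Sum>i<n. z i)"
      using px by (simp add: c(2) c'_def z_def scale_sum_right)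
    ultimately have "c' = z" using bij unfolding bij_betw_def inj_on_def by blast
    then have pc0: "p *s c i = 0" if "i < n" for i
      using that by (metis c'_def z_def lessThan_iff restrict_apply')
    have "\<forall>i\<in>{..<n}. \<exists>y. y \<in> C i \<and> c i = p ^ (l - 1) *s y"
      using hom cC pc0 unfolding homogeneous_def by blast
    then obtain y where y: "\<And>i. i < n \<Longrightarrow> y i \<in> C i" "\<And>i. i < n \<Longrightarrow> c i = p ^ (l - 1) *s y i"
      by (metis lessThan_iff)
    have "restrict y {..<n} \<in> Pi\<^sub>E {..<n} C" using y(1) by auto
    then have "(\<Sum>i<n. restrict y {..<n} i) \<in> X" using bij unfolding bij_betw_def by blast
    moreover have "x = p ^ (l - 1) *s (\<Sum>i<n. restrict y {..<n} i)"
      unfolding c(2) scale_sum_right using y(2) by (intro sum.cong) auto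
    ultimately show "\<exists>y\<in>X. x = p ^ (l - 1) *s y" by blast
  qed
qed

text \<open>Independence asks only that the terms vanish, not the coefficients: c i is determined
  only modulo the annihilator I of x i.\<close>

definition (in module) cyclic_basis :: "'a set \<Rightarrow> nat \<Rightarrow> (nat \<Rightarrow> 'b) \<Rightarrow> 'b set \<Rightarrow> bool"
  where "cyclic_basis I n x F \<longleftrightarrow>
    (\<forall>i<n. \<forall>d. d *s x i = 0 \<longleftrightarrow> d \<in> I) \<and> F = range (\<lambda>c. \<Sum>i<n. c i *s x i) \<and>
    (\<forall>c. (\<Sum>i<n. c i *s x i) = 0 \<longrightarrow> (\<forall>i<n. c i *s x i = 0))"

lemma (in dedekind_module_at) homocyclic_if_cyclic_basis:
  assumes "cyclic_basis (ideal_power P l) n x F"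
  shows "homocyclic_of_exponent scale P l F"
proof -
  have ann: "\<And>i d. i < n \<Longrightarrow> d *s x i = 0 \<longleftrightarrow> d \<in> ideal_power P l"
    and F: "F = range (\<lambda>c. \<Sum>i<n. c i *s x i)"
    and indep: "\<And>c. (\<Sum>i<n. c i *s x i) = 0 \<Longrightarrow> \<forall>i<n. c i *s x i = 0"
    using assms unfolding cyclic_basis_def by (blast, blast, metis)
  define C where "C i = span {x i}" for i
  have "bij_betw (\<lambda>c. \<Sum>i<n. c i) (Pi\<^sub>E {..<n} C) F"
  proof (rule bij_betwI')
    fix c c' assume c: "c \<in> Pi\<^sub>E {..<n} C" "c' \<in> Pi\<^sub>E {..<n} C"
    show "(\<Sum>i<n. c i) = (\<Sum>i<n. c' i) \<longleftrightarrow> c = c'"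
    proof
      assume eq: "(\<Sum>i<n. c i) = (\<Sum>i<n. c' i)"
      have "\<forall>i\<in>{..<n}. \<exists>a. c i - c' i = a *s x i"
      proof
        fix i assume "i \<in> {..<n}"
        then have "c i - c' i \<in> C i" using c unfolding C_def by (intro span_diff) (auto simp: PiE_iff)
        then show "\<exists>a. c i - c' i = a *s x i" by (auto simp: C_def span_singleton)
      qed
      then obtain a where a: "\<And>i. i < n \<Longrightarrow> c i - c' i = a i *s x i" by (metis lessThan_iff)
      have "(\<Sum>i<n. a i *s x i) = (\<Sum>i<n. c i - c' i)" using a by simp
      also have "\<dots> = 0" using eq by (simp add: sum_subtractf)
      finally have "\<forall>i<n. a i *s x i = 0" by (rule indep)
      then have "c i = c' i" if "i < n" for i using a[OF that] that by simp
      then show "c = c'" using c by (intro PiE_ext) auto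
    qed simp
  next
    fix c assume "c \<in> Pi\<^sub>E {..<n} C"
    then have "\<forall>i\<in>{..<n}. \<exists>a. c i = a *s x i" by (auto simp: C_def span_singleton PiE_iff)
    then obtain a where "\<And>i. i < n \<Longrightarrow> c i = a i *s x i" by (metis lessThan_iff)
    then have "(\<Sum>i<n. c i) = (\<Sum>i<n. a i *s x i)" by simp
    then show "(\<Sum>i<n. c i) \<in> F" unfolding F by blast
  next
    fix y assume "y \<in> F"
    then obtain a where "y = (\<Sum>i<n. a i *s x i)" unfolding F by blast
    then have "y = (\<Sum>i<n. restrict (\<lambda>i. a i *s x i) {..<n} i)" by simp
    moreover have "restrict (\<lambda>i. a i *s x i) {..<n} \<in> Pi\<^sub>E {..<n} C" by (auto simp: C_def span_singleton)
    ultimately show "\<exists>c\<in>Pi\<^sub>E {..<n} C. y = (\<Sum>i<n. c i)" by blast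
  qed
  moreover have "subspace (C i) \<and> (\<exists>\<phi>. quotient_iso scale (ideal_power P l) (C i) \<phi>)" if "i < n" for i
    using quotient_iso_iff[OF ideal_ideal_power] ann[OF that] by (auto simp: C_def)
  ultimately show ?thesis
    unfolding homocyclic_of_exponent_def by (intro exI[of _ n] exI[of _ C]) simp
qed

context dedekind_module
begin

text \<open>A largest submodule F with a cyclic basis is homogeneous, hence splits off. A nonzero
  component of the complement would be homogeneous of the same exponent l, and an element of it not
  killed by p^(l-1) would extend the basis.\<close>

lemma homocyclic_if_homogeneous:
  assumes P: "dedekind_module_at scale P" and S: "subspace S"
    and hom: "homogeneous scale (uniformizer P) l (primary_component scale P S)"
  shows "homocyclic_of_exponent scale P l (primary_component scale P S)"
proof -
  interpret dedekind_module_at scale P by fact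
  have l: "1 \<le> l" "\<And>x. x \<in> pc S \<Longrightarrow> p ^ l *s x = 0" using hom by (auto simp: homogeneous_def)
  let ?A = "{F. subspace F \<and> F \<subseteq> pc S \<and> (\<exists>n x. cyclic_basis (ideal_power P l) n x F)}"
  have "cyclic_basis (ideal_power P l) 0 x {0}" for x by (auto simp: cyclic_basis_def)
  then have "{0} \<in> ?A" using subspace_0[OF subspace_pc[OF S]] by auto
  then have "?A \<noteq> {}" by blast
  then obtain F where F: "F \<in> ?A" "\<And>X. X \<in> ?A \<Longrightarrow> F \<subseteq> X \<Longrightarrow> X = F"
    by (rule maximal_submodule) auto
  then obtain n x where Fs: "subspace F" "F \<subseteq> pc S" and x: "cyclic_basis (ideal_power P l) n x F" by blast
  have Fh: "homogeneous scale p l F"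
    by (rule homogeneous_if_homocyclic[OF homocyclic_if_cyclic_basis[OF x] l(1)])
  obtain C where C: "is_direct_sum scale S F C" using primary_direct_summand[OF P S Fs Fh l(2)] .
  note D = is_direct_sumD[OF C]
  have "pc C = {0}"
  proof (rule ccontr)
    assume "pc C \<noteq> {0}"
    then obtain t where t: "t \<in> pc C" "p ^ (l - 1) *s t \<noteq> 0"
      using homogeneous_top[OF module_axioms subspace_pc[OF D(2)]
          homogeneous_summand[OF is_direct_sum_commute[OF C] hom]] by blast
    have tC: "t \<in> C" "t \<in> pc S" using t(1) pc_subset pc_mono[OF D(5)] by auto
    have ann: "d *s t = 0 \<longleftrightarrow> d \<in> ideal_power P l" for d
      using annihilator_power[OF tC(2) l(2)[OF tC(2)]] t(2) by blast
    have WC: "span {t} \<subseteq> C" using tC(1) D(2) by (intro span_minimal) auto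
    have sup: "F \<subseteq> F + span {t}" "span {t} \<subseteq> F + span {t}"
      using set_plus_superset[OF Fs(1) subspace_span] by auto
    define x' where "x' = x(n := t)"
    have sum: "(\<Sum>i<Suc n. c i *s x' i) = (\<Sum>i<n. c i *s x i) + c n *s t" for c by (simp add: x'_def)
    have F_eq: "F = range (\<lambda>c. \<Sum>i<n. c i *s x i)" using x by (simp add: cyclic_basis_def)
    have "cyclic_basis (ideal_power P l) (Suc n) x' (F + span {t})"
      unfolding cyclic_basis_def
    proof (intro conjI allI impI)
      show "d *s x' i = 0 \<longleftrightarrow> d \<in> ideal_power P l" if "i < Suc n" for i d
        using that ann x by (auto simp: x'_def cyclic_basis_def less_Suc_eq)
      show "F + span {t} = range (\<lambda>c. \<Sum>i<Suc n. c i *s x' i)"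
      proof (intro equalityI subsetI)
        fix y assume "y \<in> F + span {t}"
        then obtain c d where "y = (\<Sum>i<n. c i *s x i) + d *s t"
          by (auto simp: set_plus_def F_eq span_singleton)
        then have "y = (\<Sum>i<Suc n. (c(n := d)) i *s x' i)" unfolding sum by simp
        then show "y \<in> range (\<lambda>c. \<Sum>i<Suc n. c i *s x' i)" by blast
      next
        fix y assume "y \<in> range (\<lambda>c. \<Sum>i<Suc n. c i *s x' i)"
        then obtain c where "y = (\<Sum>i<n. c i *s x i) + c n *s t" unfolding sum by blast
        moreover have "(\<Sum>i<n. c i *s x i) \<in> F" unfolding F_eq by blast
        ultimately show "y \<in> F + span {t}" by (auto simp: span_singleton intro: set_plus_intro)
      qed
      fix c i assume c: "(\<Sum>i<Suc n. c i *s x' i) = 0" and i: "i < Suc n"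
      have "(\<Sum>i<n. c i *s x i) = 0 \<and> c n *s t = 0"
      proof (rule direct_sum_unique[OF C])
        show "(\<Sum>i<n. c i *s x i) \<in> F" unfolding F_eq by blast
        show "(\<Sum>i<n. c i *s x i) + c n *s t = 0 + 0" using c unfolding sum by simp
      qed (use D tC subspace_scale subspace_0 in auto)
      moreover from this have "\<forall>i<n. c i *s x i = 0"
        using x unfolding cyclic_basis_def by (elim conjE allE[of _ c]) simp
      ultimately show "c i *s x' i = 0" using i by (auto simp: x'_def less_Suc_eq)
    qed
    moreover have "F + span {t} \<subseteq> pc S"
      using Fs(2) tC(2) subspace_pc[OF S] by (intro set_plus_subset span_minimal) auto
    moreover have "subspace (F + span {t})" using subspace_set_plus Fs(1) by blast
    ultimately have "F + span {t} = F" using F(2) sup(1) by blast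
    then have "t \<in> F" using sup(2) span_base[of t "{t}"] by blast
    then have "t = 0" using D(6) tC(1) by blast
    then show False using t(2) by simp
  qed
  then have "pc S = F" using pc_subset_if_complement_zero[OF C] Fs(2) by blast
  then show ?thesis using homocyclic_if_cyclic_basis[OF x] by simp
qed

lemma homocyclic_iff_homogeneous:
  assumes "dedekind_module_at scale P" "subspace S"
  shows "homocyclic scale P (primary_component scale P S) \<longleftrightarrow>
    (\<exists>l. homogeneous scale (uniformizer P) l (primary_component scale P S))"
  using dedekind_module_at.homogeneous_if_homocyclic[OF assms(1)] homocyclic_if_homogeneous[OF assms]
  unfolding homocyclic_def by (metis homogeneous_def)

text \<open>The zero module is homocyclic of every exponent, so the definite description needs a
  nonzero component.\<close>

lemma homocyclic_exponent_eq:
  assumes P: "dedekind_module_at scale P" and S: "subspace S"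
    and l: "homogeneous scale (uniformizer P) l (primary_component scale P S)"
    and nz: "primary_component scale P S \<noteq> {0}"
  shows "homocyclic_exponent scale P (primary_component scale P S) = l"
  unfolding homocyclic_exponent_def
proof (rule the_equality)
  show "1 \<le> l \<and> homocyclic_of_exponent scale P l (primary_component scale P S)"
    using l homocyclic_if_homogeneous[OF P S l] by (simp add: homogeneous_def)
  fix m assume m: "1 \<le> m \<and> homocyclic_of_exponent scale P m (primary_component scale P S)"
  show "m = l"
    using homogeneous_unique[OF module_axioms dedekind_module_at.subspace_pc[OF P S] _ l nz]
      dedekind_module_at.homogeneous_if_homocyclic[OF P] m by blast
qed

section \<open>Characterization of C4*-modules\<close>

text \<open>A component killed by p passes this on to submodules. A cyclic component has a socle
  generated by one element q; if a submodule of exponent l contains t with p^(l-1) t nonzero, this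
  multiple already generates the socle. So all submodules have homogeneous components in both
  cases.\<close>

lemma C4_star_if_cyclic_or_killed:
  assumes S: "subspace S" and rank: "rank_le_1 scale S"
    and comp: "\<And>P. prime_ideal P \<Longrightarrow> P \<noteq> {0} \<Longrightarrow> cyclic_module scale (primary_component scale P S) \<or>
      (\<forall>x\<in>primary_component scale P S. uniformizer P *s x = 0)"
  shows "C4_star scale S"
  unfolding C4_star_def
proof (intro allI impI, elim conjE)
  fix L assume L: "subspace L" "L \<subseteq> S"
  have "homogeneous_components scale L"
    unfolding homogeneous_components_def
  proof (intro allI impI, elim conjE)
    fix P :: "'d set"
    assume prime: "prime_ideal P" "P \<noteq> {0}"
    then have P: "dedekind_module_at scale P" by (rule at_prime)
    interpret dedekind_module_at scale P by (rule P)
    have LS: "pc L \<subseteq> pc S" by (rule pc_mono[OF L(2)])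
    show "\<exists>l. homogeneous scale p l (pc L)"
    proof (cases "(\<forall>x\<in>pc S. p *s x = 0) \<or> pc L = {0}")
      case True
      then have "p *s x = 0" if "x \<in> pc L" for x using LS that by (metis scale_zero_right singletonD subsetD)
      moreover have "\<exists>y\<in>pc L. x = p ^ (1 - 1) *s y" if "x \<in> pc L" for x
        using that by (intro bexI[of _ x]) simp_all
      ultimately have "homogeneous scale p 1 (pc L)" unfolding homogeneous_def by (metis order_refl power_one_right)
      then show ?thesis by blast
    next
      case False
      then have "cyclic_module scale (pc S)" using comp[OF prime nonzero] by blast
      then obtain z where z: "pc S = span {z}" unfolding cyclic_module_def by blast
      have zS: "z \<in> pc S" unfolding z by (simp add: span_base)
      have "pc S \<noteq> {0}"
      proof
        assume "pc S = {0}"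
        have "p *s x = 0" if "x \<in> pc S" for x
        proof -
          have "x \<in> {0}" using that \<open>pc S = {0}\<close> by (rule back_subst)
          then show ?thesis by simp
        qed
        then show False using False by blast
      qed
      then obtain N z0 where N: "1 \<le> N" "\<And>x. x \<in> pc S \<Longrightarrow> p ^ N *s x = 0"
        and z0: "z0 \<in> pc S" "p ^ (N - 1) *s z0 \<noteq> 0" using pc_exponent[OF P S] by metis
      obtain d0 where d0: "z0 = d0 *s z" using z0(1) unfolding z by (auto simp: span_singleton)
      \<comment> \<open>N is the exact exponent of D z, so q generates the socle.\<close>
      define q where "q = p ^ (N - 1) *s z"
      have "p ^ (N - 1) *s z0 = d0 *s q" unfolding q_def d0 by (rule scale_left_commute)
      then have q0: "q \<noteq> 0" using z0(2) by auto
      have qS: "q \<in> pc S" unfolding q_def by (rule subspace_scale[OF subspace_pc[OF S] zS])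
      have "p ^ N = p * p ^ (N - 1)" using N(1) by (cases N) auto
      then have pq: "p *s q = 0" using N(2)[OF zS] by (simp add: q_def)
      have hom: "homogeneous scale p N (pc S)"
        unfolding z using cyclic_homogeneous[OF zS N(2)[OF zS]] q0 by (simp add: q_def)
      have socle: "\<exists>e. x = e *s q" if x: "x \<in> pc S" "p *s x = 0" for x
      proof -
        obtain y where "y \<in> pc S" "x = p ^ (N - 1) *s y" using hom x unfolding homogeneous_def by blast
        moreover from this obtain e where "y = e *s z" unfolding z by (auto simp: span_singleton)
        ultimately have "x = e *s q" unfolding q_def by (simp only: scale_left_commute)
        then show ?thesis by blast
      qed
      have "pc L \<noteq> {0}" using False by blast
      then obtain l t where l: "1 \<le> l" "\<And>x. x \<in> pc L \<Longrightarrow> p ^ l *s x = 0"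
        and t: "t \<in> pc L" "p ^ (l - 1) *s t \<noteq> 0" using pc_exponent[OF P L(1)] by metis
      have tS: "p ^ (l - 1) *s t \<in> pc S" using subspace_scale[OF subspace_pc[OF S]] t(1) LS by blast
      have "p ^ l = p * p ^ (l - 1)" using l(1) by (cases l) auto
      then have "p *s p ^ (l - 1) *s t = 0" using l(2)[OF t(1)] by simp
      then obtain d where d: "p ^ (l - 1) *s t = d *s q" using socle[OF tS] by blast
      \<comment> \<open>Elements of P kill q, as u P lies in p D and p q = 0, while p^(l-1) t is
        nonzero.\<close>
      have "d \<notin> P"
      proof
        assume "d \<in> P"
        then obtain r where r: "u * d = p * r" using p_dvd by (blast elim: dvdE)
        have "u *s p ^ (l - 1) *s t = (u * d) *s q" by (simp only: d scale_scale)
        also have "\<dots> = r *s p *s q" unfolding r by (simp add: mult.commute)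
        finally have "u *s p ^ (l - 1) *s t = 0" using pq by simp
        then show False using scale_eq_0[OF u_notin tS] t(2) by blast
      qed
      then obtain v where v: "v *s d *s q = q" using unit_scale qS by metis
      have "homogeneous scale p l (pc L)"
        unfolding homogeneous_def
      proof (intro conjI ballI impI l)
        fix x assume x: "x \<in> pc L" "p *s x = 0"
        then obtain e where "x = e *s q" using socle LS by blast
        then have "x = e *s v *s p ^ (l - 1) *s t" using v d by metis
        then have "x = p ^ (l - 1) *s (e * v) *s t" by (simp add: mult_ac)
        then show "\<exists>y\<in>pc L. x = p ^ (l - 1) *s y" using subspace_scale[OF subspace_pc[OF L(1)] t(1)] by blast
      qed
      then show ?thesis by blast
    qed
  qed
  moreover have "rank_le_1 scale L" using rank L(2) unfolding rank_le_1_def by blast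
  ultimately show "C4 scale L" using C4_if_homogeneous_components L(1) by blast
qed

text \<open>If p does not kill the component, its exponent l is at least 2, and a cyclic D z of full
  length splits off. A nonzero component of the complement would contain a nonzero w with p w = 0.
  Then D z + D w has exponent at least 2, but its socle element w is not divisible by p in it, so
  its component is not homogeneous.\<close>

lemma cyclic_or_killed_if_C4_star:
  assumes S: "subspace S" and C4: "C4_star scale S" and P: "dedekind_module_at scale P"
  shows "cyclic_module scale (primary_component scale P S) \<or>
    (\<forall>x\<in>primary_component scale P S. uniformizer P *s x = 0)"
proof (rule disjCI)
  interpret dedekind_module_at scale P by fact
  assume "\<not> (\<forall>x\<in>pc S. p *s x = 0)"
  then obtain x where x: "x \<in> pc S" "p *s x \<noteq> 0" by blast
  have nz: "pc S \<noteq> {0}"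
  proof
    assume "pc S = {0}"
    then have "x = 0" using x(1) by blast
    then show False using x(2) by simp
  qed
  have "homogeneous_components scale S"
    using C4 S homogeneous_components_if_C4 unfolding C4_star_def by blast
  then obtain l where hom: "homogeneous scale p l (pc S)"
    unfolding homogeneous_components_def using prime nonzero by blast
  then have l: "1 \<le> l" "\<And>x. x \<in> pc S \<Longrightarrow> p ^ l *s x = 0" by (auto simp: homogeneous_def)
  have "l \<noteq> 1" using l(2)[OF x(1)] x(2) by auto
  obtain z where z: "z \<in> pc S" "p ^ (l - 1) *s z \<noteq> 0"
    using homogeneous_top[OF module_axioms subspace_pc[OF S] hom nz] .
  have "span {z} \<subseteq> pc S" by (rule span_minimal) (use z subspace_pc[OF S] in auto)
  then obtain C where C: "is_direct_sum scale S (span {z}) C"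
    using primary_direct_summand[OF P S subspace_span _ cyclic_homogeneous[OF z(1) l(2)[OF z(1)] z(2)] l(2)] by blast
  note D = is_direct_sumD[OF C]
  have "pc C = {0}"
  proof (rule ccontr)
    assume "pc C \<noteq> {0}"
    then obtain w0 where w0: "w0 \<in> pc C" "w0 \<noteq> 0" using subspace_0[OF subspace_pc[OF D(2)]] by blast
    obtain n where "p ^ n *s w0 = 0" using pc_power[OF w0(1)] .
    then obtain k where k: "p ^ k *s w0 \<noteq> 0" "p ^ Suc k *s w0 = 0" using least_power w0(2) by blast
    define w where "w = p ^ k *s w0"
    have w: "w \<in> pc C" "w \<noteq> 0" "p *s w = 0"
      using k subspace_scale[OF subspace_pc[OF D(2)] w0(1)] by (auto simp: w_def)
    let ?L = "span {z} + span {w}"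
    have L: "subspace ?L" "span {z} \<subseteq> ?L" "span {w} \<subseteq> ?L"
      using subspace_set_plus set_plus_superset[OF subspace_span subspace_span] by auto
    have wC: "w \<in> C" using w(1) pc_subset by blast
    have "span {w} \<subseteq> S" using wC D(5) D(3) by (intro span_minimal) auto
    then have LS: "?L \<subseteq> S" using set_plus_subset[OF D(3,4)] by blast
    have "C4 scale ?L" using C4 L(1) LS unfolding C4_star_def by blast
    then obtain m where m: "homogeneous scale p m (pc ?L)"
      using homogeneous_components_if_C4[OF L(1)] prime nonzero unfolding homogeneous_components_def by blast
    have "z \<in> ?L" "w \<in> ?L" using L(2,3) span_base[of z "{z}"] span_base[of w "{w}"] by auto
    then have zw: "z \<in> pc ?L" "w \<in> pc ?L"
      using z(1) w(1) pc_Int[of ?L] pc_Int[of S] pc_Int[of C] by blast+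
    have "p ^ m *s z = 0" using m zw(1) by (simp add: homogeneous_def)
    then have "\<not> m \<le> l - 1" using power_scale_eq_0 z(2) by blast
    then have "1 \<le> m - 1" using l(1) \<open>l \<noteq> 1\<close> by linarith
    then have pw: "p ^ (m - 1) *s w = 0" using power_scale_eq_0[of p 1 w "m - 1"] w(3) by simp
    obtain y where y: "y \<in> pc ?L" "w = p ^ (m - 1) *s y" using m zw(2) w(3) unfolding homogeneous_def by blast
    have "y \<in> ?L" using y(1) pc_subset by blast
    then obtain d e where "y = d *s z + e *s w" by (auto simp: set_plus_def span_singleton)
    then have "w = p ^ (m - 1) *s d *s z + e *s p ^ (m - 1) *s w"
      using y(2) by (metis scale_left_commute scale_right_distrib)
    then have "w = p ^ (m - 1) *s d *s z" unfolding pw by (simp only: scale_zero_right add_0_right)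
    then have "w \<in> span {z}" by (auto simp: span_singleton)
    then show False using D(6) wC w(2) by blast
  qed
  then have "pc S = span {z}" using pc_subset_if_complement_zero[OF C] \<open>span {z} \<subseteq> pc S\<close> by blast
  then show "cyclic_module scale (pc S)" by (auto simp: cyclic_module_def)
qed

theorem C4_star_iff:
  assumes S: "subspace S" and nf: "\<not> is_field TYPE('d)"
  shows "C4_star scale S \<longleftrightarrow> rank_le_1 scale S \<and>
    (\<forall>P. prime_ideal P \<and> P \<noteq> {0} \<longrightarrow> cyclic_module scale (primary_component scale P S) \<or>
      (\<forall>x\<in>primary_component scale P S. uniformizer P *s x = 0))"
proof (intro iffI conjI allI impI)
  assume C4: "C4_star scale S"
  then show "rank_le_1 scale S" using rank_le_1_if_C4[OF S _ nf] S unfolding C4_star_def by blast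
  show "cyclic_module scale (primary_component scale P S) \<or>
      (\<forall>x\<in>primary_component scale P S. uniformizer P *s x = 0)" if "prime_ideal P \<and> P \<noteq> {0}" for P
    using cyclic_or_killed_if_C4_star[OF S C4 at_prime] that by blast
qed (use C4_star_if_cyclic_or_killed[OF S] in blast)

end

text \<open>In a simple submodule the kernel of p is nonzero, since powers of p kill the elements,
  hence it is everything. Conversely, if p kills the component, every D x with x nonzero is simple:
  multiples by elements of P vanish and those by other elements can be undone.\<close>

lemma (in dedekind_module_at) semisimple_pc_iff:
  assumes S: "subspace S"
  shows "semisimple_module scale (pc S) \<longleftrightarrow> (\<forall>x\<in>pc S. p *s x = 0)"
proof
  let ?U = "\<Union>{L. simple_module scale L \<and> L \<subseteq> pc S}"
  assume ss: "semisimple_module scale (pc S)"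
  have "?U \<subseteq> {x. p *s x = 0}"
  proof
    fix y assume "y \<in> ?U"
    then obtain L where L: "simple_module scale L" "L \<subseteq> pc S" "y \<in> L" by blast
    have Ls: "subspace L" "L \<noteq> {0}" and simple: "\<And>L'. subspace L' \<Longrightarrow> L' \<subseteq> L \<Longrightarrow> L' = {0} \<or> L' = L"
      using L(1) by (auto simp: simple_module_def)
    obtain x where x: "x \<in> L" "x \<noteq> 0" using Ls subspace_0 by blast
    obtain n where "p ^ n *s x = 0" using pc_power x(1) L(2) by blast
    then obtain k where k: "p ^ k *s x \<noteq> 0" "p ^ Suc k *s x = 0" using least_power x(2) by blast
    let ?L = "{x \<in> L. p *s x = 0}"
    have "subspace ?L"
      using Ls(1) by (intro subspaceI) (auto simp: subspace_0 subspace_add subspace_scale scale_right_distrib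
          scale_left_commute[of p] simp del: scale_scale)
    moreover have "p ^ k *s x \<in> ?L" using k(2) subspace_scale[OF Ls(1) x(1)] by simp
    ultimately have "?L = L" using simple[of ?L] k(1) by blast
    then show "y \<in> {x. p *s x = 0}" using L(3) by blast
  qed
  moreover have "subspace {x. p *s x = 0}"
    by (intro subspaceI) (auto simp: scale_right_distrib scale_left_commute[of p] simp del: scale_scale)
  ultimately have "span ?U \<subseteq> {x. p *s x = 0}" by (rule span_minimal)
  then show "\<forall>x\<in>pc S. p *s x = 0" using ss unfolding semisimple_module_def by blast
next
  let ?U = "\<Union>{L. simple_module scale L \<and> L \<subseteq> pc S}"
  assume killed: "\<forall>x\<in>pc S. p *s x = 0"
  have "pc S \<subseteq> span ?U"
  proof
    fix x assume x: "x \<in> pc S"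
    show "x \<in> span ?U"
    proof (cases "x = 0")
      case False
      have xS: "span {x} \<subseteq> pc S" using x subspace_pc[OF S] by (intro span_minimal) auto
      have "simple_module scale (span {x})"
        unfolding simple_module_def
      proof (intro conjI allI impI)
        show "span {x} \<noteq> {0}" using False span_base[of x "{x}"] by blast
        fix L assume L: "subspace L \<and> L \<subseteq> span {x}"
        show "L = {0} \<or> L = span {x}"
        proof (rule disjCI)
          assume "L \<noteq> span {x}"
          show "L = {0}"
          proof (rule ccontr)
            assume "L \<noteq> {0}"
            then obtain y where y: "y \<in> L" "y \<noteq> 0" using L subspace_0 by blast
            then obtain d where d: "y = d *s x" using L by (auto simp: span_singleton)
            have "d \<notin> P"
            proof
              assume "d \<in> P"
              then obtain r where r: "u * d = p * r" using p_dvd by (blast elim: dvdE)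
              have "u *s y = (u * d) *s x" by (simp add: d)
              also have "\<dots> = r *s p *s x" unfolding r by (simp add: mult.commute)
              finally have "u *s y = 0" using killed x by simp
              then show False using scale_eq_0[OF u_notin] y L xS by blast
            qed
            then obtain v where "v *s d *s x = x" using unit_scale x by metis
            then have "x \<in> L" using y(1) L subspace_scale[of L y v] by (simp add: d)
            then have "span {x} \<subseteq> L" using L by (intro span_minimal) auto
            then show False using L \<open>L \<noteq> span {x}\<close> by blast
          qed
        qed
      qed simp
      then have "x \<in> ?U" using xS span_base[of x "{x}"] by blast
      then show ?thesis by (rule span_base)
    qed (simp add: span_zero)
  qed
  moreover have "span ?U \<subseteq> pc S" using subspace_pc[OF S] by (intro span_minimal) auto
  ultimately show "semisimple_module scale (pc S)" unfolding semisimple_module_def by blast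
qed

section \<open>Semi-weak-CS\<close>

context noetherian_module
begin

lemma essential_in_refl: "subspace X \<Longrightarrow> essential_in scale X X"
  unfolding essential_in_def by (metis inf.absorb1 subset_refl)

text \<open>Each of the two unions already occurs in a triple of the chain, hence is a direct
  summand, and serves as A or B itself.\<close>

lemma semi_weak_CS: "semi_weak_CS scale S"
  unfolding semi_weak_CS_def
proof (intro ballI impI)
  fix \<C> assume \<C>: "\<C> \<in> Chains (summand_isos_order scale S)" "\<C> \<noteq> {}"
  have total: "(a, b) \<in> summand_isos_order scale S \<or> (b, a) \<in> summand_isos_order scale S"
    if "a \<in> \<C>" "b \<in> \<C>" for a b using \<C>(1) that unfolding Chains_def by blast
  have summand: "direct_summand scale X S \<and> direct_summand scale Y S" if "(X, Y, \<phi>) \<in> \<C>" for X Y \<phi>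
    using total[OF that that] by (auto simp: summand_isos_order_def summand_isos_def)
  have sub: "subspace X" if "direct_summand scale X S" for X
    using that by (auto simp: direct_summand_def is_direct_sum_def)
  let ?X = "(\<lambda>(X, Y, \<phi>). X) ` \<C>" and ?Y = "(\<lambda>(X, Y, \<phi>). Y) ` \<C>"
  have "\<Union>?X \<in> ?X"
  proof (rule Union_chain_in)
    show "?X \<noteq> {}" using \<C>(2) by simp
    show "subspace X" if "X \<in> ?X" for X using that summand sub by auto
    fix X X' assume "X \<in> ?X" "X' \<in> ?X"
    then obtain Y \<phi> Y' \<phi>' where "(X, Y, \<phi>) \<in> \<C>" "(X', Y', \<phi>') \<in> \<C>" by auto
    from total[OF this] show "X \<subseteq> X' \<or> X' \<subseteq> X" by (auto simp: summand_isos_order_def)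
  qed
  moreover have "\<Union>?Y \<in> ?Y"
  proof (rule Union_chain_in)
    show "?Y \<noteq> {}" using \<C>(2) by simp
    show "subspace Y" if "Y \<in> ?Y" for Y using that summand sub by auto
    fix Y Y' assume "Y \<in> ?Y" "Y' \<in> ?Y"
    then obtain X \<phi> X' \<phi>' where "(X, Y, \<phi>) \<in> \<C>" "(X', Y', \<phi>') \<in> \<C>" by auto
    from total[OF this] show "Y \<subseteq> Y' \<or> Y' \<subseteq> Y" by (auto simp: summand_isos_order_def)
  qed
  moreover have X: "direct_summand scale X S" if "X \<in> ?X" for X using that summand by auto
  moreover have Y: "direct_summand scale Y S" if "Y \<in> ?Y" for Y using that summand by auto
  ultimately have "direct_summand scale (\<Union>?X) S" "direct_summand scale (\<Union>?Y) S"
    by (iprover intro: X Y)+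
  then show "\<exists>A B. direct_summand scale A S \<and> direct_summand scale B S \<and>
      essential_in scale (\<Union>(X, Y, \<phi>)\<in>\<C>. X) A \<and> essential_in scale (\<Union>(X, Y, \<phi>)\<in>\<C>. Y) B"
    using essential_in_refl sub by blast
qed

end

section \<open>Direct sums of two modules\<close>

lemma finitely_generated_prod:
  fixes s1 :: "'d::comm_ring_1 \<Rightarrow> 'm::ab_group_add \<Rightarrow> 'm" and s2 :: "'d \<Rightarrow> 'n::ab_group_add \<Rightarrow> 'n"
  assumes "module s1" "finitely_generated s1" "module s2" "finitely_generated s2"
  shows "finitely_generated (module_prod.scale s1 s2)"
proof -
  interpret m1: module s1 by fact
  interpret m2: module s2 by fact
  interpret module_prod s1 s2 by unfold_locales
  obtain A where A: "finite A" "m1.span A = UNIV" using assms(2) by (auto simp: finitely_generated_def)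
  obtain B where B: "finite B" "m2.span B = UNIV" using assms(4) by (auto simp: finitely_generated_def)
  let ?G = "(\<lambda>x. (x, 0)) ` A \<union> (\<lambda>y. (0, y)) ` B"
  have "(x, 0) \<in> p.span ?G" if "x \<in> m1.span A" for x
    using that
  proof (induction x rule: m1.span_induct_alt)
    case base show ?case using p.span_zero by (simp add: zero_prod_def)
  next
    case (step c x y)
    have "scale c (x, 0) + (y, 0) \<in> p.span ?G"
      using step(1) by (intro p.span_add[OF p.span_scale[OF p.span_base] step(2)]) auto
    then show ?case by (simp add: scale_prod)
  qed
  moreover have "(0, y) \<in> p.span ?G" if "y \<in> m2.span B" for y
    using that
  proof (induction y rule: m2.span_induct_alt)
    case base show ?case using p.span_zero by (simp add: zero_prod_def)
  next
    case (step c x y)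
    have "scale c (0, x) + (0, y) \<in> p.span ?G"
      using step(1) by (intro p.span_add[OF p.span_scale[OF p.span_base] step(2)]) auto
    then show ?case by (simp add: scale_prod)
  qed
  ultimately have "(x, 0) + (0, y) \<in> p.span ?G" for x y using A(2) B(2) by (intro p.span_add) auto
  then have "p.span ?G = UNIV" by auto
  then show ?thesis using A(1) B(1) unfolding finitely_generated_def by (intro exI[of _ ?G]) simp
qed

locale domain_module_prod = module_prod s1 s2
  for s1 :: "'d::idom \<Rightarrow> 'm::ab_group_add \<Rightarrow> 'm" and s2 :: "'d \<Rightarrow> 'n::ab_group_add \<Rightarrow> 'n"

text \<open>The exponent l is shared by both factors, which is how the equality of exponents enters
  the criterion for the direct sum.\<close>

lemma (in domain_module_prod) homogeneous_Times_iff: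
  assumes "m1.subspace X" "m2.subspace Y"
  shows "homogeneous scale p l (X \<times> Y) \<longleftrightarrow> homogeneous s1 p l X \<and> homogeneous s2 p l Y"
proof
  assume h: "homogeneous scale p l (X \<times> Y)"
  have 0: "0 \<in> X" "0 \<in> Y" using assms m1.subspace_0 m2.subspace_0 by auto
  have 1: "1 \<le> l" and 2: "\<And>z. z \<in> X \<times> Y \<Longrightarrow> scale (p ^ l) z = 0"
    and 3: "\<And>z. z \<in> X \<times> Y \<Longrightarrow> scale p z = 0 \<Longrightarrow> \<exists>y\<in>X \<times> Y. z = scale (p ^ (l - 1)) y"
    using h by (auto simp: homogeneous_def)
  have "s1 (p ^ l) x = 0" if "x \<in> X" for x using 2[of "(x, 0)"] that 0 by (simp add: scale_prod zero_prod_def)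
  moreover have "\<exists>y\<in>X. x = s1 (p ^ (l - 1)) y" if "x \<in> X" "s1 p x = 0" for x
    using 3[of "(x, 0)"] that 0 by (auto simp: scale_prod zero_prod_def)
  moreover have "s2 (p ^ l) y = 0" if "y \<in> Y" for y using 2[of "(0, y)"] that 0 by (simp add: scale_prod zero_prod_def)
  moreover have "\<exists>x\<in>Y. y = s2 (p ^ (l - 1)) x" if "y \<in> Y" "s2 p y = 0" for y
    using 3[of "(0, y)"] that 0 by (auto simp: scale_prod zero_prod_def)
  ultimately show "homogeneous s1 p l X \<and> homogeneous s2 p l Y" using 1 by (simp add: homogeneous_def)
next
  assume "homogeneous s1 p l X \<and> homogeneous s2 p l Y"
  then show "homogeneous scale p l (X \<times> Y)"
    unfolding homogeneous_def by (auto simp: scale_prod zero_prod_def)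
qed

lemma (in domain_module_prod) primary_component_prod:
  "primary_component scale P UNIV = primary_component s1 P UNIV \<times> primary_component s2 P UNIV"
proof (intro equalityI subsetI)
  fix z assume "z \<in> primary_component scale P UNIV"
  then show "z \<in> primary_component s1 P UNIV \<times> primary_component s2 P UNIV"
    by (cases z) (auto simp: primary_component_def scale_prod zero_prod_def)
next
  fix z assume "z \<in> primary_component s1 P UNIV \<times> primary_component s2 P UNIV"
  then obtain x y m n where z: "z = (x, y)" "\<forall>d\<in>ideal_power P m. s1 d x = 0" "\<forall>d\<in>ideal_power P n. s2 d y = 0"
    by (auto simp: primary_component_def)
  have "scale d z = 0" if "d \<in> ideal_power P (max m n)" for d
    using that z ideal_power_antimono[of m "max m n" P] ideal_power_antimono[of n "max m n" P]
    by (auto simp: scale_prod zero_prod_def)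
  then show "z \<in> primary_component scale P UNIV" by (auto simp: primary_component_def)
qed

lemma (in domain_module_prod) cyclic_TimesD:
  assumes "cyclic_module scale (X \<times> Y)" "0 \<in> X" "0 \<in> Y"
  shows "cyclic_module s1 X" "cyclic_module s2 Y"
proof -
  obtain a b where "X \<times> Y = p.span {(a, b)}" using assms(1) by (auto simp: cyclic_module_def)
  then have XY: "X \<times> Y = range (\<lambda>d. (s1 d a, s2 d b))" by (simp add: p.span_singleton scale_prod)
  have "fst ` (X \<times> Y) = m1.span {a}" "snd ` (X \<times> Y) = m2.span {b}"
    unfolding XY by (simp_all add: m1.span_singleton m2.span_singleton image_image)
  then show "cyclic_module s1 X" "cyclic_module s2 Y" using assms(2,3) by (auto simp: cyclic_module_def split: if_splits)
qed

lemma (in domain_module_prod) cyclic_Times_zero: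
  "cyclic_module s1 X \<Longrightarrow> cyclic_module scale (X \<times> {0})"
  "cyclic_module s2 Y \<Longrightarrow> cyclic_module scale ({0} \<times> Y)"
proof -
  have "m1.span {a} \<times> {0} = p.span {(a, 0)}" "{0} \<times> m2.span {b} = p.span {(0, b)}" for a b
    by (auto simp: p.span_singleton m1.span_singleton m2.span_singleton scale_prod)
  then show "cyclic_module s1 X \<Longrightarrow> cyclic_module scale (X \<times> {0})"
    "cyclic_module s2 Y \<Longrightarrow> cyclic_module scale ({0} \<times> Y)"
    unfolding cyclic_module_def by metis+
qed

section \<open>Torsion and support\<close>

lemma (in dedekind_module_at) pc_torsion: "pc (torsion scale) = pc UNIV"
proof -
  have "x \<in> torsion scale" if x: "x \<in> pc UNIV" for x
  proof -
    obtain d where "d \<noteq> 0" "d *s x = 0" using pc_nonzero_power[OF x] .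
    then show ?thesis by (auto simp: torsion_def)
  qed
  then show ?thesis using pc_Int[of "torsion scale"] by blast
qed

text \<open>A nonzero annihilator of a torsion element lies outside the zero ideal, which excludes
  the zero prime. At other primes a multiplier outside P moves the element into the component, where
  such multipliers act injectively.\<close>

lemma (in dedekind_module) support_torsion:
  "support scale (torsion scale) =
    {P. prime_ideal P \<and> P \<noteq> {0} \<and> primary_component scale P UNIV \<noteq> {0}}"
proof (intro equalityI subsetI)
  fix P assume "P \<in> support scale (torsion scale)"
  then obtain x where P: "prime_ideal P" and x: "x \<in> torsion scale" "\<And>d. d \<notin> P \<Longrightarrow> d *s x \<noteq> 0"
    by (auto simp: support_def)
  obtain d where d: "d \<noteq> 0" "d *s x = 0" using x(1) by (auto simp: torsion_def)
  then have "P \<noteq> {0}" using x(2) by blast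
  then interpret dedekind_module_at scale P using at_prime P by blast
  obtain w where "w \<notin> P" "w *s x \<in> pc UNIV" using scale_into_pc[OF d UNIV_I subspace_UNIV] .
  then have "pc UNIV \<noteq> {0}" using x(2) by blast
  then show "P \<in> {P. prime_ideal P \<and> P \<noteq> {0} \<and> primary_component scale P UNIV \<noteq> {0}}"
    using P \<open>P \<noteq> {0}\<close> by blast
next
  fix P assume P: "P \<in> {P. prime_ideal P \<and> P \<noteq> {0} \<and> primary_component scale P UNIV \<noteq> {0}}"
  then interpret dedekind_module_at scale P using at_prime by blast
  obtain x where x: "x \<in> pc UNIV" "x \<noteq> 0" using P subspace_0[OF subspace_pc[OF subspace_UNIV]] by blast
  have "x \<in> torsion scale" using x(1) pc_torsion pc_subset by blast
  moreover have "d *s x \<noteq> 0" if "d \<notin> P" for d using scale_eq_0[OF that x(1)] x(2) by blast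
  ultimately show "P \<in> support scale (torsion scale)" using prime by (auto simp: support_def)
qed

theorem theorem10p7:
  fixes sM :: "'d::idom \<Rightarrow> 'm::ab_group_add \<Rightarrow> 'm"
    and sN :: "'d \<Rightarrow> 'n::ab_group_add \<Rightarrow> 'n"
  assumes "dedekind_domain TYPE('d)" and "\<not> is_field TYPE('d)"
    and "module sM" and "finitely_generated sM"
    and "module sN" and "finitely_generated sN"
  defines "sMN \<equiv> module_prod.scale sM sN"
    and "TM \<equiv> torsion sM"
    and "TN \<equiv> torsion sN"
  shows
    "(C4 sMN UNIV \<longleftrightarrow>
        module_rank sM + module_rank sN \<le> 1 \<and>
        (\<forall>P. prime_ideal P \<and> P \<noteq> {0} \<longrightarrow>
          homocyclic sM P (primary_component sM P TM) \<and>
          homocyclic sN P (primary_component sN P TN)) \<and>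
        (\<forall>P. prime_ideal P \<and> P \<noteq> {0} \<and>
          primary_component sM P TM \<noteq> {0} \<and> primary_component sN P TN \<noteq> {0} \<longrightarrow>
            homocyclic_exponent sM P (primary_component sM P TM) =
            homocyclic_exponent sN P (primary_component sN P TN)))
     \<and>
     (C4_star sMN UNIV \<longleftrightarrow>
        module_rank sM + module_rank sN \<le> 1 \<and>
        (\<forall>P. prime_ideal P \<and> P \<noteq> {0} \<longrightarrow>
          (cyclic_module sM (primary_component sM P TM) \<or>
            semisimple_module sM (primary_component sM P TM)) \<and>
          (cyclic_module sN (primary_component sN P TN) \<or>
            semisimple_module sN (primary_component sN P TN))) \<and>
        (\<forall>P \<in> support sM TM \<inter> support sN TN.
          semisimple_module sM (primary_component sM P TM) \<and>
          semisimple_module sN (primary_component sN P TN)))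
     \<and>
     (semi_weak_CS sMN UNIV \<and>
      (strongly_C4_star sMN UNIV \<longleftrightarrow>
        module_rank sM + module_rank sN \<le> 1 \<and>
        (\<forall>P. prime_ideal P \<and> P \<noteq> {0} \<longrightarrow>
          (cyclic_module sM (primary_component sM P TM) \<or>
            semisimple_module sM (primary_component sM P TM)) \<and>
          (cyclic_module sN (primary_component sN P TN) \<or>
            semisimple_module sN (primary_component sN P TN))) \<and>
        (\<forall>P \<in> support sM TM \<inter> support sN TN.
          semisimple_module sM (primary_component sM P TM) \<and>
          semisimple_module sN (primary_component sN P TN))))"
proof -
  have noeth: "noetherian_domain TYPE('d)" using assms(1) by (simp add: dedekind_domain_def)
  interpret M: dedekind_module sM
    using noetherian_module_if_finitely_generated[OF noeth assms(3,4)] assms(1)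
    by (simp add: dedekind_module_def dedekind_module_axioms_def)
  interpret N: dedekind_module sN
    using noetherian_module_if_finitely_generated[OF noeth assms(5,6)] assms(1)
    by (simp add: dedekind_module_def dedekind_module_axioms_def)
  interpret prod: domain_module_prod sM sN
    using assms(3,5) by (simp add: domain_module_prod_def module_prod_def module_pair_def)
  interpret MN: dedekind_module sMN
    using noetherian_module_if_finitely_generated[OF noeth prod.p.module_axioms
        finitely_generated_prod[OF assms(3-6)]] assms(1)
    by (simp add: dedekind_module_def dedekind_module_axioms_def sMN_def)
  let ?M = "\<lambda>P. primary_component sM P UNIV" and ?N = "\<lambda>P. primary_component sN P UNIV"
  have TM: "primary_component sM P TM = ?M P" and TN: "primary_component sN P TN = ?N P"
    if "prime_ideal P \<and> P \<noteq> {0}" for P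
    using dedekind_module_at.pc_torsion[OF M.at_prime] dedekind_module_at.pc_torsion[OF N.at_prime] that
    by (auto simp: TM_def TN_def)
  have rank: "module_rank sM + module_rank sN \<le> 1 \<longleftrightarrow> rank_le_1 sMN UNIV"
    unfolding sMN_def by (rule module_rank_add_le_1_iff[OF assms(3-6)])
  have pcMN: "primary_component sMN P UNIV = ?M P \<times> ?N P" for P
    unfolding sMN_def by (rule prod.primary_component_prod)
  \<comment> \<open>A zero component is homogeneous for every exponent, so it takes the exponent of
    the other one; if both are nonzero, the uniqueness of exponents forces equality.\<close>
  have homocyclic: "(\<exists>l. homogeneous sMN (uniformizer P) l (primary_component sMN P UNIV)) \<longleftrightarrow>
      (homocyclic sM P (?M P) \<and> homocyclic sN P (?N P)) \<and>
      (?M P \<noteq> {0} \<and> ?N P \<noteq> {0} \<longrightarrow> homocyclic_exponent sM P (?M P) = homocyclic_exponent sN P (?N P))"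
    (is "?L \<longleftrightarrow> ?R") if P: "prime_ideal P \<and> P \<noteq> {0}" for P
  proof -
    have PM: "dedekind_module_at sM P" and PN: "dedekind_module_at sN P"
      using M.at_prime N.at_prime P by blast+
    have sM: "M.subspace (?M P)" and sN: "N.subspace (?N P)"
      using dedekind_module_at.subspace_pc[OF PM] dedekind_module_at.subspace_pc[OF PN] by auto
    have L: "?L \<longleftrightarrow> (\<exists>l. homogeneous sM (uniformizer P) l (?M P) \<and> homogeneous sN (uniformizer P) l (?N P))"
      unfolding pcMN unfolding sMN_def prod.homogeneous_Times_iff[OF sM sN] ..
    note hM = M.homocyclic_iff_homogeneous[OF PM M.subspace_UNIV] and hN = N.homocyclic_iff_homogeneous[OF PN N.subspace_UNIV]
    note eM = M.homocyclic_exponent_eq[OF PM M.subspace_UNIV] and eN = N.homocyclic_exponent_eq[OF PN N.subspace_UNIV]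
    show ?thesis
    proof
      assume ?L
      then show ?R using L hM hN eM eN by metis
    next
      assume R: ?R
      then obtain l m where l: "homogeneous sM (uniformizer P) l (?M P)" and m: "homogeneous sN (uniformizer P) m (?N P)"
        using hM hN by blast
      consider "?M P = {0}" | "?N P = {0}" | "?M P \<noteq> {0}" "?N P \<noteq> {0}" by blast
      then show ?L
      proof cases
        case 1
        then have "homogeneous sM (uniformizer P) m (?M P)" using m by (simp add: homogeneous_def)
        then show ?thesis using L m by blast
      next
        case 2
        then have "homogeneous sN (uniformizer P) l (?N P)" using l by (simp add: homogeneous_def)
        then show ?thesis using L l by blast
      next
        case 3
        then have "l = m" using R eM[OF l] eN[OF m] by simp
        then show ?thesis using L l m by blast
      qed
    qed
  qed
  have star: "cyclic_module sMN (primary_component sMN P UNIV) \<or>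
        (\<forall>x\<in>primary_component sMN P UNIV. sMN (uniformizer P) x = 0) \<longleftrightarrow>
      ((cyclic_module sM (?M P) \<or> semisimple_module sM (?M P)) \<and>
        (cyclic_module sN (?N P) \<or> semisimple_module sN (?N P))) \<and>
      (?M P \<noteq> {0} \<and> ?N P \<noteq> {0} \<longrightarrow> semisimple_module sM (?M P) \<and> semisimple_module sN (?N P))"
    (is "?cyc \<or> ?kill \<longleftrightarrow> ?R") if P: "prime_ideal P \<and> P \<noteq> {0}" for P
  proof -
    interpret PM: dedekind_module_at sM P using M.at_prime P by blast
    interpret PN: dedekind_module_at sN P using N.at_prime P by blast
    note ssM = PM.semisimple_pc_iff[OF M.subspace_UNIV] and ssN = PN.semisimple_pc_iff[OF N.subspace_UNIV]
    have 0: "0 \<in> ?M P" "0 \<in> ?N P"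
      using M.subspace_0[OF PM.subspace_pc] N.subspace_0[OF PN.subspace_pc] by auto
    have kill: "?kill \<longleftrightarrow> semisimple_module sM (?M P) \<and> semisimple_module sN (?N P)"
    proof -
      have "?kill \<longleftrightarrow> (\<forall>x\<in>?M P. \<forall>y\<in>?N P. sM PM.p x = 0 \<and> sN PM.p y = 0)"
        unfolding pcMN by (auto simp: sMN_def prod.scale_prod zero_prod_def)
      then show ?thesis unfolding ssM ssN using 0 by blast
    qed
    \<comment> \<open>D acts on P-primary elements like a local ring, over which a direct sum of two
      nonzero modules is not cyclic: d with d (a, b) = (a, 0) would lie in P together with 1 -
      d.\<close>
    have no_cyc: False if "?cyc" "?M P \<noteq> {0}" "?N P \<noteq> {0}"
    proof -
      obtain a b where "?M P \<times> ?N P = prod.p.span {(a, b)}"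
        using \<open>?cyc\<close> unfolding pcMN unfolding sMN_def by (auto simp: cyclic_module_def)
      then have ab: "?M P \<times> ?N P = range (\<lambda>d. (sM d a, sN d b))"
        by (simp add: prod.p.span_singleton prod.scale_prod)
      have "(sM 1 a, sN 1 b) \<in> ?M P \<times> ?N P" unfolding ab by blast
      then have "a \<in> ?M P" "b \<in> ?N P" by auto
      have "a \<noteq> 0"
      proof
        assume "a = 0"
        then have "fst ` (?M P \<times> ?N P) \<subseteq> {0}" unfolding ab by auto
        then show False using 0 \<open>?M P \<noteq> {0}\<close> by (auto simp: fst_image_times split: if_splits)
      qed
      have "b \<noteq> 0"
      proof
        assume "b = 0"
        then have "snd ` (?M P \<times> ?N P) \<subseteq> {0}" unfolding ab by auto
        then show False using 0 \<open>?N P \<noteq> {0}\<close> by (auto simp: snd_image_times split: if_splits)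
      qed
      have "(a, 0) \<in> ?M P \<times> ?N P" using \<open>a \<in> ?M P\<close> 0 by blast
      then obtain d where d: "sM d a = a" "sN d b = 0" unfolding ab by force
      have "d \<in> P" using PN.scale_eq_0[OF _ \<open>b \<in> ?N P\<close> d(2)] \<open>b \<noteq> 0\<close> by blast
      have "sM (1 - d) a = 0" using d(1) by (simp add: M.scale_left_diff_distrib)
      then have "1 - d \<in> P" using PM.scale_eq_0[OF _ \<open>a \<in> ?M P\<close>] \<open>a \<noteq> 0\<close> by blast
      then have "1 - d + d \<in> P" using ideal_add[OF PM.ideal_P] \<open>d \<in> P\<close> by blast
      then show False using PM.one_notin by simp
    qed
    have cyc: "cyclic_module sM (?M P) \<and> cyclic_module sN (?N P)" if "?cyc"
      using that prod.cyclic_TimesD[OF _ 0] unfolding pcMN unfolding sMN_def by blast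
    show ?thesis
    proof
      assume "?cyc \<or> ?kill"
      then show ?R using cyc no_cyc kill by blast
    next
      assume R: ?R
      consider "?M P = {0}" | "?N P = {0}" | "?M P \<noteq> {0}" "?N P \<noteq> {0}" by blast
      then show "?cyc \<or> ?kill"
      proof cases
        case 1
        then have "semisimple_module sM (?M P)" unfolding ssM by simp
        then show ?thesis using R kill 1 prod.cyclic_Times_zero(2)[of "?N P"] unfolding pcMN unfolding sMN_def by auto
      next
        case 2
        then have "semisimple_module sN (?N P)" unfolding ssN by simp
        then show ?thesis using R kill 2 prod.cyclic_Times_zero(1)[of "?M P"] unfolding pcMN unfolding sMN_def by auto
      next
        case 3
        then show ?thesis using R kill by blast
      qed
    qed
  qed
  have supp: "P \<in> support sM TM \<inter> support sN TN \<longleftrightarrow> (prime_ideal P \<and> P \<noteq> {0}) \<and> ?M P \<noteq> {0} \<and> ?N P \<noteq> {0}" for P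
    unfolding TM_def TN_def M.support_torsion N.support_torsion by blast
  \<comment> \<open>Stated for a single P with the side conditions inside, so that the equivalence
    rewrites under the quantifier over P.\<close>
  have 1: "(prime_ideal P \<and> P \<noteq> {0} \<longrightarrow>
        (\<exists>l. homogeneous sMN (uniformizer P) l (primary_component sMN P UNIV))) \<longleftrightarrow>
      (prime_ideal P \<and> P \<noteq> {0} \<longrightarrow>
          homocyclic sM P (primary_component sM P TM) \<and>
          homocyclic sN P (primary_component sN P TN)) \<and>
      (prime_ideal P \<and> P \<noteq> {0} \<and>
          primary_component sM P TM \<noteq> {0} \<and> primary_component sN P TN \<noteq> {0} \<longrightarrow>
            homocyclic_exponent sM P (primary_component sM P TM) =
            homocyclic_exponent sN P (primary_component sN P TN))" for P
  proof (cases "prime_ideal P \<and> P \<noteq> {0}")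
    case True
    show ?thesis using homocyclic[OF True] unfolding TM[OF True] TN[OF True] by blast
  qed blast
  have 2: "(prime_ideal P \<and> P \<noteq> {0} \<longrightarrow> cyclic_module sMN (primary_component sMN P UNIV) \<or>
        (\<forall>x\<in>primary_component sMN P UNIV. sMN (uniformizer P) x = 0)) \<longleftrightarrow>
      (prime_ideal P \<and> P \<noteq> {0} \<longrightarrow>
          (cyclic_module sM (primary_component sM P TM) \<or>
            semisimple_module sM (primary_component sM P TM)) \<and>
          (cyclic_module sN (primary_component sN P TN) \<or>
            semisimple_module sN (primary_component sN P TN))) \<and>
      (P \<in> support sM TM \<inter> support sN TN \<longrightarrow>
          semisimple_module sM (primary_component sM P TM) \<and>
          semisimple_module sN (primary_component sN P TN))" for P
  proof (cases "prime_ideal P \<and> P \<noteq> {0}")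
    case True
    show ?thesis using star[OF True] True unfolding TM[OF True] TN[OF True] supp by blast
  next
    case False
    then show ?thesis unfolding supp by blast
  qed
  show ?thesis
    unfolding strongly_C4_star_def rank MN.C4_iff[OF MN.subspace_UNIV assms(2)]
      MN.C4_star_iff[OF MN.subspace_UNIV assms(2)] homogeneous_components_def
    using MN.semi_weak_CS[of UNIV] by (simp only: 1 2) blast
qed

end
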